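(* Let $\tau\in\mathbb H$ satisfy $A+B\tau+C\tau^2=0$ with integers $A,B,C$, $\gcd(A,B,C)=1$, $C>0$; let $D=B^2-4AC$ and $\sqrt D:=2C\tau+B$. Let $\eta\in\mathbb C$ be any number with $1728\,\eta^{24}=E_4(\tau)^3-E_6(\tau)^2$. Then the numbers $$\sqrt D\cdot\frac{E_2^*(\tau)}{\eta^4}\cdot(AC)^2,\qquad \frac{E_4(\tau)}{\eta^8},\qquad \frac{E_6(\tau)}{\eta^{12}}$$ are algebraic integers.
   Context: $q=e^{2\pi i\tau}$, $E_2(\tau)=1-24\sum_{n\ge1}n\frac{q^n}{1-q^n}$, $E_4(\tau)=1+240\sum_{n\ge1}n^3\frac{q^n}{1-q^n}$, $E_6(\tau)=1-504\sum_{n\ge1}n^5\frac{q^n}{1-q^n}$, $E_2^*(\tau)=E_2(\tau)-\frac{3}{\pi\operatorname{Im}\tau}$. *)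

theory Defs
  imports "HOL-Analysis.Analysis" "HOL-Computational_Algebra.Polynomial"
begin

definition qnome :: "complex \<Rightarrow> complex" where
  "qnome \<tau> = exp (2 * of_real pi * \<i> * \<tau>)"

definition lambert :: "nat \<Rightarrow> complex \<Rightarrow> complex" where
  "lambert k \<tau> = (\<Sum>n. of_nat (Suc n) ^ k * qnome \<tau> ^ Suc n / (1 - qnome \<tau> ^ Suc n))"

definition E2 :: "complex \<Rightarrow> complex" where
  "E2 \<tau> = 1 - 24 * lambert 1 \<tau>"

definition E4 :: "complex \<Rightarrow> complex" where
  "E4 \<tau> = 1 + 240 * lambert 3 \<tau>"

definition E6 :: "complex \<Rightarrow> complex" where
  "E6 \<tau> = 1 - 504 * lambert 5 \<tau>"

definition E2star :: "complex \<Rightarrow> complex" where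
  "E2star \<tau> = E2 \<tau> - of_real (3 / (pi * Im \<tau>))"

definition algebraic_integer :: "complex \<Rightarrow> bool" where
  "algebraic_integer x \<longleftrightarrow>
     (\<exists>p :: int poly. lead_coeff p = 1 \<and> poly (map_poly of_int p) x = 0)"

end

theory Submission
  imports Defs "HOL-Complex_Analysis.Complex_Analysis" "Jordan_Normal_Form.Char_Poly"
begin

text \<open>
  Let \<open>j = E4\<^sup>3 / \<Delta>\<close> with \<open>1728 \<Delta> = E4\<^sup>3 - E6\<^sup>2\<close>. A holomorphic modular function on the upper
  half plane whose expansion at the cusp has algebraic integer coefficients is a polynomial in \<open>j\<close>
  with algebraic integer coefficients (subtract powers of \<open>j\<close> until the pole is gone).

  Apply this to symmetric functions over the upper triangular integer matrices \<open>M\<close> of determinant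
  \<open>N\<close>, which the modular group permutes modulo left multiplication. For the product of the
  \<open>j(\<tau>) - j(M \<tau>)\<close> with \<open>N\<close> not a square, the leading coefficient is a unit; since a CM point is
  fixed by an integer matrix of nonsquare determinant, \<open>j(\<tau>)\<close> is an algebraic integer, and hence so
  are \<open>E4 / \<eta>\<^sup>8\<close> and \<open>E6 / \<eta>\<^sup>1\<^sup>2\<close>. The differences \<open>E2\<^sup>* | M - E2\<^sup>*\<close> are holomorphic, and the
  polynomial with roots \<open>(N (E2\<^sup>* | M - E2\<^sup>*))\<^sup>6 / \<Delta>\<close> shows that these are integral over \<open>\<int>[j]\<close>.
  Finally \<open>C \<tau> + B = -1 / (\<tau> / A)\<close> expresses \<open>sqrt D E2\<^sup>*(\<tau>)\<close> through the differences for
  \<open>M = diag(C, 1)\<close> and \<open>M = diag(1, A)\<close>.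

  The transformation laws of \<open>E2\<close>, \<open>E4\<close>, \<open>E6\<close> under inversion are the Taylor coefficients of one
  identity, the inversion formula for the logarithmic derivative of the Jacobi theta function.
\<close>

section \<open>The ring of algebraic integers\<close>

text \<open>The expansions of \<open>jinv (mob M \<tau>)\<close> and
  \<open>E2 (mob M \<tau>)\<close> involve roots of unity exp(2 pi i b/d), so their coefficients are
  in general not integers. Admitting all algebraic integers as coefficients avoids a descent by
  Galois conjugation; the price is that algebraic integers must be known to form an integrally
  closed ring. Symmetric functions over a whole set of classes, instead of a single matrix, are
  invariant under the full modular group, so two generators and one cusp suffice. Two analytic facts
  carry the rest. An invariant function that stays holomorphic at the cusp is constant, by the
  maximum principle. And the discriminant has no zero in the upper half plane, without which neither
  j nor the quotients by it would be holomorphic. The second fact comes from a comparison with the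
  zero-free product q (1-q)^24 (1-q^2)^24 ..., whose transformation law is the integrated form of
  the law for \<open>E2\<close>. A nonsquare determinant matters because j(\<tau>) and j(M \<tau>)
  then have poles of different orders at the cusp and their leading terms cannot cancel.\<close>

definition zspan :: "complex set \<Rightarrow> complex set" where
  "zspan V = {\<Sum>v\<in>V. of_int (c v) * v |c. True}"

lemma zspan_0: "0 \<in> zspan V"
  unfolding zspan_def by (auto intro: exI[of _ "\<lambda>_. 0"])

lemma zspan_base: "finite V \<Longrightarrow> v \<in> V \<Longrightarrow> v \<in> zspan V"
proof -
  assume "finite V" "v \<in> V"
  then have "v = (\<Sum>w\<in>V. of_int (if w = v then 1 else 0) * w)"
    by (simp add: if_distrib[of of_int] if_distribR sum.delta if_distrib[of "\<lambda>t. t * _"] cong: if_cong)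
  then show ?thesis unfolding zspan_def
    by (intro CollectI exI[of _ "\<lambda>w. if w = v then 1 else 0"]) auto
qed

lemma zspan_add:
  assumes "a \<in> zspan V" "b \<in> zspan V" shows "a + b \<in> zspan V"
proof -
  from assms obtain c d where "a = (\<Sum>v\<in>V. of_int (c v) * v)" "b = (\<Sum>v\<in>V. of_int (d v) * v)"
    unfolding zspan_def by auto
  then have "a + b = (\<Sum>v\<in>V. of_int (c v + d v) * v)"
    by (simp add: sum.distrib algebra_simps)
  then show ?thesis unfolding zspan_def by (intro CollectI exI[of _ "\<lambda>v. c v + d v"]) auto
qed

lemma zspan_int_mult:
  assumes "a \<in> zspan V" shows "of_int k * a \<in> zspan V"
proof -
  from assms obtain c where "a = (\<Sum>v\<in>V. of_int (c v) * v)"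
    unfolding zspan_def by auto
  then have "of_int k * a = (\<Sum>v\<in>V. of_int (k * c v) * v)"
    by (simp add: sum_distrib_left algebra_simps)
  then show ?thesis unfolding zspan_def by (intro CollectI exI[of _ "\<lambda>v. k * c v"]) auto
qed

lemma zspan_sum: "(\<And>i. i \<in> I \<Longrightarrow> f i \<in> zspan V) \<Longrightarrow> (\<Sum>i\<in>I. f i) \<in> zspan V"
  by (induction I rule: infinite_finite_induct) (auto intro: zspan_0 zspan_add)

lemma zspan_minus: "a \<in> zspan V \<Longrightarrow> - a \<in> zspan V"
  using zspan_int_mult[of a V "-1"] by simp

text \<open>A number is an algebraic integer exactly when it maps some nonzero finitely generated
  Z-module into itself. Unlike monic polynomials, such modules combine easily under sums and
  products.\<close>

definition stabilizes :: "complex set \<Rightarrow> complex \<Rightarrow> bool" where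
  "stabilizes V x \<longleftrightarrow> (\<forall>v\<in>zspan V. x * v \<in> zspan V)"

lemma stabilizesI:
  assumes "\<And>v. v \<in> V \<Longrightarrow> x * v \<in> zspan V" shows "stabilizes V x"
  unfolding stabilizes_def
proof
  fix v assume "v \<in> zspan V"
  then obtain c where v: "v = (\<Sum>v\<in>V. of_int (c v) * v)" unfolding zspan_def by auto
  have "x * v = (\<Sum>v\<in>V. of_int (c v) * (x * v))"
    unfolding v by (simp add: sum_distrib_left algebra_simps)
  also have "\<dots> \<in> zspan V" by (intro zspan_sum zspan_int_mult assms)
  finally show "x * v \<in> zspan V" .
qed

lemma stabilizes_add: "stabilizes V x \<Longrightarrow> stabilizes V y \<Longrightarrow> stabilizes V (x + y)"
  unfolding stabilizes_def by (auto simp: algebra_simps intro: zspan_add)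

lemma stabilizes_mult: "stabilizes V x \<Longrightarrow> stabilizes V y \<Longrightarrow> stabilizes V (x * y)"
  unfolding stabilizes_def by (simp add: mult.assoc)

text \<open>Determinant trick: multiplication by x acts on the generators through an integer matrix,
  so the vector of generators is an eigenvector and x is a root of a monic integer polynomial. The
  element \<open>w\<close> keeps that vector nonzero.\<close>

lemma stabilizes_imp_algebraic_int:
  assumes V: "finite V" "w \<in> V" "w \<noteq> 0" and x: "stabilizes V x"
  shows "algebraic_int x"
proof -
  obtain vs where vs: "set vs = V" "distinct vs"
    using finite_distinct_list[OF V(1)] by auto
  define n where "n = length vs"
  have "\<exists>c. x * vs ! i = (\<Sum>v\<in>V. of_int (c v) * v)" if "i < n" for i
  proof -
    have "vs ! i \<in> zspan V" using that vs V(1) by (auto intro!: zspan_base simp: n_def)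
    with x show ?thesis unfolding stabilizes_def zspan_def by auto
  qed
  then obtain c where c: "\<And>i. i < n \<Longrightarrow> x * vs ! i = (\<Sum>v\<in>V. of_int (c i v) * v)" by metis
  define M where "M = mat n n (\<lambda>(i, j). c i (vs ! j))"
  have M: "M \<in> carrier_mat n n" by (simp add: M_def)
  have M': "map_mat complex_of_int M \<in> carrier_mat n n" using M by auto
  have sumV: "(\<Sum>v\<in>V. f v) = (\<Sum>j = 0..<n. f (vs ! j))" for f :: "complex \<Rightarrow> complex"
    by (subst sum_list_distinct_conv_sum_set[symmetric, OF vs(2), unfolded vs(1)])
       (simp add: sum_list_sum_nth n_def)
  have "eigenvector (map_mat complex_of_int M) (vec_of_list vs) x"
    unfolding eigenvector_def
  proof (intro conjI)
    show "vec_of_list vs \<in> carrier_vec (dim_row (map_mat complex_of_int M))"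
      unfolding carrier_vec_def by (simp add: M_def n_def)
    from V vs obtain i where "i < n" "vs ! i \<noteq> 0" by (auto simp: n_def in_set_conv_nth)
    then show "vec_of_list vs \<noteq> 0\<^sub>v (dim_row (map_mat complex_of_int M))"
      by (metis M M' carrier_matD(1) index_zero_vec(1) vec_of_list_index)
    show "map_mat complex_of_int M *\<^sub>v vec_of_list vs = x \<cdot>\<^sub>v vec_of_list vs"
      by (rule eq_vecI)
         (auto simp: M_def n_def[symmetric] scalar_prod_def vec_of_list_index c sumV)
  qed
  then have "eigenvalue (map_mat complex_of_int M) x" unfolding eigenvalue_def by blast
  then have "poly (char_poly (map_mat complex_of_int M)) x = 0"
    using eigenvalue_root_char_poly[OF M'] by simp
  also have "char_poly (map_mat complex_of_int M) = map_poly of_int (char_poly M)"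
    by (rule of_int_hom.char_poly_hom[OF M])
  finally show ?thesis
    using degree_monic_char_poly[OF M] unfolding algebraic_int_altdef_ipoly by auto
qed

text \<open>\<open>W\<close> is generated by the products v x^i with i < deg p, and x^n is rewritten
  by p. The coefficients of p need not be integers, they only have to act on \<open>V\<close>; this
  is what later gives integral closure. Whatever acted on \<open>V\<close> still acts on
  \<open>W\<close>, so numbers can be adjoined one at a time.\<close>

lemma extend_stabilized:
  assumes V: "finite V" "1 \<in> V" and p: "lead_coeff p = 1" "poly p x = 0"
    and stab: "\<And>i. i < degree p \<Longrightarrow> stabilizes V (coeff p i)"
  obtains W where "finite W" "1 \<in> W" "stabilizes W x" "\<And>y. stabilizes V y \<Longrightarrow> stabilizes W y"
proof -
  define n where "n = degree p"
  have n0: "n > 0"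
    using p by (intro Nat.gr0I) (auto simp: n_def elim!: degree_eq_zeroE)
  define W where "W = (\<lambda>(v, i). v * x ^ i) ` (V \<times> {..<n})"
  have fin: "finite W" using V by (simp add: W_def)
  have one: "1 \<in> W" unfolding W_def using V n0 by (auto intro!: image_eqI[of _ _ "(1, 0)"])
  have lift: "u * x ^ i \<in> zspan W" if u: "u \<in> zspan V" and i: "i < n" for u i
  proof -
    from u obtain c where "u = (\<Sum>v\<in>V. of_int (c v) * v)" unfolding zspan_def by auto
    then have "u * x ^ i = (\<Sum>v\<in>V. of_int (c v) * (v * x ^ i))"
      by (simp add: sum_distrib_right mult.assoc)
    also have "\<dots> \<in> zspan W"
      by (intro zspan_sum zspan_int_mult zspan_base fin) (use i in \<open>auto simp: W_def\<close>)
    finally show ?thesis .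
  qed
  have keep: "stabilizes W y" if y: "stabilizes V y" for y
  proof (rule stabilizesI)
    fix w assume "w \<in> W"
    then obtain v i where vi: "v \<in> V" "i < n" "w = v * x ^ i" by (auto simp: W_def)
    have "y * v \<in> zspan V" using y zspan_base[OF V(1) vi(1)] unfolding stabilizes_def by auto
    from lift[OF this vi(2)] show "y * w \<in> zspan W" by (simp add: vi mult.assoc)
  qed
  have "stabilizes W x"
  proof (rule stabilizesI)
    fix w assume "w \<in> W"
    then obtain v i where vi: "v \<in> V" "i < n" "w = v * x ^ i" by (auto simp: W_def)
    show "x * w \<in> zspan W"
    proof (cases "Suc i < n")
      case True
      have "x * w = v * x ^ Suc i" by (simp add: vi)
      then show ?thesis using lift[OF zspan_base[OF V(1) vi(1)] True] by (simp only:)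
    next
      case False
      then have i: "Suc i = n" using vi by simp
      have "0 = (\<Sum>k\<le>n. coeff p k * x ^ k)" using p by (simp add: poly_altdef n_def)
      also have "{..n} = insert n {..<n}" by auto
      finally have "x ^ n = - (\<Sum>k<n. coeff p k * x ^ k)" using p by (simp add: n_def add_eq_0_iff)
      then have "v * x ^ n = - (\<Sum>k<n. (coeff p k * v) * x ^ k)"
        by (simp add: sum_distrib_left mult_ac)
      moreover have "x * w = v * x ^ n" by (simp add: vi i[symmetric])
      ultimately have "x * w = - (\<Sum>k<n. (coeff p k * v) * x ^ k)" by simp
      also have "\<dots> \<in> zspan W"
      proof (intro zspan_minus zspan_sum lift)
        fix k assume "k \<in> {..<n}"
        then show "coeff p k * v \<in> zspan V" "k < n"
          using stab[of k] zspan_base[OF V(1) vi(1)] unfolding stabilizes_def n_def by auto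
      qed
      finally show ?thesis .
    qed
  qed
  with fin one keep show ?thesis using that by blast
qed

lemma stabilizes_of_int: "stabilizes V (of_int k)"
  unfolding stabilizes_def by (auto intro: zspan_int_mult)

lemma common_stabilized:
  assumes "finite S" "\<And>x. x \<in> S \<Longrightarrow> algebraic_int x"
  obtains W where "finite W" "1 \<in> W" "\<And>x. x \<in> S \<Longrightarrow> stabilizes W x"
proof -
  have "\<exists>W. finite W \<and> 1 \<in> W \<and> (\<forall>x\<in>S. stabilizes W x)"
    using assms
  proof (induction S rule: finite_induct)
    case empty
    show ?case by (rule exI[of _ "{1}"]) auto
  next
    case (insert x S)
    then obtain V where V: "finite V" "1 \<in> V" "\<forall>x\<in>S. stabilizes V x" by auto
    from insert.prems[of x] obtain p where p: "poly (map_poly of_int p) x = 0" "lead_coeff p = (1 :: int)"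
      unfolding algebraic_int_altdef_ipoly by auto
    show ?case
    proof (rule extend_stabilized[OF V(1,2), of "map_poly of_int p" x])
      show "stabilizes V (coeff (map_poly of_int p) i)" for i
        by (simp add: coeff_map_poly stabilizes_of_int)
    qed (use p V in \<open>auto simp: degree_map_poly coeff_map_poly\<close>)
  qed
  then show ?thesis using that by blast
qed

theorem algebraic_int_add [intro]:
  fixes x y :: complex assumes "algebraic_int x" "algebraic_int y" shows "algebraic_int (x + y)"
proof -
  obtain W where "finite W" "1 \<in> W" "\<And>z. z \<in> {x, y} \<Longrightarrow> stabilizes W z"
    using common_stabilized[of "{x, y}"] assms by auto
  then show ?thesis by (intro stabilizes_imp_algebraic_int[of W 1] stabilizes_add) auto
qed

theorem algebraic_int_mult [intro]:
  fixes x y :: complex assumes "algebraic_int x" "algebraic_int y" shows "algebraic_int (x * y)"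
proof -
  obtain W where "finite W" "1 \<in> W" "\<And>z. z \<in> {x, y} \<Longrightarrow> stabilizes W z"
    using common_stabilized[of "{x, y}"] assms by auto
  then show ?thesis by (intro stabilizes_imp_algebraic_int[of W 1] stabilizes_mult) auto
qed

theorem algebraic_int_integrally_closed:
  fixes x :: complex
  assumes "lead_coeff p = 1" "poly p x = 0" "\<And>i. algebraic_int (coeff p i)"
  shows "algebraic_int x"
proof -
  obtain V where V: "finite V" "1 \<in> V" "\<And>z. z \<in> set (coeffs p) \<Longrightarrow> stabilizes V z"
  proof (rule common_stabilized[of "set (coeffs p)"])
    show "\<And>x. x \<in> set (coeffs p) \<Longrightarrow> algebraic_int x"
      using assms(3) by (metis in_set_conv_nth nth_default_coeffs_eq nth_default_nth)
  qed auto
  have "stabilizes V (coeff p i)" if "i < degree p" for i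
    using that assms(1) by (intro V(3) coeff_in_coeffs) auto
  then obtain W where "finite W" "1 \<in> W" "stabilizes W x"
    using extend_stabilized[OF V(1,2) assms(1,2)] by metis
  then show ?thesis by (intro stabilizes_imp_algebraic_int[of W 1]) auto
qed

lemma algebraic_int_diff [intro]:
  fixes x y :: complex shows "algebraic_int x \<Longrightarrow> algebraic_int y \<Longrightarrow> algebraic_int (x - y)"
  using algebraic_int_add[of x "- y"] by simp

lemma algebraic_int_power [intro]:
  fixes x :: complex shows "algebraic_int x \<Longrightarrow> algebraic_int (x ^ n)"
  by (induction n) auto

lemma algebraic_int_sum [intro]:
  fixes f :: "'b \<Rightarrow> complex"
  shows "(\<And>i. i \<in> I \<Longrightarrow> algebraic_int (f i)) \<Longrightarrow> algebraic_int (\<Sum>i\<in>I. f i)"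
  by (induction I rule: infinite_finite_induct) auto

lemma algebraic_int_power_imp:
  fixes x :: complex assumes "algebraic_int (x ^ n)" "n > 0" shows "algebraic_int x"
  by (rule algebraic_int_root[OF assms(1), of "monom 1 n"])
     (use assms(2) in \<open>auto simp: poly_monom degree_monom_eq\<close>)

lemma algebraic_integer_iff: "algebraic_integer x \<longleftrightarrow> algebraic_int x"
  unfolding algebraic_integer_def algebraic_int_altdef_ipoly by auto

section \<open>Power series in the nome\<close>

lemma qnome_add: "qnome (a + b) = qnome a * qnome b"
  by (simp add: qnome_def exp_add ring_distribs)

lemma norm_qnome: "norm (qnome z) = exp (- 2 * pi * Im z)"
  by (simp add: qnome_def)

lemma qnome_nonzero [simp]: "qnome z \<noteq> 0"
  by (simp add: qnome_def)

lemma qnome_1 [simp]: "qnome 1 = 1"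
  by (simp add: qnome_def exp_eq_1)

lemma qnome_minus: "qnome (- z) = inverse (qnome z)"
  by (simp add: qnome_def exp_minus)

lemma qnome_of_nat_mult: "qnome (of_nat n * z) = qnome z ^ n"
  unfolding qnome_def exp_of_nat_mult[symmetric] by (simp add: mult_ac)

lemma norm_qnome_less_1 [simp]: "Im z > 0 \<Longrightarrow> norm (qnome z) < 1"
  by (simp add: norm_qnome)

lemma holomorphic_on_qnome [holomorphic_intros]:
  "f holomorphic_on A \<Longrightarrow> (\<lambda>z. qnome (f z)) holomorphic_on A"
  unfolding qnome_def by (intro holomorphic_intros)

lemma deriv_qnome: "(qnome has_field_derivative 2 * pi * \<i> * qnome z) (at z)"
  unfolding qnome_def by (auto intro!: derivative_eq_intros)

text \<open>The operator q d/dq. Along q = \<open>qnome z\<close> it is d/dz divided by 2 pi i, and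
  it multiplies the n-th coefficient by n.\<close>

definition theta :: "complex fps \<Rightarrow> complex fps" where
  "theta F = fps_X * fps_deriv F"

lemma theta_nth: "fps_nth ((theta ^^ k) F) n = of_nat n ^ k * fps_nth F n"
  by (induction k) (auto simp: theta_def)

lemma conv_radius_theta: "fps_conv_radius (theta F) \<ge> fps_conv_radius F"
proof -
  have "fps_conv_radius F \<le> min (fps_conv_radius (fps_X :: complex fps)) (fps_conv_radius (fps_deriv F))"
    using fps_conv_radius_deriv[of F] by simp
  also have "\<dots> \<le> fps_conv_radius (theta F)" unfolding theta_def by (rule fps_conv_radius_mult)
  finally show ?thesis .
qed

lemma conv_radius_theta_pow: "fps_conv_radius ((theta ^^ k) F) \<ge> fps_conv_radius F"
  by (induction k) (auto intro: order_trans conv_radius_theta)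

lemma conv_radius_nat_power_mult:
  fixes f :: "nat \<Rightarrow> complex"
  shows "conv_radius (\<lambda>n. of_nat n ^ k * f n) \<ge> conv_radius f"
proof -
  have "fps_nth ((theta ^^ k) (Abs_fps f)) = (\<lambda>n. of_nat n ^ k * f n)"
    by (simp add: fun_eq_iff theta_nth)
  with conv_radius_theta_pow[of "Abs_fps f" k] show ?thesis by (simp add: fps_conv_radius_def)
qed

lemma deriv_eval_fps_qnome:
  assumes "ereal (norm (qnome (a * z))) < fps_conv_radius F"
  shows "((\<lambda>z. eval_fps F (qnome (a * z))) has_field_derivative
           (2 * pi * \<i> * a) * eval_fps (theta F) (qnome (a * z))) (at z)"
proof -
  have r: "ereal (norm (qnome (a * z))) < fps_conv_radius (fps_deriv F)"
    using assms fps_conv_radius_deriv less_le_trans by blast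
  have "((\<lambda>z. qnome (a * z)) has_field_derivative (2 * pi * \<i> * a) * qnome (a * z)) (at z)"
    unfolding qnome_def by (auto intro!: derivative_eq_intros)
  from DERIV_chain2[OF has_field_derivative_eval_fps[OF assms] this] show ?thesis
    using r by (simp add: theta_def eval_fps_mult mult_ac)
qed

lemma higher_deriv_eval_fps_qnome:
  assumes "open S" "z \<in> S" "\<And>w. w \<in> S \<Longrightarrow> ereal (norm (qnome (a * w))) < fps_conv_radius F"
  shows "(deriv ^^ n) (\<lambda>z. eval_fps F (qnome (a * z))) z
           = (2 * pi * \<i> * a) ^ n * eval_fps ((theta ^^ n) F) (qnome (a * z))"
  using assms(2)
proof (induction n arbitrary: z)
  case (Suc n)
  have r: "ereal (norm (qnome (a * z))) < fps_conv_radius ((theta ^^ n) F)"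
    using assms(3)[OF Suc.prems] conv_radius_theta_pow less_le_trans by blast
  have "((\<lambda>z. (2 * pi * \<i> * a) ^ n * eval_fps ((theta ^^ n) F) (qnome (a * z)))
           has_field_derivative ((2 * pi * \<i> * a) ^ Suc n * eval_fps ((theta ^^ Suc n) F) (qnome (a * z)))) (at z)"
    using DERIV_cmult[OF deriv_eval_fps_qnome[OF r], of "(2 * pi * \<i> * a) ^ n"] by (simp add: mult_ac)
  then have "((deriv ^^ n) (\<lambda>z. eval_fps F (qnome (a * z)))
           has_field_derivative ((2 * pi * \<i> * a) ^ Suc n * eval_fps ((theta ^^ Suc n) F) (qnome (a * z)))) (at z)"
    by (rule has_field_derivative_transform_within_open[OF _ assms(1) Suc.prems]) (simp add: Suc.IH)
  then show ?case by (simp add: DERIV_imp_deriv)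
qed auto

section \<open>Lambert series as power series\<close>

text \<open>Coefficients in y of the series with terms q^n y^n / (1 - q^n). Applying
  \<open>theta\<close> k times and setting y = 1 gives the Lambert series of exponent k. At n = 0
  the convention 1 / 0 = 0 makes the term vanish.\<close>

definition lcoeff :: "complex \<Rightarrow> nat \<Rightarrow> complex" where
  "lcoeff q n = q ^ n / (1 - q ^ n)"

lemma lcoeff_0 [simp]: "lcoeff q 0 = 0"
  by (simp add: lcoeff_def)

lemma norm_1_minus_power_ge:
  fixes q :: complex
  assumes "norm q < 1" "n > 0" shows "norm (1 - q ^ n) \<ge> 1 - norm q"
proof -
  have "norm q ^ n \<le> norm q ^ 1" using assms by (intro power_decreasing) auto
  moreover have "norm (1 - q ^ n) \<ge> norm (1 :: complex) - norm (q ^ n)" by (rule norm_triangle_ineq2)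
  ultimately show ?thesis by (simp add: norm_power)
qed

lemma norm_lcoeff_le:
  assumes "norm q < 1" shows "norm (lcoeff q n) \<le> norm q ^ n / (1 - norm q)"
proof (cases "n = 0")
  case False
  then show ?thesis using norm_1_minus_power_ge[OF assms, of n] assms
    by (auto simp: lcoeff_def norm_divide norm_power intro!: divide_left_mono mult_pos_pos)
qed (use assms in auto)

lemma conv_radius_lcoeff:
  assumes "norm q < 1" "q \<noteq> 0"
  shows "conv_radius (lcoeff q) \<ge> inverse (norm q)"
proof (rule conv_radius_geI_ex')
  fix r :: real assume r: "0 < r" "ereal r < ereal (inverse (norm q))"
  then have "r * norm q < 1" using assms(2) by (simp add: field_simps)
  then have "summable (\<lambda>n. (norm q * r) ^ n / (1 - norm q))"
    using r by (intro summable_divide summable_geometric) (auto simp: mult_ac)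
  then show "summable (\<lambda>n. lcoeff q n * complex_of_real r ^ n)"
    by (rule summable_comparison_test'[of _ 0])
       (use norm_lcoeff_le[OF assms(1)] r in \<open>auto simp: norm_mult norm_power power_mult_distrib
          intro!: mult_right_mono simp flip: times_divide_eq_left\<close>)
qed

lemma lambert_eq_suminf: "lambert k \<tau> = (\<Sum>n. of_nat n ^ k * lcoeff (qnome \<tau>) n)"
  if "Im \<tau> > 0"
proof -
  define q where "q = qnome \<tau>"
  have q: "norm q < 1" "q \<noteq> 0" using that by (auto simp: q_def)
  have "ereal (norm (1 :: complex)) < conv_radius (\<lambda>n. of_nat n ^ k * lcoeff q n)"
  proof -
    have "ereal (norm (1 :: complex)) < inverse (norm q)" using q by (simp add: field_simps)
    also have "\<dots> \<le> conv_radius (lcoeff q)" by (rule conv_radius_lcoeff[OF q])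
    also have "\<dots> \<le> conv_radius (\<lambda>n. of_nat n ^ k * lcoeff q n)" by (rule conv_radius_nat_power_mult)
    finally show ?thesis .
  qed
  from summable_in_conv_radius[OF this] have "summable (\<lambda>n. of_nat n ^ k * lcoeff q n)" by simp
  from suminf_split_head[OF this] show ?thesis
    unfolding lambert_def q_def[symmetric] by (simp add: lcoeff_def)
qed

lemma lambert_eq_eval_fps:
  assumes "Im \<tau> > 0"
  shows "lambert k \<tau> = eval_fps ((theta ^^ k) (Abs_fps (lcoeff (qnome \<tau>)))) 1"
  using assms by (simp add: lambert_eq_suminf eval_fps_def theta_nth)

text \<open>For n = 0 the set of divisors is infinite, so the sum is 0 by convention and the
  constant term vanishes.\<close>

definition sigma_fps :: "nat \<Rightarrow> complex fps" where
  "sigma_fps k = Abs_fps (\<lambda>n. of_nat (\<Sum>d | d dvd n. d ^ k))"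

lemma sigma_fps_nth: "fps_nth (sigma_fps k) n = of_nat (\<Sum>d | d dvd n. d ^ k)"
  by (simp add: sigma_fps_def)

lemma sigma_fps_nth_0 [simp]: "fps_nth (sigma_fps k) 0 = 0"
  by (simp add: sigma_fps_nth)

lemma sigma_fps_nth_1 [simp]: "fps_nth (sigma_fps k) (Suc 0) = 1"
  by (simp add: sigma_fps_nth)

lemma conv_radius_antimono:
  fixes f g :: "nat \<Rightarrow> complex"
  assumes "\<And>n. norm (f n) \<le> norm (g n)"
  shows "conv_radius g \<le> conv_radius f"
proof (rule conv_radius_geI_ex')
  fix r :: real assume r: "0 < r" "ereal r < conv_radius g"
  then have "ereal (norm (of_real r :: complex)) < conv_radius g" by simp
  from abs_summable_in_conv_radius[OF this]
  show "summable (\<lambda>n. f n * of_real r ^ n)"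
    by (rule summable_comparison_test'[of _ 0])
       (use assms in \<open>auto simp only: norm_mult intro!: mult_right_mono norm_ge_zero\<close>)
qed

text \<open>A crude bound suffices: n has at most n divisors, so the sum of their k-th powers is at
  most n^(k+1).\<close>

lemma conv_radius_sigma_fps: "fps_conv_radius (sigma_fps k) \<ge> 1"
proof -
  have "conv_radius (\<lambda>n. of_nat n ^ Suc k * (1 :: complex)) \<ge> conv_radius (\<lambda>n::nat. 1 :: complex)"
    by (rule conv_radius_nat_power_mult)
  moreover have "conv_radius (\<lambda>n::nat. 1 :: complex) = 1"
    by (rule conv_radius_ratio_limit_nonzero[of _ 1]) (auto simp: one_ereal_def)
  ultimately have cr: "1 \<le> conv_radius (\<lambda>n. of_nat n ^ Suc k * (1 :: complex))" by simp
  have bound: "norm (fps_nth (sigma_fps k) n) \<le> norm (of_nat n ^ Suc k * (1 :: complex))" for n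
  proof (cases "n = 0")
    case False
    have "(\<Sum>d | d dvd n. d ^ k) \<le> card {d. d dvd n} * n ^ k"
      using sum_bounded_above[of "{d. d dvd n}" "\<lambda>d. d ^ k" "n ^ k"] False
      by (simp add: power_mono dvd_imp_le)
    also have "card {d. d dvd n} \<le> n"
    proof -
      have "{d. d dvd n} \<subseteq> {1..n}"
        using False dvd_pos_nat[of n] by (fastforce simp: Suc_le_eq dest: dvd_imp_le)
      from card_mono[OF _ this] show ?thesis by simp
    qed
    finally have "(\<Sum>d | d dvd n. d ^ k) \<le> n ^ Suc k" by simp
    then have "real (\<Sum>d | d dvd n. d ^ k) \<le> real (n ^ Suc k)" by (rule of_nat_mono)
    then show ?thesis by (simp only: sigma_fps_nth norm_of_nat mult_1_right norm_power of_nat_power)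
  qed simp
  show ?thesis unfolding fps_conv_radius_def
    by (rule order_trans[OF cr conv_radius_antimono]) (rule bound)
qed

text \<open>Both sides sum m^k q^(m r) over m, r \<ge> 1: once row by row through geometric series,
  once grouped by the product n = m r.\<close>

lemma lambert_eq_sigma_fps:
  assumes \<tau>: "Im \<tau> > 0"
  shows "lambert k \<tau> = eval_fps (sigma_fps k) (qnome \<tau>)"
proof -
  define q where "q = qnome \<tau>"
  have q: "norm q < 1" "q \<noteq> 0" using \<tau> by (auto simp: q_def)
  define S where "S = Sigma {1::nat..} (\<lambda>_. {1::nat..})"
  define g where "g = (\<lambda>(m::nat, r::nat). of_nat m ^ k * q ^ (m * r))"
  \<comment> \<open>With |q| in place of q, the Lambert series is the iterated sum of the norms, so
    its convergence yields absolute summability of the double series.\<close>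
  have summable_real: "summable (\<lambda>n. norm (of_nat n ^ k * lcoeff (of_real (norm q)) n))"
  proof -
    have "ereal (norm (1 :: complex)) < inverse (norm q)" using q by (simp add: field_simps)
    also have "\<dots> \<le> conv_radius (\<lambda>n. of_nat n ^ k * lcoeff (of_real (norm q)) n)"
      using conv_radius_lcoeff[of "of_real (norm q)"] q
      by (intro order_trans[OF _ conv_radius_nat_power_mult]) auto
    finally show ?thesis
      using abs_summable_in_conv_radius[of 1 "\<lambda>n. of_nat n ^ k * lcoeff (of_real (norm q)) n"] by simp
  qed
  have norm_lc: "norm (lcoeff (of_real (norm q)) n) = norm q ^ n / (1 - norm q ^ n)" if "n > 0" for n
  proof -
    have "norm q ^ n \<le> 1" using q by (intro power_le_one) auto
    then have "norm (complex_of_real (norm q ^ n / (1 - norm q ^ n))) = norm q ^ n / (1 - norm q ^ n)"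
      unfolding norm_of_real by simp
    then show ?thesis by (simp add: lcoeff_def)
  qed
  have lt1: "norm q ^ m < 1" if "m > 0" for m
    using q that by (simp add: power_less_one_iff)
  have "(\<lambda>p. norm (g p)) summable_on S"
    unfolding S_def
  proof (rule summable_on_SigmaI)
    show "((\<lambda>r. norm (g (m, r))) has_sum norm (of_nat m ^ k * lcoeff (of_real (norm q)) m)) {1..}"
      if "m \<in> {1..}" for m
    proof -
      have "((\<lambda>r. (norm q ^ m) ^ r) has_sum (norm q ^ m / (1 - norm q ^ m))) {1..}"
        by (rule has_sum_geometric_from_1) (use lt1[of m] that in auto)
      then have "((\<lambda>r. real m ^ k * (norm q ^ m) ^ r) has_sum (real m ^ k * (norm q ^ m / (1 - norm q ^ m)))) {1..}"
        by (rule has_sum_cmult_right)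
      then show ?thesis using that
        by (simp add: g_def norm_mult norm_power norm_lc power_mult)
    qed
    show "(\<lambda>m. norm (of_nat m ^ k * lcoeff (of_real (norm q)) m)) summable_on {1..}"
      using norm_summable_imp_summable_on[of "\<lambda>n. norm (of_nat n ^ k * lcoeff (of_real (norm q)) n)"]
        summable_real by (auto intro: summable_on_subset)
  qed auto
  then have "g summable_on S" by (rule abs_summable_summable)
  then obtain s where s: "(g has_sum s) S" using summable_on_def by blast
  have "((\<lambda>m. of_nat m ^ k * lcoeff q m) has_sum s) {1..}"
  proof (rule has_sum_Sigma'[OF s[unfolded S_def]])
    fix m :: nat assume m: "m \<in> {1..}"
    have "((\<lambda>r. (q ^ m) ^ r) has_sum (q ^ m / (1 - q ^ m))) {1..}"
      by (rule has_sum_geometric_from_1) (use lt1[of m] m in \<open>auto simp: norm_power\<close>)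
    then have "((\<lambda>r. of_nat m ^ k * (q ^ m) ^ r) has_sum (of_nat m ^ k * (q ^ m / (1 - q ^ m)))) {1..}"
      by (rule has_sum_cmult_right)
    then show "((\<lambda>r. g (m, r)) has_sum of_nat m ^ k * lcoeff q m) {1..}"
      by (simp add: g_def lcoeff_def power_mult)
  qed
  then have "((\<lambda>m. of_nat m ^ k * lcoeff q m) has_sum s) UNIV"
    by (rule has_sum_cong_neutral[THEN iffD1, rotated 3]) (auto simp: not_le)
  then have 1: "s = lambert k \<tau>"
    using has_sum_imp_sums sums_unique lambert_eq_suminf[OF \<tau>] unfolding q_def by metis
  have "((\<lambda>(n, d). g (d, n div d)) has_sum s) (Sigma {1..} (\<lambda>n. {d. d dvd n}))"
    by (rule has_sum_reindex_bij_witness[THEN iffD1, OF _ _ _ _ _ _ s,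
          of "\<lambda>(n, d). (d, n div d)" "\<lambda>(m, r). (m * r, m)"])
       (auto simp: S_def g_def Suc_le_eq intro: Nat.gr0I dest: dvd_div_eq_0_iff[THEN iffD1, rotated])
  then have "((\<lambda>n. fps_nth (sigma_fps k) n * q ^ n) has_sum s) {1..}"
  proof (rule has_sum_Sigma')
    fix n :: nat assume "n \<in> {1..}"
    then have n: "n > 0" by auto
    have "(\<Sum>d | d dvd n. of_nat d ^ k * q ^ (d * (n div d))) = fps_nth (sigma_fps k) n * q ^ n"
      by (simp add: sigma_fps_nth sum_distrib_right)
    with has_sum_finite[of "{d. d dvd n}" "\<lambda>d. of_nat d ^ k * q ^ (d * (n div d))"] n
    show "((\<lambda>d. case (n, d) of (n, d) \<Rightarrow> g (d, n div d)) has_sum fps_nth (sigma_fps k) n * q ^ n) {d. d dvd n}"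
      by (simp add: g_def)
  qed
  then have "((\<lambda>n. fps_nth (sigma_fps k) n * q ^ n) has_sum s) UNIV"
    by (rule has_sum_cong_neutral[THEN iffD1, rotated 3]) (auto simp: not_le)
  then have "s = eval_fps (sigma_fps k) q"
    using has_sum_imp_sums sums_unique unfolding eval_fps_def by metis
  with 1 show ?thesis by (simp add: q_def)
qed

section \<open>A Kronecker-type function\<close>

abbreviation lambert_fps :: "complex \<Rightarrow> complex fps" where
  "lambert_fps \<tau> \<equiv> Abs_fps (lcoeff (qnome \<tau>))"

lemma qnome_in_conv_radius:
  assumes "\<bar>Im z\<bar> < Im \<tau>"
  shows "ereal (norm (qnome z)) < fps_conv_radius (lambert_fps \<tau>)"
proof -
  have q: "norm (qnome \<tau>) < 1" using assms by auto
  have "- Im z < Im \<tau>" using assms by (simp add: abs_less_iff)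
  then have "2 * pi * (- Im z) < 2 * pi * Im \<tau>" by (intro mult_strict_left_mono) auto
  then have "norm (qnome z) < inverse (norm (qnome \<tau>))"
    by (simp add: norm_qnome flip: exp_minus)
  then have "ereal (norm (qnome z)) < ereal (inverse (norm (qnome \<tau>)))" by simp
  also have "\<dots> \<le> fps_conv_radius (lambert_fps \<tau>)"
    using conv_radius_lcoeff[OF q] by (simp add: fps_conv_radius_def)
  finally show ?thesis .
qed

text \<open>Replacing y by q y multiplies the n-th term by q^n, so the difference cancels the
  denominator 1 - q^n and leaves the geometric series in q y. Both points must lie in the strip
  where the series in y converges.\<close>

lemma lambert_fps_shift:
  assumes "\<bar>Im z\<bar> < Im \<tau>" "\<bar>Im (z + \<tau>)\<bar> < Im \<tau>"
  shows "eval_fps (lambert_fps \<tau>) (qnome z) - eval_fps (lambert_fps \<tau>) (qnome (z + \<tau>))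
           = qnome (z + \<tau>) / (1 - qnome (z + \<tau>))"
proof -
  define y where "y = qnome z"
  define q where "q = qnome \<tau>"
  have "0 < Im \<tau>" using assms by linarith
  then have q1: "norm q < 1" by (simp add: q_def)
  have qy: "qnome (z + \<tau>) = q * y" by (simp add: qnome_add q_def y_def)
  have "0 < Im (z + \<tau>)" using assms by (simp add: abs_less_iff)
  then have n: "norm (q * y) < 1" unfolding qy[symmetric] by simp
  have "(\<lambda>n. lcoeff q n * y ^ n - lcoeff q n * (q * y) ^ n)
          sums (eval_fps (lambert_fps \<tau>) y - eval_fps (lambert_fps \<tau>) (q * y))"
    using sums_eval_fps[OF qnome_in_conv_radius[OF assms(1)]] sums_eval_fps[OF qnome_in_conv_radius[OF assms(2)]]
    by (intro sums_diff) (simp_all add: qy y_def[symmetric] q_def[symmetric])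
  moreover have "(\<lambda>n. lcoeff q n * y ^ n - lcoeff q n * (q * y) ^ n) sums (q * y / (1 - q * y) + 0)"
  proof -
    have "lcoeff q (Suc n) * y ^ Suc n - lcoeff q (Suc n) * (q * y) ^ Suc n = (q * y) * (q * y) ^ n" for n
    proof -
      have q0: "q \<noteq> 0" by (simp add: q_def)
      have "norm (q ^ Suc n) < 1" using q1 q0 unfolding norm_power by (intro power_Suc_less_one) auto
      then have "1 - q ^ Suc n \<noteq> 0" by auto
      moreover have "lcoeff q (Suc n) * y ^ Suc n - lcoeff q (Suc n) * (q * y) ^ Suc n
          = lcoeff q (Suc n) * (1 - q ^ Suc n) * y ^ Suc n"
        unfolding power_mult_distrib by (simp add: ring_distribs del: power_Suc)
      ultimately have "lcoeff q (Suc n) * y ^ Suc n - lcoeff q (Suc n) * (q * y) ^ Suc n = q ^ Suc n * y ^ Suc n"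
        by (simp add: lcoeff_def del: power_Suc)
      then show ?thesis by (simp add: power_mult_distrib)
    qed
    with sums_mult[OF geometric_sums[OF n], of "q * y"]
    have "(\<lambda>n. lcoeff q (Suc n) * y ^ Suc n - lcoeff q (Suc n) * (q * y) ^ Suc n) sums (q * y / (1 - q * y))"
      by simp
    from sums_Suc[OF this] show ?thesis by simp
  qed
  ultimately show ?thesis unfolding qy y_def[symmetric] using sums_unique2 by fastforce
qed

text \<open>This includes the poles: there both sides are divisions by zero, hence 0.\<close>

lemma cot_pi_eq: "cot (of_real pi * z) = \<i> * (qnome z + 1) / (qnome z - 1)"
proof -
  define w where "w = exp (\<i> * (of_real pi * z))"
  have w0: "w \<noteq> 0" by (simp add: w_def)
  have y: "qnome z = w * w" by (simp add: qnome_def w_def mult_ac flip: exp_add)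
  have c: "cos (of_real pi * z) = (w + inverse w) / 2"
    by (simp add: cos_exp_eq w_def exp_minus)
  have s: "sin (of_real pi * z) = (w - inverse w) / (2 * \<i>)"
    by (simp add: sin_exp_eq w_def exp_minus)
  show ?thesis
  proof (cases "w * w = 1")
    case True
    then have "w - inverse w = 0" using w0 by (simp add: field_simps)
    then show ?thesis unfolding cot_def s y using True by simp
  next
    case False
    then have "w - inverse w \<noteq> 0" using w0 by (auto simp: field_simps)
    moreover have "w * w - 1 \<noteq> 0" using False by simp
    ultimately show ?thesis unfolding cot_def s c y using w0 by (simp add: field_simps)
  qed
qed

text \<open>
  The logarithmic derivative of the Jacobi theta function. It is elliptic in \<^term>\<open>z\<close> up to an
  additive constant, and its Taylor coefficients at \<^term>\<open>0::complex\<close> are the Eisenstein series.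
\<close>

definition lambert_odd :: "complex \<Rightarrow> complex \<Rightarrow> complex" where
  "lambert_odd \<tau> z = - 2 * pi * \<i> *
     (eval_fps (lambert_fps \<tau>) (qnome z) - eval_fps (lambert_fps \<tau>) (qnome (- z)))"

definition kron :: "complex \<Rightarrow> complex \<Rightarrow> complex" where
  "kron \<tau> z = of_real pi * cot (of_real pi * z) + lambert_odd \<tau> z"

lemma kron_shift_1: "kron \<tau> (z + 1) = kron \<tau> z"
  using qnome_add[of z 1] qnome_add[of "-z-1" 1]
  by (simp add: kron_def lambert_odd_def cot_pi_eq)

text \<open>The shift of each Lambert part is a geometric series, and these two rational functions
  of \<open>qnome z\<close> add up with the two cotangents to a constant. The bounds on
  \<open>Im z\<close> put z and z + \<tau> on opposite sides of the real axis inside the strip of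
  convergence.\<close>

lemma kron_shift_tau:
  assumes "- Im \<tau> < Im z" "Im z < 0"
  shows "kron \<tau> (z + \<tau>) = kron \<tau> z - 2 * pi * \<i>"
proof -
  define y q where "y = qnome z" and "q = qnome \<tau>"
  have qy: "qnome (z + \<tau>) = q * y" by (simp add: qnome_add q_def y_def)
  have n: "norm (q * y) < 1" unfolding qy[symmetric] using assms by (intro norm_qnome_less_1) auto
  have "norm y > 1" unfolding y_def norm_qnome using assms by (simp add: mult_pos_neg)
  then have ne: "y \<noteq> 0" "y \<noteq> 1" "q * y \<noteq> 1" using n by auto
  let ?g = "\<lambda>z. eval_fps (lambert_fps \<tau>) (qnome z)"
  have 1: "?g z - ?g (z + \<tau>) = q * y / (1 - q * y)"
    using lambert_fps_shift[of z \<tau>] assms by (simp add: qy)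
  have 2: "?g (- z - \<tau>) - ?g (- z) = inverse y / (1 - inverse y)"
    using lambert_fps_shift[of "- z - \<tau>" \<tau>] assms by (simp add: qnome_minus y_def)
  have "kron \<tau> (z + \<tau>) - kron \<tau> z = pi * \<i> * ((q * y + 1) / (q * y - 1) - (y + 1) / (y - 1))
      + 2 * pi * \<i> * ((?g z - ?g (z + \<tau>)) + (?g (- z - \<tau>) - ?g (- z)))"
    unfolding kron_def lambert_odd_def cot_pi_eq qy y_def[symmetric] minus_add_distrib diff_conv_add_uminus
    by (simp add: ring_distribs mult_ac)
  also have "\<dots> = pi * \<i> * ((q * y + 1) / (q * y - 1) - (y + 1) / (y - 1) + 2 * (q * y / (1 - q * y)) + 2 / (y - 1))"
    unfolding 1 2 using ne by (simp add: divide_simps) (simp add: algebra_simps)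
  also have "(q * y + 1) / (q * y - 1) + 2 * (q * y / (1 - q * y)) = -1"
    using ne by (simp add: divide_simps) (simp add: algebra_simps)
  then have "(q * y + 1) / (q * y - 1) - (y + 1) / (y - 1) + 2 * (q * y / (1 - q * y)) + 2 / (y - 1)
      = - 1 - (y + 1) / (y - 1) + 2 / (y - 1)" by (simp add: algebra_simps)
  also have "\<dots> = - 2" using ne by (simp add: divide_simps)
  finally show ?thesis by (simp add: algebra_simps)
qed

lemma holomorphic_eval_lambert_fps:
  assumes "a = 1 \<or> a = -1"
  shows "(\<lambda>z. eval_fps (lambert_fps \<tau>) (qnome (a * z))) holomorphic_on {z. \<bar>Im z\<bar> < Im \<tau>}"
proof -
  have "eval_fps (lambert_fps \<tau>) \<circ> (\<lambda>z. qnome (a * z)) holomorphic_on {z. \<bar>Im z\<bar> < Im \<tau>}"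
    by (rule holomorphic_on_compose_gen[where t = "eball 0 (fps_conv_radius (lambert_fps \<tau>))"])
       (use assms qnome_in_conv_radius in \<open>auto intro!: holomorphic_intros\<close>)
  then show ?thesis by (simp add: o_def)
qed

lemma open_strip: "open {z. \<bar>Im z\<bar> < c}"
  by (intro open_Collect_less continuous_intros)

lemma holomorphic_lambert_odd: "lambert_odd \<tau> holomorphic_on {z. \<bar>Im z\<bar> < Im \<tau>}"
  unfolding lambert_odd_def[abs_def]
  using holomorphic_eval_lambert_fps[of 1 \<tau>] holomorphic_eval_lambert_fps[of "-1" \<tau>]
  by (auto intro!: holomorphic_intros)

text \<open>The n-th derivative at z = 0 becomes the n-th iterate of \<open>theta\<close> at y = 1,
  which is the Lambert series of exponent n. For odd n the parts in y and 1/y reinforce each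
  other.\<close>

lemma lambert_odd_fps:
  assumes "Im \<tau> > 0"
  obtains F where "lambert_odd \<tau> has_fps_expansion F"
    "\<And>n. odd n \<Longrightarrow> fps_nth F n = 2 * (2 * pi * \<i>) ^ Suc n * - lambert n \<tau> / fact n"
proof -
  let ?S = "{z. \<bar>Im z\<bar> < Im \<tau>}"
  define g where "g = (\<lambda>a z. eval_fps (lambert_fps \<tau>) (qnome (a * z)))"
  have ex: "g a has_fps_expansion fps_expansion (g a) 0" if "a = 1 \<or> a = -1" for a
    using holomorphic_eval_lambert_fps[OF that] assms open_strip
    by (intro has_fps_expansion_fps_expansion[of ?S]) (auto simp: g_def)
  have nth: "fps_nth (fps_expansion (g a) 0) n = (2 * pi * \<i> * a) ^ n * lambert n \<tau> / fact n"
    if "a = 1 \<or> a = -1" for a n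
  proof -
    have "(deriv ^^ n) (g a) 0 = (2 * pi * \<i> * a) ^ n * eval_fps ((theta ^^ n) (lambert_fps \<tau>)) (qnome (a * 0))"
      unfolding g_def
      by (rule higher_deriv_eval_fps_qnome[OF open_strip[of "Im \<tau>"]])
         (use assms that in \<open>auto intro: qnome_in_conv_radius\<close>)
    then show ?thesis
      using lambert_eq_eval_fps[OF assms] qnome_of_nat_mult[of 0 1]
      by (simp add: fps_expansion_def)
  qed
  let ?F = "fps_const (- 2 * pi * \<i>) * (fps_expansion (g 1) 0 - fps_expansion (g (-1)) 0)"
  show ?thesis
  proof (rule that)
    have "lambert_odd \<tau> = (\<lambda>z. (- 2 * pi * \<i>) * (g 1 z - g (-1) z))"
      by (simp add: fun_eq_iff lambert_odd_def g_def)
    moreover have "(\<lambda>z. (- 2 * pi * \<i>) * (g 1 z - g (-1) z)) has_fps_expansion ?F"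
      by (intro fps_expansion_intros ex) auto
    ultimately show "lambert_odd \<tau> has_fps_expansion ?F" by metis
    show "fps_nth ?F n = 2 * (2 * pi * \<i>) ^ Suc n * - lambert n \<tau> / fact n" if "odd n" for n
      using that by (simp add: nth field_simps)
  qed
qed

section \<open>The regular part of the cotangent\<close>

text \<open>Shifting power series removes the singularity at 0: \<open>sinc_fps\<close> is sin(pi
  z)/z, \<open>cotnum_fps\<close> is (pi cos(pi z) - sin(pi z)/z)/z, and their quotient
  \<open>cotreg\<close> continues pi cot(pi z) - 1/z to z = 0.\<close>

definition sinc_fps :: "complex fps" where
  "sinc_fps = fps_shift 1 (fps_sin pi)"

definition cotnum_fps :: "complex fps" where
  "cotnum_fps = fps_shift 1 (fps_const (of_real pi) * fps_cos pi - sinc_fps)"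

definition cotreg :: "complex \<Rightarrow> complex" where
  "cotreg z = eval_fps cotnum_fps z / eval_fps sinc_fps z"

lemma radius_sinc [simp]: "fps_conv_radius sinc_fps = \<infinity>"
  by (simp add: sinc_fps_def)

lemma radius_cot_aux: "fps_conv_radius (fps_const (of_real pi) * fps_cos pi - sinc_fps :: complex fps) = \<infinity>"
proof -
  have "(\<infinity>::ereal) \<le> min (fps_conv_radius (fps_const (of_real pi) * fps_cos pi :: complex fps)) (fps_conv_radius sinc_fps)"
    using fps_conv_radius_mult[of "fps_const (of_real pi :: complex)" "fps_cos pi"] by simp
  also have "\<dots> \<le> fps_conv_radius (fps_const (of_real pi) * fps_cos pi - sinc_fps)"
    by (rule fps_conv_radius_diff)
  finally show ?thesis by simp
qed

lemma radius_cotnum [simp]: "fps_conv_radius cotnum_fps = \<infinity>"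
  by (simp add: cotnum_fps_def radius_cot_aux)

lemma eval_fps_shift_1:
  fixes f :: "complex fps"
  assumes "fps_nth f 0 = 0" "norm z < fps_conv_radius f" "z \<noteq> 0"
  shows "eval_fps (fps_shift 1 f) z = eval_fps f z / z"
proof (cases "f = 0")
  case False
  then have "1 \<le> subdegree f" using assms(1) by (intro subdegree_geI) auto
  then show ?thesis using assms by (simp add: eval_fps_shift)
qed simp

lemma fps_nth_sin_0: "fps_nth (fps_sin c) 0 = 0"
  by (simp add: fps_sin_def)

lemma eval_sinc: "z \<noteq> 0 \<Longrightarrow> eval_fps sinc_fps z = sin (of_real pi * z) / z"
  unfolding sinc_fps_def
  by (subst eval_fps_shift_1) (simp_all add: fps_nth_sin_0)

lemma sinc_nth_0: "fps_nth sinc_fps 0 = pi"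
  by (simp add: sinc_fps_def fps_sin_def)

lemma eval_cotnum:
  assumes "z \<noteq> 0" shows "eval_fps cotnum_fps z = (of_real pi * cos (of_real pi * z) - sin (of_real pi * z) / z) / z"
proof -
  have "eval_fps cotnum_fps z = eval_fps (fps_const (of_real pi) * fps_cos pi - sinc_fps) z / z"
    unfolding cotnum_fps_def using assms
    by (subst eval_fps_shift_1) (simp_all add: radius_cot_aux, simp add: sinc_nth_0 fps_cos_def)
  also have "eval_fps (fps_const (of_real pi) * fps_cos pi - sinc_fps) z = of_real pi * cos (of_real pi * z) - sin (of_real pi * z) / z"
    using fps_conv_radius_mult[of "fps_const (of_real pi :: complex)" "fps_cos pi"]
    by (subst eval_fps_diff) (auto simp: eval_sinc assms eval_fps_mult)
  finally show ?thesis .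
qed

lemma sin_pi_nonzero:
  fixes z :: complex assumes "z \<noteq> 0" "norm z < 1" shows "sin (of_real pi * z) \<noteq> 0"
proof
  assume "sin (of_real pi * z) = 0"
  then obtain n :: int where "of_real pi * z = of_real (of_int n * pi)" by (auto simp: sin_eq_0)
  then have "of_real pi * z = of_real pi * of_int n" by simp
  then have "z = of_int n" by (simp del: of_real_mult)
  with assms show False by auto
qed

lemma eval_sinc_nonzero: "norm z < 1 \<Longrightarrow> eval_fps sinc_fps z \<noteq> 0"
  by (cases "z = 0") (auto simp: eval_sinc sin_pi_nonzero eval_fps_at_0 sinc_nth_0)

lemma holomorphic_cotreg: "cotreg holomorphic_on ball 0 1"
  unfolding cotreg_def[abs_def] using eval_sinc_nonzero
  by (auto intro!: holomorphic_intros)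

lemma cotreg_eq:
  assumes "z \<noteq> 0" "norm z < 1" shows "of_real pi * cot (of_real pi * z) = 1 / z + cotreg z"
  using assms sin_pi_nonzero[OF assms]
  by (simp add: cotreg_def eval_sinc eval_cotnum cot_def field_simps)

text \<open>
  With \<open>P = \<pi>\<close>, \<open>s\<close> are the coefficients of \<open>sin (\<pi> z) / z\<close> and \<open>w\<close> those of \<open>\<pi> cot (\<pi> z) - 1 / z\<close>.
\<close>

lemma cot_recursion:
  fixes w s :: "nat \<Rightarrow> complex"
  assumes P0: "P \<noteq> 0" and s: "s 0 = P" "s 1 = 0" "s 2 = - (P ^ 3 / 6)" "s 3 = 0" "s 4 = P ^ 5 / 120" "s 5 = 0"
 and 0: "w 0 = 0"
 and e1: "w 0 * s 1 + w 1 * s 0 = - (P ^ 3 / 3)"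
  and e3: "w 0 * s 3 + w 1 * s 2 + w 2 * s 1 + w 3 * s 0 = P ^ 5 / 30"
  and e5: "w 0 * s 5 + w 1 * s 4 + w 2 * s 3 + w 3 * s 2 + w 4 * s 1 + w 5 * s 0 = - (P ^ 7 / 840)"
 shows "w 1 = - (P\<^sup>2 / 3)" "w 3 = - (P ^ 4 / 45)" "w 5 = - (2 * P ^ 6 / 945)"
proof -
  have pw: "P ^ 3 = P ^ 2 * P" "P ^ 5 = P ^ 4 * P" "P ^ 7 = P ^ 6 * P" 
     "P ^ 2 * P ^ 3 = P ^ 4 * P" "P ^ 4 * P ^ 3 = P ^ 6 * P" "P ^ 2 * P ^ 5 = P ^ 6 * P"
    by (simp_all flip: power_Suc2 power_add)
  have "w 1 * P = - (P\<^sup>2 / 3) * P"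
    using e1 unfolding s 0 pw by simp
  then show w1: "w 1 = - (P\<^sup>2 / 3)" using P0 by (simp only: mult_cancel_right) simp
  have "w 3 * P = (w 0 * s 3 + w 1 * s 2 + w 2 * s 1 + w 3 * s 0) - (P ^ 2 * P ^ 3) / 18"
    unfolding s 0 w1 by simp
  then have "w 3 * P = P ^ 5 / 30 - (P ^ 2 * P ^ 3) / 18" unfolding e3 .
  also have "\<dots> = - (P ^ 4 / 45) * P"  unfolding pw by simp
  finally show w3: "w 3 = - (P ^ 4 / 45)" using P0 by (simp only: mult_cancel_right) simp
  have "w 5 * P = (w 0 * s 5 + w 1 * s 4 + w 2 * s 3 + w 3 * s 2 + w 4 * s 1 + w 5 * s 0)
      + (P ^ 2 * P ^ 5) / 360 - (P ^ 4 * P ^ 3) / 270"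
    unfolding s 0 w1 w3 by simp
  then have "w 5 * P = - (P ^ 7 / 840) + (P ^ 2 * P ^ 5) / 360 - (P ^ 4 * P ^ 3) / 270" unfolding e5 .
  also have "\<dots> = - (2 * P ^ 6 / 945) * P"  unfolding pw by simp
  finally show "w 5 = - (2 * P ^ 6 / 945)" using P0 by (simp only: mult_cancel_right) simp
qed

text \<open>The coefficients are -2 zeta(2), -2 zeta(4) and -2 zeta(6).\<close>

lemma cotreg_fps:
  obtains W where "cotreg has_fps_expansion W"
    "fps_nth W 0 = 0" "fps_nth W 1 = - ((of_real pi)\<^sup>2 / 3)" "fps_nth W 3 = - (of_real pi ^ 4 / 45)"
    "fps_nth W 5 = - (2 * of_real pi ^ 6 / 945)"
proof -
  define W where "W = cotnum_fps * inverse sinc_fps"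
  have "(\<lambda>z. eval_fps cotnum_fps z * inverse (eval_fps sinc_fps z)) has_fps_expansion W"
    unfolding W_def by (intro fps_expansion_intros eval_fps_has_fps_expansion) (auto simp: sinc_nth_0)
  then have exp: "cotreg has_fps_expansion W"
    by (simp add: cotreg_def[abs_def] divide_inverse)
  have "inverse sinc_fps * sinc_fps = 1" by (rule inverse_mult_eq_1) (simp add: sinc_nth_0)
  \<comment> \<open>Multiplying back turns the quotient into a triangular recursion for the
    coefficients, with pivot pi.\<close>
  then have "W * sinc_fps = cotnum_fps" unfolding W_def by (simp add: mult.assoc)
  then have eq: "(\<Sum>i=0..n. fps_nth W i * fps_nth sinc_fps (n - i)) = fps_nth cotnum_fps n" for n
    by (metis fps_mult_nth)
  define w s where "w = fps_nth W" and "s = fps_nth sinc_fps"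
  have s: "s 0 = of_real pi" "s 1 = 0" "s 2 = - (of_real pi ^ 3 / 6)" "s 3 = 0" "s 4 = of_real pi ^ 5 / 120" "s 5 = 0"
    "s 6 = - (of_real pi ^ 7 / 5040)"
    by (simp_all add: s_def sinc_fps_def fps_sin_def fact_numeral)
  have c: "fps_nth cotnum_fps 0 = 0" "fps_nth cotnum_fps 1 = - (of_real pi ^ 3 / 3)"
    "fps_nth cotnum_fps 3 = of_real pi ^ 5 / 30" "fps_nth cotnum_fps 5 = - (of_real pi ^ 7 / 840)"
    by (simp_all add: cotnum_fps_def sinc_fps_def fps_sin_def fps_cos_def fact_numeral
          power_numeral_reduce field_simps)
  have 0: "w 0 = 0" using eq[of 0] c(1) s(1) by (simp add: w_def s_def)
  have e1: "w 0 * s 1 + w 1 * s 0 = - (of_real pi ^ 3 / 3)"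
    using eq[of 1] c(2) by (simp add: w_def s_def)
  have e3: "w 0 * s 3 + w 1 * s 2 + w 2 * s 1 + w 3 * s 0 = of_real pi ^ 5 / 30"
    using eq[of 3] unfolding c by (simp add: w_def s_def eval_nat_numeral)
  have e5: "w 0 * s 5 + w 1 * s 4 + w 2 * s 3 + w 3 * s 2 + w 4 * s 1 + w 5 * s 0 = - (of_real pi ^ 7 / 840)"
    using eq[of 5] unfolding c by (simp add: w_def s_def eval_nat_numeral)
  have p: "complex_of_real pi \<noteq> 0" by simp
  show ?thesis using cot_recursion[OF p s(1-6) 0 e1 e3 e5] 0 unfolding w_def by (rule that[OF exp, rotated])
qed

section \<open>Modular transformation of the Eisenstein series\<close>

definition kron_reg :: "complex \<Rightarrow> complex \<Rightarrow> complex" where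
  "kron_reg \<tau> z = cotreg z + lambert_odd \<tau> z"

lemma kron_eq: "z \<noteq> 0 \<Longrightarrow> norm z < 1 \<Longrightarrow> kron \<tau> z = 1 / z + kron_reg \<tau> z"
  using cotreg_eq[of z] by (simp add: kron_def kron_reg_def)

lemma kron_reg_0 [simp]: "kron_reg \<tau> 0 = 0"
  by (simp add: kron_reg_def cotreg_def lambert_odd_def eval_fps_at_0 cotnum_fps_def sinc_fps_def
        fps_sin_def fps_cos_def)

lemma cot_pi_holomorphic:
  assumes "f holomorphic_on A" "\<And>z. z \<in> A \<Longrightarrow> f z \<notin> \<int>"
  shows "(\<lambda>z. cot (of_real pi * f z)) holomorphic_on A"
proof -
  have "sin (of_real pi * f z) \<noteq> 0" if "z \<in> A" for z
  proof
    assume "sin (of_real pi * f z) = 0"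
    then obtain n :: int where "of_real pi * f z = of_real (of_int n * pi)" by (auto simp: sin_eq_0)
    then have "of_real pi * f z = of_real pi * of_int n" by simp
    then have "f z = of_int n" by (simp del: of_real_mult)
    with assms(2)[OF that] show False by simp
  qed
  then show ?thesis unfolding cot_def using assms(1) by (auto intro!: holomorphic_intros)
qed

text \<open>
  The difference of the two sides, continued to the parallelogram with vertices \<open>\<plusminus> 1 \<plusminus> \<tau>\<close>, is
  invariant under the translations by \<open>1\<close> and \<open>\<tau>\<close> inside it. So its modulus attains its maximum
  over the open parallelogram on the concentric one of half the size, and the difference is constant.
\<close>

lemma kron_inversion:
  assumes "Im \<tau> > 0"
  obtains r where "r > 0"
    "\<And>z. norm z < r \<Longrightarrow> kron_reg (-1 / \<tau>) (z / \<tau>) / \<tau> = kron_reg \<tau> z + 2 * pi * \<i> * z / \<tau>"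
proof -
  define \<tau>' where "\<tau>' = -1 / \<tau>"
  have t0: "\<tau> \<noteq> 0" using assms by auto
  have it: "Im \<tau>' > 0" using assms
    by (simp add: \<tau>'_def Im_divide field_simps power2_eq_square sum_squares_gt_zero_iff)
  have inv: "1 / \<tau> = - \<tau>'" by (simp add: \<tau>'_def)
  define P where "P = {z. \<bar>Im z\<bar> < Im \<tau> \<and> \<bar>Im (z / \<tau>)\<bar> < Im \<tau>'}"
  define Q where "Q = {z. \<bar>Im z\<bar> \<le> Im \<tau> / 2 \<and> \<bar>Im (z / \<tau>)\<bar> \<le> Im \<tau>' / 2}"
  have QP: "Q \<subseteq> P" using assms it by (auto simp: P_def Q_def)
  have opP: "open P"
    unfolding P_def by (intro open_Collect_conj open_Collect_less continuous_intros) (use t0 in auto)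
  have Pset: "P = {z. Im z < Im \<tau>} \<inter> {z. Im z > - Im \<tau>} \<inter> {z. Im (inverse \<tau> * z) < Im \<tau>'} \<inter> {z. Im (inverse \<tau> * z) > - Im \<tau>'}"
    by (auto simp: P_def divide_inverse mult.commute)
  have convex_im: "convex {z. Im (c * z) < t}" "convex {z. Im (c * z) > t}" for c t
  proof -
    have "{z. Im (c * z) < t} = {z. (Im c * Re z + Re c * Im z) < t}"
         "{z. Im (c * z) > t} = {z. (Im c * Re z + Re c * Im z) > t}" by (auto simp: algebra_simps)
    moreover have "linear (\<lambda>z. Im (c * z))"
      by (intro linearI) (auto simp: algebra_simps)
    ultimately show "convex {z. Im (c * z) < t}" "convex {z. Im (c * z) > t}"
      using convex_linear_vimage[of "\<lambda>z. Im (c * z)" "{..<t}"] convex_linear_vimage[of "\<lambda>z. Im (c * z)" "{t<..}"]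
      by (auto simp: vimage_def)
  qed
  have conP: "connected P"
    unfolding Pset by (intro convex_connected convex_Int convex_im convex_halfspace_Im_lt convex_halfspace_Im_gt)
  have zP: "0 \<in> P" using assms it by (simp add: P_def)
  have closedQ: "closed Q"
    unfolding Q_def by (intro closed_Collect_conj closed_Collect_le continuous_intros) (use t0 in auto)
  have bndQ: "bounded Q"
  proof (rule boundedI)
    fix z assume z: "z \<in> Q"
    define w where "w = z / \<tau>"
    have zw: "z = w * \<tau>" using t0 by (simp add: w_def)
    have a: "\<bar>Im z\<bar> \<le> Im \<tau>" "\<bar>Im w\<bar> \<le> Im \<tau>'" using z assms it by (auto simp: Q_def w_def)
    have "Re w * Im \<tau> = Im z - Im w * Re \<tau>" by (simp add: zw)
    then have "Re w = (Im z - Im w * Re \<tau>) / Im \<tau>" using assms by (simp add: field_simps)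
    then have "\<bar>Re w\<bar> = \<bar>Im z - Im w * Re \<tau>\<bar> / Im \<tau>" using assms by simp
    also have "\<dots> \<le> (Im \<tau> + Im \<tau>' * \<bar>Re \<tau>\<bar>) / Im \<tau>"
      using assms a by (intro divide_right_mono order_trans[OF abs_triangle_ineq4] add_mono)
        (auto simp: abs_mult intro!: mult_right_mono)
    finally have "norm w \<le> (Im \<tau> + Im \<tau>' * \<bar>Re \<tau>\<bar>) / Im \<tau> + Im \<tau>'"
      using cmod_le[of w] a by linarith
    then show "norm z \<le> ((Im \<tau> + Im \<tau>' * \<bar>Re \<tau>\<bar>) / Im \<tau> + Im \<tau>') * norm \<tau>"
      unfolding zw norm_mult by (intro mult_right_mono) auto
  qed
  have compQ: "compact Q" using closedQ bndQ compact_eq_bounded_closed by blast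

  have int1: "z \<notin> \<int>" if z: "z \<in> P" "z \<noteq> 0" for z
  proof
    assume "z \<in> \<int>"
    then obtain n where n: "z = of_int n" by (elim Ints_cases)
    have "z / \<tau> = - (of_int n * \<tau>')" by (simp add: n \<tau>'_def)
    then have "\<bar>of_int n\<bar> * Im \<tau>' < 1 * Im \<tau>'" using z it by (simp add: P_def abs_mult)
    then have "\<bar>of_int n :: real\<bar> < 1" using it by (simp only: mult_less_cancel_right_pos)
    then show False using z n by simp
  qed
  have int2: "z / \<tau> \<notin> \<int>" if z: "z \<in> P" "z \<noteq> 0" for z
  proof
    assume "z / \<tau> \<in> \<int>"
    then obtain n where "z / \<tau> = of_int n" by (elim Ints_cases)
    then have n: "z = of_int n * \<tau>" using t0 by (simp add: field_simps)
    then have "\<bar>of_int n\<bar> * Im \<tau> < 1 * Im \<tau>" using z assms by (simp add: P_def abs_mult)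
    then have "\<bar>of_int n :: real\<bar> < 1" using assms by (simp only: mult_less_cancel_right_pos)
    then have "n = 0" by linarith
    then show False using z n by simp
  qed

  \<comment> \<open>Both \<open>kron\<close> terms have principal part 1/z at 0, and
    \<open>kron_reg\<close> vanishes there, so the value 0 is the holomorphic continuation. The
    linear term is chosen to absorb the constants -2 pi i of \<open>kron_shift_tau\<close> under
    both translations.\<close>
  define D where "D = (\<lambda>z. if z = 0 then 0 else kron \<tau>' (z / \<tau>) / \<tau> - kron \<tau> z - 2 * pi * \<i> * z / \<tau>)"
  have hol_odd: "lambert_odd \<tau> holomorphic_on P" "(\<lambda>z. lambert_odd \<tau>' (z / \<tau>)) holomorphic_on P"
  proof -
    show "lambert_odd \<tau> holomorphic_on P"
      by (rule holomorphic_on_subset[OF holomorphic_lambert_odd]) (auto simp: P_def)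
    have "lambert_odd \<tau>' \<circ> (\<lambda>z. z / \<tau>) holomorphic_on P"
      by (rule holomorphic_on_compose_gen[OF _ holomorphic_lambert_odd])
         (use t0 in \<open>auto simp: P_def intro!: holomorphic_intros\<close>)
    then show "(\<lambda>z. lambert_odd \<tau>' (z / \<tau>)) holomorphic_on P" by (simp add: o_def)
  qed
  have hol1: "D holomorphic_on (P - {0})"
  proof -
    have "(\<lambda>z. kron \<tau>' (z / \<tau>) / \<tau> - kron \<tau> z - 2 * pi * \<i> * z / \<tau>) holomorphic_on (P - {0})"
      unfolding kron_def
      by (intro holomorphic_intros cot_pi_holomorphic hol_odd[THEN holomorphic_on_subset])
         (use t0 int1 int2 in auto)
    then show ?thesis by (rule holomorphic_transform) (auto simp: D_def)
  qed
  obtain r0 where r0: "r0 > 0" "ball 0 r0 \<subseteq> P" using opP zP open_contains_ball by blast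
  define r where "r = min r0 (min 1 (norm \<tau>))"
  have r: "r > 0" "ball 0 r \<subseteq> P" "r \<le> 1" "r \<le> norm \<tau>" using r0 t0 by (auto simp: r_def)
  have Deq: "D z = kron_reg \<tau>' (z / \<tau>) / \<tau> - kron_reg \<tau> z - 2 * pi * \<i> * z / \<tau>" if "norm z < r" for z
  proof (cases "z = 0")
    case False
    have "norm (z / \<tau>) < 1" using that r t0 by (simp add: norm_divide)
    then have "kron \<tau>' (z / \<tau>) = 1 / (z / \<tau>) + kron_reg \<tau>' (z / \<tau>)"
      using False t0 by (intro kron_eq) auto
    moreover have "kron \<tau> z = 1 / z + kron_reg \<tau> z" using False that r by (intro kron_eq) auto
    ultimately show ?thesis using False t0 by (simp add: D_def add_divide_distrib)
  qed (simp add: D_def)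
  have hol2: "D holomorphic_on ball 0 r"
  proof -
    have "cotreg \<circ> (\<lambda>z. z / \<tau>) holomorphic_on ball 0 r"
      by (rule holomorphic_on_compose_gen[OF _ holomorphic_cotreg])
         (use t0 r in \<open>auto simp: norm_divide intro!: holomorphic_intros\<close>)
    then have "(\<lambda>z. cotreg (z / \<tau>)) holomorphic_on ball 0 r" by (simp add: o_def)
    moreover have "cotreg holomorphic_on ball 0 r"
      by (rule holomorphic_on_subset[OF holomorphic_cotreg]) (use r in auto)
    ultimately have "(\<lambda>z. kron_reg \<tau>' (z / \<tau>) / \<tau> - kron_reg \<tau> z - 2 * pi * \<i> * z / \<tau>) holomorphic_on ball 0 r"
      unfolding kron_reg_def
      by (intro holomorphic_intros hol_odd[THEN holomorphic_on_subset]) (use t0 r in auto)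
    then show ?thesis by (rule holomorphic_transform) (auto simp: Deq)
  qed
  have holP: "D holomorphic_on P"
  proof -
    have "D holomorphic_on (P - {0}) \<union> ball 0 r"
      by (intro holomorphic_on_Un hol1 hol2 open_delete opP) auto
    moreover have "(P - {0}) \<union> ball 0 r = P" using r zP by auto
    ultimately show ?thesis by simp
  qed

  have shift_tau: "D (z + \<tau>) = D z" if "z \<in> P" "Im z < 0" for z
  proof -
    have z: "- Im \<tau> < Im z" using that by (auto simp: P_def abs_less_iff)
    then have ne: "z \<noteq> 0" "z + \<tau> \<noteq> 0" using that(2) by (auto simp: complex_eq_iff)
    have "(z + \<tau>) / \<tau> = z / \<tau> + 1" using t0 by (simp add: field_simps)
    moreover have "2 * pi * \<i> * (z + \<tau>) / \<tau> = 2 * pi * \<i> * z / \<tau> + 2 * pi * \<i>"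
      using t0 by (simp add: field_simps)
    ultimately show ?thesis using ne kron_shift_1[of \<tau>' "z / \<tau>"]
      unfolding D_def kron_shift_tau[OF z that(2)] by simp
  qed
  have shift_1: "D (z - 1) = D z" if "z \<in> P" "Im (z / \<tau>) < 0" for z
  proof -
    have z: "- Im \<tau>' < Im (z / \<tau>)" using that by (auto simp: P_def abs_less_iff)
    have e: "(z - 1) / \<tau> = z / \<tau> + \<tau>'" using inv by (simp add: diff_divide_distrib)
    have "(z - 1) / \<tau> \<noteq> 0" unfolding e using z by (auto simp: complex_eq_iff)
    then have ne: "z \<noteq> 0" "z - 1 \<noteq> 0" using that(2) by auto
    have k: "kron \<tau> (z - 1) = kron \<tau> z" using kron_shift_1[of \<tau> "z - 1"] by simp
    show ?thesis using ne kron_shift_tau[OF z that(2)] k unfolding D_def e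
      by (simp add: diff_divide_distrib right_diff_distrib)
  qed
  \<comment> \<open>Translation by \<tau> leaves \<open>Im (z / \<tau>)\<close> alone and
    translation by 1 leaves \<open>Im z\<close> alone, so the two coordinates can be halved one
    after the other.\<close>
  have red1: "\<exists>z'\<in>P. \<bar>Im z'\<bar> \<le> Im \<tau> / 2 \<and> D z' = D z" if z: "z \<in> P" for z
  proof -
    have e: "(z + \<tau>) / \<tau> = z / \<tau> + 1" "(z - \<tau>) / \<tau> = z / \<tau> - 1" using t0 by (simp_all add: field_simps)
    consider "\<bar>Im z\<bar> \<le> Im \<tau> / 2" | "Im z < - Im \<tau> / 2" | "Im z > Im \<tau> / 2" by linarith
    then show ?thesis
    proof cases
      case 1 then show ?thesis using z by blast
    next
      case 2
      have "z + \<tau> \<in> P" "\<bar>Im (z + \<tau>)\<bar> \<le> Im \<tau> / 2" using z 2 assms by (auto simp: P_def e)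
      moreover have "D (z + \<tau>) = D z" using 2 assms z by (intro shift_tau) auto
      ultimately show ?thesis by blast
    next
      case 3
      have *: "z - \<tau> \<in> P" "\<bar>Im (z - \<tau>)\<bar> \<le> Im \<tau> / 2" using z 3 assms by (auto simp: P_def e)
      moreover have "D (z - \<tau> + \<tau>) = D (z - \<tau>)"
        by (rule shift_tau[OF *(1)]) (use z in \<open>auto simp: P_def\<close>)
      ultimately show ?thesis by (metis diff_add_cancel)
    qed
  qed
  have red2: "\<exists>z'\<in>Q. D z' = D z" if z: "z \<in> P" "\<bar>Im z\<bar> \<le> Im \<tau> / 2" for z
  proof -
    have e: "(z + 1) / \<tau> = z / \<tau> - \<tau>'" "(z - 1) / \<tau> = z / \<tau> + \<tau>'"
      using inv by (simp_all add: diff_divide_distrib add_divide_distrib)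
    consider "\<bar>Im (z / \<tau>)\<bar> \<le> Im \<tau>' / 2" | "Im (z / \<tau>) < - Im \<tau>' / 2" | "Im (z / \<tau>) > Im \<tau>' / 2" by linarith
    then show ?thesis
    proof cases
      case 1 then show ?thesis using z unfolding Q_def by blast
    next
      case 2
      then have "z - 1 \<in> Q" using z it unfolding P_def Q_def mem_Collect_eq e by auto
      moreover have "D (z - 1) = D z" using 2 it z by (intro shift_1) auto
      ultimately show ?thesis by blast
    next
      case 3
      then have *: "z + 1 \<in> Q" using z it unfolding P_def Q_def mem_Collect_eq e by auto
      have "Im ((z + 1) / \<tau>) < 0" using z it unfolding e P_def by auto
      then have "D (z + 1 - 1) = D (z + 1)" using * QP by (intro shift_1) auto
      then show ?thesis using * by auto
    qed
  qed
  obtain w where w: "w \<in> Q" "\<And>z. z \<in> Q \<Longrightarrow> norm (D z) \<le> norm (D w)"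
  proof -
    have "continuous_on Q (\<lambda>z. norm (D z))"
      by (intro continuous_on_norm holomorphic_on_imp_continuous_on holomorphic_on_subset[OF holP QP])
    moreover have "0 \<in> Q" using assms it by (simp add: Q_def)
    ultimately show ?thesis using continuous_attains_sup[OF compQ] that by blast
  qed
  have "D constant_on P"
  proof (rule maximum_modulus_principle[OF holP opP conP opP order_refl])
    show "w \<in> P" using w QP by auto
    show "norm (D z) \<le> norm (D w)" if "z \<in> P" for z
      using red1[OF that] red2 w(2) by metis
  qed
  then have "D z = D 0" if "z \<in> P" for z using that zP unfolding constant_on_def by metis
  moreover have "D 0 = 0" by (simp add: D_def)
  moreover have "z \<in> P" if "norm z < r" for z using that r(2) by auto
  ultimately have "D z = 0" if "norm z < r" for z using that by metis
  with Deq have "kron_reg \<tau>' (z / \<tau>) / \<tau> - kron_reg \<tau> z - 2 * pi * \<i> * z / \<tau> = 0" if "norm z < r" for z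
    using that by simp
  then have "kron_reg \<tau>' (z / \<tau>) / \<tau> = kron_reg \<tau> z + 2 * pi * \<i> * z / \<tau>" if "norm z < r" for z
    using that by (simp add: algebra_simps)
  with r(1) show ?thesis unfolding \<tau>'_def by (rule that)
qed


text \<open>The cotangent supplies the constant terms of the Eisenstein series and
  \<open>lambert_odd\<close> the Lambert series. The common factors are -2 zeta(2), -2 zeta(4), -2
  zeta(6), which produces the normalizing constants -24, 240, -504.\<close>

lemma kron_reg_fps:
  assumes "Im \<tau> > 0"
  obtains F where "kron_reg \<tau> has_fps_expansion F"
    "fps_nth F 1 = - (of_real pi ^ 2 / 3) * E2 \<tau>"
    "fps_nth F 3 = - (of_real pi ^ 4 / 45) * E4 \<tau>"
    "fps_nth F 5 = - (2 * of_real pi ^ 6 / 945) * E6 \<tau>"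
proof -
  obtain L where L: "lambert_odd \<tau> has_fps_expansion L"
    "\<And>n. odd n \<Longrightarrow> fps_nth L n = 2 * (2 * pi * \<i>) ^ Suc n * - lambert n \<tau> / fact n"
    using lambert_odd_fps[OF assms] by blast
  obtain W where W: "cotreg has_fps_expansion W"
    "fps_nth W 0 = 0" "fps_nth W 1 = - (of_real pi ^ 2 / 3)" "fps_nth W 3 = - (of_real pi ^ 4 / 45)"
    "fps_nth W 5 = - (2 * of_real pi ^ 6 / 945)"
    using cotreg_fps by blast
  have sq: "(2 * complex_of_real pi * \<i>) ^ 2 = - 4 * of_real pi ^ 2" by (simp add: power_mult_distrib)
  have e: "Suc 1 = 2" "Suc 3 = 2 * 2" "Suc 5 = 2 * 3" by simp_all
  have pow: "(2 * complex_of_real pi * \<i>) ^ Suc 1 = - 4 * of_real pi ^ 2"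
       "(2 * complex_of_real pi * \<i>) ^ Suc 3 = 16 * of_real pi ^ 4"
       "(2 * complex_of_real pi * \<i>) ^ Suc 5 = - 64 * of_real pi ^ 6"
    unfolding e power_mult sq by (simp_all add: power_mult_distrib flip: power_mult)
  have Ln: "fps_nth L 1 = 8 * of_real pi ^ 2 * lambert 1 \<tau>"
     "fps_nth L 3 = - (16 * of_real pi ^ 4 / 3) * lambert 3 \<tau>"
     "fps_nth L 5 = (16 * of_real pi ^ 6 / 15) * lambert 5 \<tau>"
    using L(2)[of 1] L(2)[of 3] L(2)[of 5] unfolding of_real_mult of_real_numeral pow by (simp_all add: fact_numeral)
  show ?thesis
  proof (rule that)
    show "kron_reg \<tau> has_fps_expansion W + L"
      unfolding kron_reg_def[abs_def] by (intro fps_expansion_intros W L)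
    show "fps_nth (W + L) 1 = - (of_real pi ^ 2 / 3) * E2 \<tau>"
      unfolding fps_add_nth W(3) Ln E2_def by (simp add: field_simps)
    show "fps_nth (W + L) 3 = - (of_real pi ^ 4 / 45) * E4 \<tau>"
      unfolding fps_add_nth W(4) Ln E4_def by (simp add: field_simps)
    show "fps_nth (W + L) 5 = - (2 * of_real pi ^ 6 / 945) * E6 \<tau>"
      unfolding fps_add_nth W(5) Ln E6_def by (simp add: field_simps)
  qed
qed

text \<open>In \<open>kron_inversion\<close> the substitution z / \<tau> and the outer factor 1 /
  \<tau> give the n-th Taylor coefficient the weight n + 1, so n = 1, 3, 5 yield weights 2, 4, 6.
  The linear term touches only n = 1 and is the anomaly of \<open>E2\<close>.\<close>

theorem Eisenstein_inversion:
  assumes "Im \<tau> > 0"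
  shows "E2 (-1 / \<tau>) = \<tau>\<^sup>2 * E2 \<tau> + 6 * \<tau> / (pi * \<i>)"
    and "E4 (-1 / \<tau>) = \<tau> ^ 4 * E4 \<tau>"
    and "E6 (-1 / \<tau>) = \<tau> ^ 6 * E6 \<tau>"
proof -
  have t0: "\<tau> \<noteq> 0" using assms by auto
  have it: "Im (-1 / \<tau>) > 0" using assms
    by (simp add: Im_divide field_simps power2_eq_square sum_squares_gt_zero_iff)
  obtain F where F: "kron_reg \<tau> has_fps_expansion F"
    "fps_nth F 1 = - (of_real pi ^ 2 / 3) * E2 \<tau>" "fps_nth F 3 = - (of_real pi ^ 4 / 45) * E4 \<tau>"
    "fps_nth F 5 = - (2 * of_real pi ^ 6 / 945) * E6 \<tau>"
    using kron_reg_fps[OF assms] by blast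
  obtain G where G: "kron_reg (-1 / \<tau>) has_fps_expansion G"
    "fps_nth G 1 = - (of_real pi ^ 2 / 3) * E2 (-1 / \<tau>)" "fps_nth G 3 = - (of_real pi ^ 4 / 45) * E4 (-1 / \<tau>)"
    "fps_nth G 5 = - (2 * of_real pi ^ 6 / 945) * E6 (-1 / \<tau>)"
    using kron_reg_fps[OF it] by blast
  obtain r where r: "r > 0"
    "\<And>z. norm z < r \<Longrightarrow> kron_reg (-1 / \<tau>) (z / \<tau>) / \<tau> = kron_reg \<tau> z + 2 * pi * \<i> * z / \<tau>"
    using kron_inversion[OF assms] by blast
  have "(kron_reg (-1 / \<tau>) \<circ> (\<lambda>z. inverse \<tau> * z)) has_fps_expansion
          fps_compose G (fps_const (inverse \<tau>) * fps_X)"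
    by (intro fps_expansion_intros G) auto
  then have 1: "(\<lambda>z. (kron_reg (-1 / \<tau>) \<circ> (\<lambda>z. inverse \<tau> * z)) z * inverse \<tau>) has_fps_expansion
      fps_compose G (fps_const (inverse \<tau>) * fps_X) * fps_const (inverse \<tau>)"
    by (rule has_fps_expansion_cmult_right)
  have 2: "(\<lambda>z. kron_reg \<tau> z + 2 * pi * \<i> / \<tau> * z) has_fps_expansion F + fps_const (2 * pi * \<i> / \<tau>) * fps_X"
    by (intro fps_expansion_intros F)
  have "\<forall>\<^sub>F z in nhds 0. (kron_reg (-1 / \<tau>) \<circ> (\<lambda>z. inverse \<tau> * z)) z * inverse \<tau>
      = kron_reg \<tau> z + 2 * pi * \<i> / \<tau> * z"
    unfolding eventually_nhds_metric
  proof (intro exI conjI allI impI)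
    fix z :: complex assume "dist z 0 < r"
    then show "(kron_reg (-1 / \<tau>) \<circ> (\<lambda>z. inverse \<tau> * z)) z * inverse \<tau>
      = kron_reg \<tau> z + 2 * pi * \<i> / \<tau> * z" using r(2)[of z] by (simp add: divide_inverse mult_ac)
  qed (rule r(1))
  then have "fps_compose G (fps_const (inverse \<tau>) * fps_X) * fps_const (inverse \<tau>)
      = F + fps_const (2 * pi * \<i> / \<tau>) * fps_X"
    by (intro fps_expansion_unique_complex[OF _ 2] has_fps_expansion_cong[OF _ refl, THEN iffD1, OF _ 1])
  then have eq: "inverse \<tau> ^ n * fps_nth G n * inverse \<tau> = fps_nth F n + (if n = 1 then 2 * pi * \<i> / \<tau> else 0)" for n
    by (auto simp: fps_eq_iff fps_compose_linear)
  have eq': "fps_nth G n = (fps_nth F n + (if n = 1 then 2 * pi * \<i> / \<tau> else 0)) * \<tau> ^ Suc n" for n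
    using eq[of n] t0 by (simp add: field_simps)
  have pi2: "complex_of_real pi \<noteq> 0" by simp
  have "fps_nth G 3 = fps_nth F 3 * \<tau> ^ 4" "fps_nth G 5 = fps_nth F 5 * \<tau> ^ 6"
    using eq'[of 3] eq'[of 5] by simp_all
  then have "(of_real pi ^ 4 / 45) * E4 (-1 / \<tau>) = (of_real pi ^ 4 / 45) * (\<tau> ^ 4 * E4 \<tau>)"
      "(2 * of_real pi ^ 6 / 945) * E6 (-1 / \<tau>) = (2 * of_real pi ^ 6 / 945) * (\<tau> ^ 6 * E6 \<tau>)"
    unfolding F G by (simp_all add: mult_ac)
  then show "E4 (-1 / \<tau>) = \<tau> ^ 4 * E4 \<tau>" "E6 (-1 / \<tau>) = \<tau> ^ 6 * E6 \<tau>"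
    using pi2 by (simp_all only: mult_cancel_left) simp_all
  have "- (of_real pi ^ 2 / 3) * E2 (-1 / \<tau>) = (- (of_real pi ^ 2 / 3) * E2 \<tau> + 2 * pi * \<i> / \<tau>) * \<tau> ^ 2"
    using eq'[of 1] unfolding F(2) G(2) by (simp add: power2_eq_square)
  moreover have "2 * pi * \<i> / \<tau> * \<tau> ^ 2 = 2 * pi * \<i> * \<tau>"
    using t0 by (simp add: power2_eq_square)
  ultimately have *: "- (of_real pi ^ 2 / 3) * E2 (-1 / \<tau>) = - (of_real pi ^ 2 / 3) * E2 \<tau> * \<tau> ^ 2 + 2 * pi * \<i> * \<tau>"
    by (simp only: distrib_right)
  have "E2 (-1 / \<tau>) = - (3 / of_real pi ^ 2) * (- (of_real pi ^ 2 / 3) * E2 (-1 / \<tau>))"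
    using pi2 by simp
  also have "\<dots> = \<tau>\<^sup>2 * E2 \<tau> + - (6 * \<i> * \<tau> / pi)"
    unfolding * using pi2 by (simp add: field_simps power2_eq_square)
  also have "- (6 * \<i> * \<tau> / pi) = 6 * \<tau> / (pi * \<i>)" by (simp add: field_simps)
  finally show "E2 (-1 / \<tau>) = \<tau>\<^sup>2 * E2 \<tau> + 6 * \<tau> / (pi * \<i>)" .
qed

section \<open>Modular functions\<close>

lemma Im_neg_inverse: "Im (-1 / \<tau>) = Im \<tau> / (norm \<tau>)\<^sup>2"
  by (simp add: Im_divide cmod_power2)

lemma Im_neg_inverse_pos: "Im \<tau> > 0 \<Longrightarrow> Im (-1 / \<tau>) > 0"
  unfolding Im_neg_inverse by (auto intro!: divide_pos_pos)

definition modular_invariant :: "(complex \<Rightarrow> 'a) \<Rightarrow> bool" where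
  "modular_invariant F \<longleftrightarrow> (\<forall>\<tau>. Im \<tau> > 0 \<longrightarrow> F (\<tau> + 1) = F \<tau> \<and> F (-1 / \<tau>) = F \<tau>)"

lemma invariant_translate:
  assumes "modular_invariant F" "Im \<tau> > 0"
  shows "F (\<tau> + of_int n) = F \<tau>"
proof (induction n rule: int_induct[of _ 0])
  case (step1 i)
  have "F (\<tau> + of_int i + 1) = F (\<tau> + of_int i)"
    using assms unfolding modular_invariant_def by simp
  then show ?case using step1 by (simp add: add.assoc)
next
  case (step2 i)
  have "Im (\<tau> + of_int (i - 1)) > 0" using assms by simp
  then have "F (\<tau> + of_int (i - 1) + 1) = F (\<tau> + of_int (i - 1))"
    using assms unfolding modular_invariant_def by blast
  moreover have "\<tau> + of_int (i - 1) + 1 = \<tau> + of_int i" by simp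
  ultimately show ?case using step2 by metis
qed simp

text \<open>
  If \<^term>\<open>Im \<tau> < 1 / 2\<close> and \<^term>\<open>\<bar>Re \<tau>\<bar> \<le> 1 / 2\<close>, then the inversion at least doubles
  the imaginary part.
\<close>

lemma invariant_reach:
  assumes F: "modular_invariant F" and "Im \<tau> > 0"
  shows "\<exists>\<tau>'. Im \<tau>' \<ge> 1 / 2 \<and> F \<tau>' = F \<tau>"
proof -
  have "1 / 2 \<le> 2 ^ n * Im \<tau> \<Longrightarrow> Im \<tau> > 0 \<Longrightarrow> \<exists>\<tau>'. Im \<tau>' \<ge> 1 / 2 \<and> F \<tau>' = F \<tau>" for n
  proof (induction n arbitrary: \<tau>)
    case (Suc n)
    show ?case
    proof (cases "Im \<tau> \<ge> 1 / 2")
      case False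
      define w where "w = \<tau> + of_int (- round (Re \<tau>))"
      have Fw: "F w = F \<tau>" unfolding w_def by (rule invariant_translate[OF F Suc.prems(2)])
      have re: "\<bar>Re w\<bar> \<le> 1 / 2" using of_int_round_abs_le[of "Re \<tau>"] by (simp add: w_def abs_minus_commute)
      have im: "Im w = Im \<tau>" by (simp add: w_def)
      have "(norm w)\<^sup>2 = \<bar>Re w\<bar>\<^sup>2 + \<bar>Im w\<bar>\<^sup>2" by (simp add: cmod_power2)
      also have "\<dots> \<le> (1 / 2)\<^sup>2 + (1 / 2)\<^sup>2"
        using re False Suc.prems(2) by (intro add_mono power_mono) (auto simp: im)
      finally have n: "(norm w)\<^sup>2 \<le> 1 / 2" by (simp add: power2_eq_square)
      have "w \<noteq> 0" using im Suc.prems(2) by auto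
      then have "0 < (norm w)\<^sup>2" by simp
      then have "Im (-1 / w) \<ge> 2 * Im \<tau>"
        unfolding Im_neg_inverse im using n Suc.prems(2) by (simp add: pos_le_divide_eq)
      moreover have "F (-1 / w) = F \<tau>" using F Fw im Suc.prems(2) by (simp add: modular_invariant_def)
      moreover have "1 / 2 \<le> 2 ^ n * Im (-1 / w)"
        using Suc.prems(1) mult_left_mono[OF calculation(1), of "2 ^ n"] by simp
      ultimately show ?thesis using Suc.IH[of "-1 / w"] Suc.prems(2) by auto
    qed blast
  qed auto
  moreover obtain n :: nat where "1 / 2 / Im \<tau> < 2 ^ n" using real_arch_pow[of 2 "1 / 2 / Im \<tau>"] by auto
  then have "1 / 2 \<le> 2 ^ n * Im \<tau>" using assms(2) by (simp add: field_simps)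
  ultimately show ?thesis using assms(2) by blast
qed

lemma qnome_surj:
  fixes N :: nat
  assumes "N > 0" "x \<noteq> 0" "norm x < 1"
  obtains \<tau> where "Im \<tau> > 0" "qnome (\<tau> / of_nat N) = x"
proof
  define \<tau> where "\<tau> = of_nat N * (Ln x / (2 * pi * \<i>))"
  have "ln (norm x) < 0" using assms by simp
  then show "Im \<tau> > 0" using assms
    by (simp add: \<tau>_def Im_divide zero_less_mult_iff divide_less_0_iff mult_less_0_iff)
  have "\<tau> / of_nat N = Ln x / (2 * pi * \<i>)" using assms(1) by (simp add: \<tau>_def)
  then show "qnome (\<tau> / of_nat N) = x" using assms(2) by (simp add: qnome_def)
qed

lemma norm_qnome_div_less_1:
  assumes "Im \<tau> > 0" "N > (0 :: nat)" shows "norm (qnome (\<tau> / of_nat N)) < 1"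
  using assms by (intro norm_qnome_less_1) simp

theorem modular_invariant_constant:
  fixes N :: nat
  assumes F: "modular_invariant F" and N: "N > 0" and G: "G holomorphic_on ball 0 1"
    and FG: "\<And>\<tau>. Im \<tau> > 0 \<Longrightarrow> F \<tau> = G (qnome (\<tau> / of_nat N))" and x: "norm x < 1"
  shows "G x = G 0"
proof -
  define r where "r = exp (- pi / N)"
  have r: "0 < r" "r < 1" using N by (auto simp: r_def)
  obtain w where w: "w \<in> cball 0 r" "\<And>z. z \<in> cball 0 r \<Longrightarrow> norm (G z) \<le> norm (G w)"
  proof -
    have "continuous_on (cball 0 r) (\<lambda>z. norm (G z))"
      using r by (intro continuous_on_norm holomorphic_on_imp_continuous_on holomorphic_on_subset[OF G]) auto
    from continuous_attains_sup[OF compact_cball _ this] r obtain w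
      where "w \<in> cball 0 r" "\<forall>z\<in>cball 0 r. norm (G z) \<le> norm (G w)" by auto
    then show ?thesis using that by blast
  qed
  have "G constant_on ball 0 1"
  proof (rule maximum_modulus_principle[OF G open_ball connected_ball open_ball order_refl])
    show "w \<in> ball 0 1" using w(1) r by auto
    fix z :: complex assume z: "z \<in> ball 0 1"
    show "norm (G z) \<le> norm (G w)"
    proof (cases "z = 0")
      case False
      with z N obtain \<tau> where t: "Im \<tau> > 0" "qnome (\<tau> / of_nat N) = z" using qnome_surj[of N z] by auto
      obtain \<tau>' where t': "Im \<tau>' \<ge> 1 / 2" "F \<tau>' = F \<tau>" using invariant_reach[OF F t(1)] by blast
      have "norm (qnome (\<tau>' / of_nat N)) \<le> r"
        using t'(1) N by (simp add: norm_qnome r_def field_simps)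
      then have "norm (G (qnome (\<tau>' / of_nat N))) \<le> norm (G w)" by (intro w(2)) auto
      moreover have "G z = G (qnome (\<tau>' / of_nat N))"
        using FG[of \<tau>] FG[of \<tau>'] t t' by simp
      ultimately show ?thesis by simp
    qed (use w(2)[of 0] r in auto)
  qed
  then obtain c where c: "\<And>y. y \<in> ball 0 1 \<Longrightarrow> G y = c" unfolding constant_on_def by blast
  show ?thesis using c[of x] c[of 0] x by simp
qed

section \<open>The discriminant\<close>

lemma E_translate [simp]: "E2 (\<tau> + 1) = E2 \<tau>" "E4 (\<tau> + 1) = E4 \<tau>" "E6 (\<tau> + 1) = E6 \<tau>"
  by (simp_all add: E2_def E4_def E6_def lambert_def qnome_add)

definition E2_fps :: "complex fps" where "E2_fps = 1 - 24 * sigma_fps 1"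
definition E4_fps :: "complex fps" where "E4_fps = 1 + 240 * sigma_fps 3"
definition E6_fps :: "complex fps" where "E6_fps = 1 - 504 * sigma_fps 5"

lemma radius_ge_add: "R \<le> fps_conv_radius f \<Longrightarrow> R \<le> fps_conv_radius g \<Longrightarrow> R \<le> fps_conv_radius (f + g)"
  by (rule order_trans[OF _ fps_conv_radius_add]) simp

lemma radius_ge_diff: "R \<le> fps_conv_radius f \<Longrightarrow> R \<le> fps_conv_radius g \<Longrightarrow> R \<le> fps_conv_radius (f - g)"
  by (rule order_trans[OF _ fps_conv_radius_diff]) simp

lemma radius_ge_mult: "R \<le> fps_conv_radius f \<Longrightarrow> R \<le> fps_conv_radius g \<Longrightarrow> R \<le> fps_conv_radius (f * g)"
  by (rule order_trans[OF _ fps_conv_radius_mult]) simp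

lemma radius_ge_power: "R \<le> fps_conv_radius f \<Longrightarrow> R \<le> fps_conv_radius (f ^ n)"
  by (rule order_trans[OF _ fps_conv_radius_power])

lemmas radius_intros = radius_ge_add radius_ge_diff radius_ge_mult radius_ge_power conv_radius_sigma_fps

lemma radius_E_fps: "fps_conv_radius E2_fps \<ge> 1" "fps_conv_radius E4_fps \<ge> 1" "fps_conv_radius E6_fps \<ge> 1"
  unfolding E2_fps_def E4_fps_def E6_fps_def by (intro radius_intros; simp)+

lemma less_radius: "norm x < 1 \<Longrightarrow> 1 \<le> fps_conv_radius f \<Longrightarrow> ereal (norm x) < fps_conv_radius f"
  by (metis ereal_less(3) less_le_trans)

lemma E_eval_fps:
  assumes "Im \<tau> > 0"
  shows "E2 \<tau> = eval_fps E2_fps (qnome \<tau>)" "E4 \<tau> = eval_fps E4_fps (qnome \<tau>)"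
    "E6 \<tau> = eval_fps E6_fps (qnome \<tau>)"
proof -
  have n: "norm (qnome \<tau>) < 1" using assms by simp
  note r = less_radius[OF n conv_radius_sigma_fps]
  have m: "ereal (norm (qnome \<tau>)) < fps_conv_radius (numeral c * sigma_fps k)" for c k
    by (rule less_radius[OF n]) (intro radius_intros, simp_all)
  show "E2 \<tau> = eval_fps E2_fps (qnome \<tau>)" "E4 \<tau> = eval_fps E4_fps (qnome \<tau>)"
    "E6 \<tau> = eval_fps E6_fps (qnome \<tau>)"
    unfolding E2_def E4_def E6_def E2_fps_def E4_fps_def E6_fps_def lambert_eq_sigma_fps[OF assms]
    using m r by (simp_all add: eval_fps_add eval_fps_diff eval_fps_mult)
qed

definition disc :: "complex \<Rightarrow> complex" where
  "disc \<tau> = (E4 \<tau> ^ 3 - E6 \<tau> ^ 2) / 1728"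

text \<open>With a, b the series of the divisor sums of cubes and fifth powers, ((1 + 240 a)^3 - (1
  - 504 b)^2) / 1728 equals (5 a + 7 b)/12 + 100 a^2 + 8000 a^3 - 147 b^2. Only the linear part has
  a denominator; it is taken inside the divisor sum, where 12 divides each term.\<close>

definition disc_sum_fps :: "complex fps" where
  "disc_sum_fps = Abs_fps (\<lambda>n. of_nat (\<Sum>d | d dvd n. (5 * d ^ 3 + 7 * d ^ 5) div 12))"

definition disc_fps :: "complex fps" where
  "disc_fps = disc_sum_fps + 100 * sigma_fps 3 ^ 2 + 8000 * sigma_fps 3 ^ 3 - 147 * sigma_fps 5 ^ 2"

lemma twelve_dvd: "12 dvd 5 * d ^ 3 + 7 * d ^ 5" for d :: nat
proof -
  have "r < 12 \<Longrightarrow> r = 0 \<or> r = 1 \<or> r = 2 \<or> r = 3 \<or> r = 4 \<or> r = 5 \<or> r = 6 \<or> r = 7 \<or> r = 8 \<or> r = 9 \<or> r = 10 \<or> r = 11"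
    for r :: nat by presburger
  from this[of "d mod 12"] have "d mod 12 \<in> {0,1,2,3,4,5,6,7,8,9,10,11}" by simp
  then have a: "(5 * (d mod 12) ^ 3 + 7 * (d mod 12) ^ 5) mod 12 = 0" by auto
  have b: "(5 * d ^ 3 + 7 * d ^ 5) mod 12 = (5 * (d mod 12) ^ 3 + 7 * (d mod 12) ^ 5) mod 12"
    by (intro mod_add_cong mod_mult_cong) (simp_all add: power_mod)
  show ?thesis unfolding dvd_eq_mod_eq_0 by (rule trans[OF b a])
qed

lemma disc_sum_fps: "fps_const 12 * disc_sum_fps = fps_const 5 * sigma_fps 3 + fps_const 7 * sigma_fps 5"
proof (rule fps_ext)
  fix n :: nat
  have "12 * (\<Sum>d | d dvd n. (5 * d ^ 3 + 7 * d ^ 5) div 12) = (\<Sum>d | d dvd n. 5 * d ^ 3 + 7 * d ^ 5)"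
    by (simp add: sum_distrib_left twelve_dvd)
  also have "\<dots> = 5 * (\<Sum>d | d dvd n. d ^ 3) + 7 * (\<Sum>d | d dvd n. d ^ 5)"
    by (simp add: sum.distrib sum_distrib_left)
  finally have "of_nat (12 * (\<Sum>d | d dvd n. (5 * d ^ 3 + 7 * d ^ 5) div 12))
      = (of_nat (5 * (\<Sum>d | d dvd n. d ^ 3) + 7 * (\<Sum>d | d dvd n. d ^ 5)) :: complex)" by simp
  then show "fps_nth (fps_const 12 * disc_sum_fps) n = fps_nth (fps_const 5 * sigma_fps 3 + fps_const 7 * sigma_fps 5) n"
    by (simp only: of_nat_mult of_nat_add of_nat_numeral fps_mult_left_const_nth fps_add_nth
          sigma_fps_nth disc_sum_fps_def fps_nth_Abs_fps)
qed

lemma disc_fps_eq: "1728 * disc_fps = E4_fps ^ 3 - E6_fps ^ 2"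
proof -
  have "12 * disc_sum_fps = 5 * sigma_fps 3 + 7 * sigma_fps 5"
    using disc_sum_fps by (simp add: numeral_fps_const)
  moreover have "1728 * disc_sum_fps = 144 * (12 * disc_sum_fps)" by (simp add: mult.assoc[symmetric])
  ultimately have "1728 * disc_sum_fps = 144 * (5 * sigma_fps 3 + 7 * sigma_fps 5)" by simp
  then show ?thesis
    unfolding disc_fps_def E4_fps_def E6_fps_def
    by (simp add: algebra_simps power2_eq_square power3_eq_cube)
qed

lemma radius_disc_fps: "fps_conv_radius disc_fps \<ge> 1"
proof -
  have *: "disc_fps = fps_const (1 / 1728) * (E4_fps ^ 3 - E6_fps ^ 2)"
    unfolding disc_fps_eq[symmetric] by (simp add: numeral_fps_const mult.assoc[symmetric])
  show ?thesis by (subst *) (intro radius_intros radius_E_fps, simp)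
qed

lemma disc_eval_fps:
  assumes "Im \<tau> > 0" shows "disc \<tau> = eval_fps disc_fps (qnome \<tau>)"
proof -
  have n: "norm (qnome \<tau>) < 1" using assms by simp
  note r = radius_E_fps[THEN less_radius[OF n]] radius_disc_fps[THEN less_radius[OF n]]
     radius_E_fps[THEN radius_ge_power, THEN less_radius[OF n]]
  have "1728 * eval_fps disc_fps (qnome \<tau>) = eval_fps (1728 * disc_fps) (qnome \<tau>)"
    using r by (simp add: eval_fps_mult)
  also have "\<dots> = 1728 * disc \<tau>"
    unfolding disc_fps_eq disc_def using r by (simp add: E_eval_fps[OF assms] eval_fps_diff eval_fps_power)
  finally show ?thesis by simp
qed

lemma disc_inversion:
  assumes "Im \<tau> > 0" shows "disc (-1 / \<tau>) = \<tau> ^ 12 * disc \<tau>"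
  unfolding disc_def Eisenstein_inversion(2,3)[OF assms]
  by (simp add: power_mult_distrib field_simps flip: power_mult)

lemma disc_fps_nth_0: "fps_nth disc_fps 0 = 0"
  by (simp add: disc_fps_def disc_sum_fps_def power2_eq_square power3_eq_cube)

lemma disc_fps_nth_1: "fps_nth disc_fps 1 = 1"
  by (simp add: disc_fps_def disc_sum_fps_def power2_eq_square power3_eq_cube fps_mult_nth numeral_fps_const)

text \<open>
  The function \<open>exp (-24 \<Sum> \<sigma>(n)/n q\<^sup>n)\<close> is the product \<open>\<Prod> (1 - q\<^sup>n)\<^sup>2\<^sup>4\<close>; it has no zeros, and
  the logarithmic derivative of its product with \<open>q\<close> is \<^const>\<open>E2\<close>.
\<close>

definition eta_log_fps :: "complex fps" where
  "eta_log_fps = Abs_fps (\<lambda>n. fps_nth (sigma_fps 1) n / of_nat n)"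

definition eta24 :: "complex \<Rightarrow> complex" where
  "eta24 \<tau> = qnome \<tau> * exp (- 24 * eval_fps eta_log_fps (qnome \<tau>))"

lemma theta_eta_log: "theta eta_log_fps = sigma_fps 1"
proof (rule fps_ext)
  fix n show "fps_nth (theta eta_log_fps) n = fps_nth (sigma_fps 1) n"
    using theta_nth[of 1 eta_log_fps n] by (cases "n = 0") (auto simp: eta_log_fps_def)
qed

lemma radius_eta_log: "fps_conv_radius eta_log_fps \<ge> 1"
proof -
  have "norm (fps_nth eta_log_fps n) \<le> norm (fps_nth (sigma_fps 1) n)" for n
  proof (cases "n = 0")
    case False
    have "norm (fps_nth (sigma_fps 1) n) / real n \<le> norm (fps_nth (sigma_fps 1) n) / 1"
      using False by (intro divide_left_mono) auto
    then show ?thesis by (simp add: eta_log_fps_def norm_divide)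
  qed (simp add: eta_log_fps_def)
  then have "conv_radius (fps_nth (sigma_fps 1)) \<le> conv_radius (fps_nth eta_log_fps)"
    by (rule conv_radius_antimono)
  then show ?thesis using conv_radius_sigma_fps[of 1] unfolding fps_conv_radius_def by simp
qed

lemma eta24_nonzero [simp]: "eta24 \<tau> \<noteq> 0"
  by (simp add: eta24_def)

lemma deriv_eta24:
  assumes "Im \<tau> > 0"
  shows "(eta24 has_field_derivative 2 * pi * \<i> * E2 \<tau> * eta24 \<tau>) (at \<tau>)"
proof -
  have n: "norm (qnome \<tau>) < 1" using assms by simp
  have "((\<lambda>z. eval_fps eta_log_fps (qnome (1 * z))) has_field_derivative
           (2 * pi * \<i> * 1) * eval_fps (theta eta_log_fps) (qnome (1 * \<tau>))) (at \<tau>)"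
    by (rule deriv_eval_fps_qnome) (simp add: less_radius[OF n radius_eta_log])
  then have d: "((\<lambda>z. eval_fps eta_log_fps (qnome z)) has_field_derivative 2 * pi * \<i> * lambert 1 \<tau>) (at \<tau>)"
    by (simp add: theta_eta_log lambert_eq_sigma_fps[OF assms])
  show ?thesis unfolding eta24_def[abs_def]
    by (rule derivative_eq_intros d deriv_qnome refl)+ (simp add: E2_def algebra_simps)
qed

lemma open_upper: "open {\<tau>. Im \<tau> > 0}"
  by (intro open_Collect_less continuous_intros)

text \<open>The quotient R of the two sides has derivative 0: after multiplication by 2 pi i, the
  anomaly of \<open>E2\<close> is 12 z, which matches the logarithmic derivative 12/z of z^12. The
  constant is found at the fixed point \<i>, where \<i>^12 = 1.\<close>

lemma eta24_inversion:
  assumes "Im \<tau> > 0" shows "eta24 (-1 / \<tau>) = \<tau> ^ 12 * eta24 \<tau>"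
proof -
  define R where "R = (\<lambda>\<tau>. eta24 (-1 / \<tau>) / (\<tau> ^ 12 * eta24 \<tau>))"
  have der: "(R has_field_derivative 0) (at z)" if "Im z > 0" for z
  proof -
    have z0: "z \<noteq> 0" using that by auto
    have i: "Im (-1 / z) > 0" using that by (rule Im_neg_inverse_pos)
    have d1: "((\<lambda>z. eta24 (-1 / z)) has_field_derivative
        (2 * pi * \<i> * E2 (-1 / z) * eta24 (-1 / z)) * (1 / z ^ 2)) (at z)"
      by (rule DERIV_chain2[where f = eta24 and g = "\<lambda>z. -1 / z", OF deriv_eta24[OF i]])
         (use z0 in \<open>auto intro!: derivative_eq_intros simp: power2_eq_square\<close>)
    have d2: "((\<lambda>z. z ^ 12 * eta24 z) has_field_derivative
        (12 * z ^ 11 * eta24 z + 2 * pi * \<i> * E2 z * eta24 z * z ^ 12)) (at z)"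
      by (rule derivative_eq_intros deriv_eta24[OF that] refl)+ simp
    have "(R has_field_derivative
       (((2 * pi * \<i> * E2 (-1 / z) * eta24 (-1 / z)) * (1 / z ^ 2)) * (z ^ 12 * eta24 z)
         - eta24 (-1 / z) * (12 * z ^ 11 * eta24 z + 2 * pi * \<i> * E2 z * eta24 z * z ^ 12))
       / ((z ^ 12 * eta24 z) * (z ^ 12 * eta24 z))) (at z)"
      unfolding R_def by (rule DERIV_divide[OF d1 d2]) (use z0 in simp)
    moreover have "((2 * pi * \<i> * E2 (-1 / z) * eta24 (-1 / z)) * (1 / z ^ 2)) * (z ^ 12 * eta24 z)
         = eta24 (-1 / z) * (12 * z ^ 11 * eta24 z + 2 * pi * \<i> * E2 z * eta24 z * z ^ 12)"
    proof -
      have "2 * pi * \<i> * E2 (-1 / z) = 2 * pi * \<i> * (z ^ 2 * E2 z) + 12 * z"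
        unfolding Eisenstein_inversion(1)[OF that] by (simp add: field_simps)
      moreover have "z ^ 12 = z ^ 2 * z ^ 10" "z ^ 11 = z * z ^ 10" by (simp_all flip: power_add power_Suc)
      ultimately show ?thesis using z0 by (simp add: field_simps)
    qed
    ultimately show ?thesis by simp
  qed
  have "R \<tau> = R \<i>"
  proof (rule DERIV_zero_connected_constant[of "{\<tau>. Im \<tau> > 0}" "{}"])
    show "connected {\<tau>. Im \<tau> > 0}" by (intro convex_connected convex_halfspace_Im_gt)
    show "continuous_on {\<tau>. 0 < Im \<tau>} R"
      using der by (intro continuous_at_imp_continuous_on ballI) (auto dest: DERIV_isCont)
  qed (use der assms open_upper in auto)
  also have "R \<i> = 1"
  proof -
    have "\<i> ^ 12 = (1 :: complex)" using power_mult[of \<i> 4 3] by simp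
    then show ?thesis by (simp add: R_def)
  qed
  finally show ?thesis using assms by (auto simp: R_def divide_eq_1_iff split: if_splits)
qed

definition disc_unit :: "complex \<Rightarrow> complex" where
  "disc_unit x = eval_fps (fps_shift 1 disc_fps) x"

lemma holomorphic_disc_unit: "disc_unit holomorphic_on ball 0 1"
  unfolding disc_unit_def[abs_def] using radius_disc_fps
  by (intro holomorphic_on_eval_fps) (auto intro: less_radius)

lemma disc_eq_unit:
  assumes "Im \<tau> > 0" shows "disc \<tau> = qnome \<tau> * disc_unit (qnome \<tau>)"
  using assms disc_fps_nth_0 less_radius[OF _ radius_disc_fps, of "qnome \<tau>"]
    eval_fps_shift_1[of disc_fps "qnome \<tau>"]
  by (simp add: disc_unit_def disc_eval_fps)

text \<open>The quotient of \<open>disc\<close> by the zero-free \<open>eta24\<close> has weight 0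
  and extends to the cusp with value 1, so it is constantly 1. The factor q cancels, hence the
  conclusion also covers the cusp x = 0.\<close>

lemma disc_unit_nonzero:
  assumes "norm x < 1" shows "disc_unit x \<noteq> 0"
proof -
  define G where "G = (\<lambda>x. disc_unit x * exp (24 * eval_fps eta_log_fps x))"
  define F where "F = (\<lambda>\<tau>. disc \<tau> / eta24 \<tau>)"
  define e where "e = eval_fps eta_log_fps"
  have "e holomorphic_on ball 0 1"
    using radius_eta_log unfolding e_def by (intro holomorphic_on_eval_fps) (auto intro: less_radius)
  then have G: "G holomorphic_on ball 0 1"
    unfolding G_def e_def[symmetric] by (intro holomorphic_intros holomorphic_disc_unit)
  have inv: "modular_invariant F"
    unfolding modular_invariant_def F_def
  proof (intro allI impI conjI)
    fix \<tau> :: complex assume t: "Im \<tau> > 0"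
    show "disc (\<tau> + 1) / eta24 (\<tau> + 1) = disc \<tau> / eta24 \<tau>"
      by (simp add: disc_def eta24_def qnome_add)
    have "\<tau> \<noteq> 0" using t by auto
    then show "disc (-1 / \<tau>) / eta24 (-1 / \<tau>) = disc \<tau> / eta24 \<tau>"
      using eta24_inversion[OF t] disc_inversion[OF t] by simp
  qed
  have FG: "F \<tau> = G (qnome (\<tau> / of_nat 1))" if "Im \<tau> > 0" for \<tau>
    by (simp add: F_def G_def disc_eq_unit[OF that] eta24_def exp_minus field_simps)
  have "G x = G 0" by (rule modular_invariant_constant[OF inv _ G FG assms]) auto
  also have "G 0 = 1"
    using disc_fps_nth_1 by (simp add: G_def disc_unit_def eval_fps_at_0 eta_log_fps_def)
  finally show ?thesis unfolding G_def by auto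
qed

lemma disc_nonzero: "Im \<tau> > 0 \<Longrightarrow> disc \<tau> \<noteq> 0"
  using disc_eq_unit disc_unit_nonzero by simp

section \<open>Integer matrices of fixed determinant\<close>

type_synonym imat = "int \<times> int \<times> int \<times> int"

fun idet :: "imat \<Rightarrow> int" where "idet (a, b, c, d) = a * d - b * c"

fun mob :: "imat \<Rightarrow> complex \<Rightarrow> complex" where
  "mob (a, b, c, d) \<tau> = (of_int a * \<tau> + of_int b) / (of_int c * \<tau> + of_int d)"

text \<open>
  The tuple \<^term>\<open>(a, b, c, d)\<close> is the matrix with rows \<^term>\<open>(a, b)\<close> and \<^term>\<open>(c, d)\<close>; \<open>meq\<close> is
  equivalence under left multiplication by the modular group, given by its generators.
\<close>

inductive meq :: "imat \<Rightarrow> imat \<Rightarrow> bool" where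
  meq_refl: "meq M M"
| meq_T: "meq M (a, b, c, d) \<Longrightarrow> meq M (a + c, b + d, c, d)"
| meq_T': "meq M (a, b, c, d) \<Longrightarrow> meq M (a - c, b - d, c, d)"
| meq_S: "meq M (a, b, c, d) \<Longrightarrow> meq M (- c, - d, a, b)"

definition left_invariant :: "(imat \<Rightarrow> 'a) \<Rightarrow> bool" where
  "left_invariant \<Psi> \<longleftrightarrow> (\<forall>a b c d. idet (a, b, c, d) > 0 \<longrightarrow>
     \<Psi> (a + c, b + d, c, d) = \<Psi> (a, b, c, d) \<and> \<Psi> (- c, - d, a, b) = \<Psi> (a, b, c, d))"

lemma meq_idet: "meq M M' \<Longrightarrow> idet M' = idet M"
  by (induction rule: meq.induct) (auto simp: algebra_simps)

lemma meq_invariant: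
  assumes "meq M M'" "left_invariant \<Psi>" "idet M > 0" shows "\<Psi> M' = \<Psi> M"
  using assms
proof (induction rule: meq.induct)
  case (meq_T M a b c d)
  then show ?case using meq_idet[OF meq_T(1)] unfolding left_invariant_def by simp
next
  case (meq_T' M a b c d)
  have "idet (a - c, b - d, c, d) = idet (a, b, c, d)" by (simp add: algebra_simps)
  then have "\<Psi> (a - c + c, b - d + d, c, d) = \<Psi> (a - c, b - d, c, d)"
    using meq_T' meq_idet[OF meq_T'(1)] unfolding left_invariant_def by metis
  with meq_T' show ?case by simp
next
  case (meq_S M a b c d)
  then show ?case using meq_idet[OF meq_S(1)] unfolding left_invariant_def by simp
qed auto

lemma meq_T_pow:
  assumes "meq M (a, b, c, d)" shows "meq M (a + k * c, b + k * d, c, d)"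
proof (induction k rule: int_induct[of _ 0])
  case base then show ?case using assms by simp
next
  case (step1 i) then show ?case using meq_T[OF step1(2)] by (simp add: algebra_simps)
next
  case (step2 i) then show ?case using meq_T'[OF step2(2)] by (simp add: algebra_simps)
qed

text \<open>Hermite normal forms: representatives of the integer matrices of determinant N modulo
  left multiplication by the modular group.\<close>

definition hecke :: "int \<Rightarrow> imat set" where
  "hecke N = {(a, b, c, d). c = 0 \<and> 0 < a \<and> 0 < d \<and> a * d = N \<and> 0 \<le> b \<and> b < d}"

lemma finite_hecke: "finite (hecke N)"
proof (rule finite_subset)
  show "hecke N \<subseteq> {0..N} \<times> {0..N} \<times> {0} \<times> {0..N}"
  proof
    fix M assume "M \<in> hecke N"
    then obtain a b c d where *: "M = (a, b, c, d)" "c = 0" "0 < a" "0 < d" "a * d = N" "0 \<le> b" "b < d"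
      by (auto simp: hecke_def)
    have "a * 1 \<le> a * d" "1 * d \<le> a * d" using * by (intro mult_left_mono mult_right_mono; simp)+
    with * show "M \<in> {0..N} \<times> {0..N} \<times> {0} \<times> {0..N}" by auto
  qed
qed auto

lemma idet_hecke: "M \<in> hecke N \<Longrightarrow> idet M = N"
  by (auto simp: hecke_def)

text \<open>Euclid's algorithm on the first column: powers of T reduce a modulo c, and S exchanges
  the rows. Once c = 0, the sign is corrected and b is reduced modulo d.\<close>

lemma meq_hecke_ex:
  assumes "idet M > 0" shows "\<exists>M'\<in>hecke (idet M). meq M M'"
proof -
  have "meq M (a, b, c, d) \<Longrightarrow> \<exists>M'\<in>hecke (idet M). meq M M'" for a b c d
  proof (induction "nat \<bar>c\<bar>" arbitrary: a b c d rule: less_induct)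
    case less
    show ?case
    proof (cases "c = 0")
      case True
      have det: "a * d = idet M" using meq_idet[OF less(2)] True by simp
      obtain a' b' d' where m: "meq M (a', b', 0, d')" "d' > 0" "a' * d' = idet M"
      proof (cases "d > 0")
        case True then show ?thesis using that[of a b d] less(2) det \<open>c = 0\<close> by simp
      next
        case False
        \<comment> \<open>S applied twice is minus the identity.\<close>
        have "meq M (- a, - b, 0, - d)" using meq_S[OF meq_S[OF less(2)]] \<open>c = 0\<close> by simp
        moreover have "d \<noteq> 0" using det assms by auto
        ultimately show ?thesis using that[of "- a" "- b" "- d"] False det by simp
      qed
      have "meq M (a' + - (b' div d') * 0, b' + - (b' div d') * d', 0, d')" by (rule meq_T_pow[OF m(1)])
      then have "meq M (a', b' mod d', 0, d')" by (simp add: minus_div_mult_eq_mod)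
      moreover have "(a', b' mod d', 0, d') \<in> hecke (idet M)"
        using m assms by (auto simp: hecke_def) (metis zero_less_mult_pos2)
      ultimately show ?thesis by blast
    next
      case False
      have "meq M (a + - (a div c) * c, b + - (a div c) * d, c, d)" by (rule meq_T_pow[OF less(2)])
      then have "meq M (- c, - d, a mod c, b + - (a div c) * d)"
        by (intro meq_S) (simp add: minus_div_mult_eq_mod)
      moreover have "nat \<bar>a mod c\<bar> < nat \<bar>c\<bar>" using False by (simp add: abs_mod_less)
      ultimately show ?thesis by (intro less(1))
    qed
  qed
  then show ?thesis by (metis meq_refl prod_cases4)
qed

text \<open>The lattice spanned by the rows. It does not change under left multiplication by the
  modular group, so it separates the classes, while right multiplication acts on it by a fixed
  injective map.\<close>

fun rowlat :: "imat \<Rightarrow> (int \<times> int) set" where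
  "rowlat (a, b, c, d) = {(x * a + y * c, x * b + y * d) |x y. True}"

lemma rowlat_iff: "(u, v) \<in> rowlat (a, b, c, d) \<longleftrightarrow> (\<exists>x y. u = x * a + y * c \<and> v = x * b + y * d)"
  by auto

lemma left_invariant_rowlat: "left_invariant rowlat"
  unfolding left_invariant_def
proof (intro allI impI conjI)
  fix a b c d :: int
  have "(u, v) \<in> rowlat (a + c, b + d, c, d) \<longleftrightarrow> (u, v) \<in> rowlat (a, b, c, d)" for u v
  proof
    assume "(u, v) \<in> rowlat (a + c, b + d, c, d)"
    then obtain x y where "u = x * (a + c) + y * c" "v = x * (b + d) + y * d" unfolding rowlat_iff by blast
    then show "(u, v) \<in> rowlat (a, b, c, d)"
      unfolding rowlat_iff by (intro exI[of _ x] exI[of _ "x + y"]) (simp add: algebra_simps)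
  next
    assume "(u, v) \<in> rowlat (a, b, c, d)"
    then obtain x y where "u = x * a + y * c" "v = x * b + y * d" unfolding rowlat_iff by blast
    then show "(u, v) \<in> rowlat (a + c, b + d, c, d)"
      unfolding rowlat_iff by (intro exI[of _ x] exI[of _ "y - x"]) (simp add: algebra_simps)
  qed
  then show "rowlat (a + c, b + d, c, d) = rowlat (a, b, c, d)" by (meson subrelI subset_antisym)
  have "(u, v) \<in> rowlat (- c, - d, a, b) \<longleftrightarrow> (u, v) \<in> rowlat (a, b, c, d)" for u v
  proof
    assume "(u, v) \<in> rowlat (- c, - d, a, b)"
    then obtain x y where "u = x * (- c) + y * a" "v = x * (- d) + y * b" unfolding rowlat_iff by blast
    then show "(u, v) \<in> rowlat (a, b, c, d)"
      unfolding rowlat_iff by (intro exI[of _ y] exI[of _ "- x"]) simp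
  next
    assume "(u, v) \<in> rowlat (a, b, c, d)"
    then obtain x y where "u = x * a + y * c" "v = x * b + y * d" unfolding rowlat_iff by blast
    then show "(u, v) \<in> rowlat (- c, - d, a, b)"
      unfolding rowlat_iff by (intro exI[of _ "- y"] exI[of _ x]) simp
  qed
  then show "rowlat (- c, - d, a, b) = rowlat (a, b, c, d)" by (meson subrelI subset_antisym)
qed

text \<open>The lattice determines d, as the generator of its vectors with first coordinate 0, and
  then a through the determinant. The vector (a, b) fixes b modulo d.\<close>

lemma hecke_rowlat_inj:
  assumes "M \<in> hecke N" "M' \<in> hecke N" "rowlat M = rowlat M'" shows "M = M'"
proof -
  obtain a b d a' b' d' where M: "M = (a, b, 0, d)" "M' = (a', b', 0, d')"
    "0 < a" "0 < d" "a * d = N" "0 \<le> b" "b < d" "0 < a'" "0 < d'" "a' * d' = N" "0 \<le> b'" "b' < d'"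
    using assms by (auto simp: hecke_def)
  have dvd: "e dvd f" if "(0, f) \<in> rowlat (a1, b1, 0, e)" "a1 > 0" for a1 b1 e f :: int
    using that unfolding rowlat_iff by auto
  have "(0, d) \<in> rowlat M" "(0, d') \<in> rowlat M'"
    unfolding M rowlat_iff by (intro exI[of _ 0] exI[of _ 1]; simp)+
  then have "d' dvd d" "d dvd d'" using dvd M assms(3) by metis+
  then have d: "d = d'" using M by (simp add: zdvd_antisym_nonneg)
  then have a: "a = a'" using M by auto
  have "(a, b) \<in> rowlat M" unfolding M rowlat_iff by (intro exI[of _ 1] exI[of _ 0]) simp
  then have "(a, b) \<in> rowlat (a, b', 0, d)" unfolding assms(3) unfolding M a d .
  then obtain x y where "a = x * a + y * 0" "b = x * b' + y * d" using rowlat_iff by blast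
  then have "b = b' + y * d" using M by simp
  then have "b mod d = b' mod d" by simp
  then have "b = b'" using M d by simp
  with a d M show ?thesis by simp
qed

text \<open>Right multiplication by the generators \<tau> + 1 and -1/\<tau>; it transfers a change
  of the argument \<tau> to the matrix.\<close>

fun mulT :: "imat \<Rightarrow> imat" where "mulT (a, b, c, d) = (a, a + b, c, c + d)"
fun mulS :: "imat \<Rightarrow> imat" where "mulS (a, b, c, d) = (b, - a, d, - c)"

lemma rowlat_mulT: "rowlat (mulT M) = (\<lambda>(u, v). (u, u + v)) ` rowlat M"
  by (cases M; auto simp: image_iff algebra_simps; blast)

lemma rowlat_mulS: "rowlat (mulS M) = (\<lambda>(u, v). (v, - u)) ` rowlat M"
  by (cases M; auto simp: image_iff algebra_simps; blast)

text \<open>Sending M to the representative of \<open>g M\<close> is injective, since the lattices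
  of classes can be recovered through the injective f, and an injective self-map of a finite set is
  a bijection.\<close>

lemma hecke_permutation:
  assumes N: "N > 0" and g: "\<And>M. idet (g M) = idet M" "\<And>M. rowlat (g M) = f ` rowlat M" "inj f"
  obtains \<sigma> where "bij_betw \<sigma> (hecke N) (hecke N)" "\<And>M. M \<in> hecke N \<Longrightarrow> meq (g M) (\<sigma> M)"
proof -
  have "\<exists>M'\<in>hecke N. meq (g M) M'" if "M \<in> hecke N" for M
    using meq_hecke_ex[of "g M"] that N by (simp add: g idet_hecke)
  then obtain \<sigma> where \<sigma>: "\<And>M. M \<in> hecke N \<Longrightarrow> \<sigma> M \<in> hecke N \<and> meq (g M) (\<sigma> M)" by metis
  have "inj_on \<sigma> (hecke N)"
  proof
    fix M M' assume M: "M \<in> hecke N" "M' \<in> hecke N" "\<sigma> M = \<sigma> M'"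
    have *: "rowlat (\<sigma> M) = rowlat (g M)" if "M \<in> hecke N" for M
      using meq_invariant[OF _ left_invariant_rowlat] \<sigma>[OF that] N idet_hecke[OF that] g(1) by metis
    then have "f ` rowlat M = f ` rowlat M'" using M g(2) by metis
    then have "rowlat M = rowlat M'" using g(3) by (simp add: inj_image_eq_iff)
    with M show "M = M'" by (intro hecke_rowlat_inj)
  qed
  moreover have "\<sigma> ` hecke N \<subseteq> hecke N" using \<sigma> by auto
  ultimately have "bij_betw \<sigma> (hecke N) (hecke N)"
    unfolding bij_betw_def using endo_inj_surj[OF finite_hecke] by blast
  with \<sigma> show ?thesis using that by blast
qed

lemma idet_mulT: "idet (mulT M) = idet M" and idet_mulS: "idet (mulS M) = idet M"
  by (cases M; simp add: algebra_simps)+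

text \<open>The value depends only on the left class of M, and moving \<tau> by a generator amounts
  to multiplying M on the right. Under these two rules the modular group merely permutes the values
  over \<open>hecke N\<close>.\<close>

definition hecke_compatible :: "(imat \<Rightarrow> complex \<Rightarrow> 'a) \<Rightarrow> bool" where
  "hecke_compatible h \<longleftrightarrow> (\<forall>\<tau>. Im \<tau> > 0 \<longrightarrow> left_invariant (\<lambda>M. h M \<tau>) \<and>
     (\<forall>M. idet M > 0 \<longrightarrow> h M (\<tau> + 1) = h (mulT M) \<tau> \<and> h M (-1 / \<tau>) = h (mulS M) \<tau>))"

text \<open>The function f serves two purposes: the identity gives the product of the values, and z
  mapped to the linear polynomial X - z gives all their elementary symmetric functions at
  once.\<close>

lemma hecke_product_invariant:
  fixes f :: "'a \<Rightarrow> 'b :: comm_monoid_mult"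
  assumes h: "hecke_compatible h" and N: "N > 0"
  shows "(\<forall>\<tau>. Im \<tau> > 0 \<longrightarrow> (\<Prod>M\<in>hecke N. f (h M (\<tau> + 1))) = (\<Prod>M\<in>hecke N. f (h M \<tau>)) \<and>
    (\<Prod>M\<in>hecke N. f (h M (-1 / \<tau>))) = (\<Prod>M\<in>hecke N. f (h M \<tau>)))"
proof -
  have main: "(\<Prod>M\<in>hecke N. f (h (g M) \<tau>)) = (\<Prod>M\<in>hecke N. f (h M \<tau>))"
    if t: "Im \<tau> > 0" and g: "\<And>M. idet (g M) = idet M" "\<And>M. rowlat (g M) = \<phi> ` rowlat M" "inj \<phi>" for g \<phi> \<tau>
  proof -
    obtain \<sigma> where \<sigma>: "bij_betw \<sigma> (hecke N) (hecke N)" "\<And>M. M \<in> hecke N \<Longrightarrow> meq (g M) (\<sigma> M)"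
      using hecke_permutation[OF N g] by blast
    have "h (g M) \<tau> = h (\<sigma> M) \<tau>" if "M \<in> hecke N" for M
    proof (rule meq_invariant[OF \<sigma>(2)[OF that], of "\<lambda>M. h M \<tau>", symmetric])
      show "left_invariant (\<lambda>M. h M \<tau>)" using h t by (simp add: hecke_compatible_def)
      show "idet (g M) > 0" using N idet_hecke[OF that] g by simp
    qed
    then have "(\<Prod>M\<in>hecke N. f (h (g M) \<tau>)) = (\<Prod>M\<in>hecke N. f (h (\<sigma> M) \<tau>))" by simp
    also have "\<dots> = (\<Prod>M\<in>hecke N. f (h M \<tau>))" by (rule prod.reindex_bij_betw[OF \<sigma>(1)])
    finally show ?thesis .
  qed
  have "h M (\<tau> + 1) = h (mulT M) \<tau>" "h M (-1 / \<tau>) = h (mulS M) \<tau>" if "Im \<tau> > 0" "M \<in> hecke N" for M \<tau>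
    using h that N idet_hecke[OF that(2)] unfolding hecke_compatible_def by metis+
  then have "(\<Prod>M\<in>hecke N. f (h M (\<tau> + 1))) = (\<Prod>M\<in>hecke N. f (h (mulT M) \<tau>))"
       "(\<Prod>M\<in>hecke N. f (h M (-1 / \<tau>))) = (\<Prod>M\<in>hecke N. f (h (mulS M) \<tau>))" if "Im \<tau> > 0" for \<tau>
    using that by simp_all
  moreover have "inj (\<lambda>(u :: int, v :: int). (u, u + v))" "inj (\<lambda>(u :: int, v :: int). (v, - u))"
    by (auto simp: inj_def)
  ultimately show ?thesis
    using main[OF _ idet_mulT rowlat_mulT] main[OF _ idet_mulS rowlat_mulS] by simp
qed

section \<open>Action on the upper half plane\<close>

lemma mob_denominator_nonzero:
  assumes "Im \<tau> > 0" "idet (a, b, c, d) > 0"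
  shows "of_int c * \<tau> + of_int d \<noteq> 0" "of_int a * \<tau> + of_int b \<noteq> 0"
  using assms by (auto simp: complex_eq_iff)

lemma Im_mob:
  assumes "Im \<tau> > 0" "idet M > 0" shows "Im (mob M \<tau>) > 0"
proof -
  obtain a b c d where M: "M = (a, b, c, d)" by (metis prod_cases4)
  define w where "w = of_int c * \<tau> + of_int d"
  have w0: "w \<noteq> 0" unfolding w_def using mob_denominator_nonzero assms M by blast
  have "Im (mob M \<tau>) = of_int (idet M) * Im \<tau> / (norm w)\<^sup>2"
    unfolding M mob.simps w_def[symmetric] Im_divide cmod_power2[symmetric]
    by (simp add: w_def algebra_simps)
  also have "\<dots> > 0" using assms w0 by (intro divide_pos_pos mult_pos_pos) auto
  finally show ?thesis .
qed

lemma mob_left: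
  assumes "Im \<tau> > 0" "idet (a, b, c, d) > 0"
  shows "mob (a + c, b + d, c, d) \<tau> = mob (a, b, c, d) \<tau> + 1"
    and "mob (- c, - d, a, b) \<tau> = - 1 / mob (a, b, c, d) \<tau>"
  using mob_denominator_nonzero[OF assms] by (simp_all add: field_simps)

lemma mob_right:
  assumes "Im \<tau> > 0" "idet M > 0"
  shows "mob M (\<tau> + 1) = mob (mulT M) \<tau>"
    and "mob M (-1 / \<tau>) = mob (mulS M) \<tau>"
proof -
  obtain a b c d where M: "M = (a, b, c, d)" by (metis prod_cases4)
  show "mob M (\<tau> + 1) = mob (mulT M) \<tau>" by (simp add: M algebra_simps)
  have t0: "\<tau> \<noteq> 0" using assms by auto
  have "mob M (-1 / \<tau>) = (\<tau> * (of_int a * (-1 / \<tau>) + of_int b)) / (\<tau> * (of_int c * (-1 / \<tau>) + of_int d))"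
    unfolding M mob.simps using t0 by simp
  also have "\<dots> = mob (mulS M) \<tau>" unfolding M using t0 by (simp add: algebra_simps)
  finally show "mob M (-1 / \<tau>) = mob (mulS M) \<tau>" .
qed

section \<open>Power series with algebraic integer coefficients\<close>

definition integral_fps :: "complex fps \<Rightarrow> bool" where
  "integral_fps F \<longleftrightarrow> (\<forall>n. algebraic_int (fps_nth F n))"

lemma integral_fps_add: "integral_fps F \<Longrightarrow> integral_fps G \<Longrightarrow> integral_fps (F + G)"
  and integral_fps_diff: "integral_fps F \<Longrightarrow> integral_fps G \<Longrightarrow> integral_fps (F - G)"
  and integral_fps_mult: "integral_fps F \<Longrightarrow> integral_fps G \<Longrightarrow> integral_fps (F * G)"
  and integral_fps_const: "algebraic_int c \<Longrightarrow> integral_fps (fps_const c)"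
  and integral_fps_X: "integral_fps fps_X"
  and integral_fps_shift: "integral_fps F \<Longrightarrow> integral_fps (fps_shift n F)"
  by (auto simp: integral_fps_def fps_mult_nth fps_X_def)

lemma integral_fps_numeral: "integral_fps (numeral n)"
  using integral_fps_const[of "numeral n"] by (simp add: numeral_fps_const)

lemma integral_fps_1: "integral_fps 1"
  using integral_fps_const[of 1] by simp

lemma integral_fps_power: "integral_fps F \<Longrightarrow> integral_fps (F ^ n)"
  by (induction n) (auto intro: integral_fps_mult integral_fps_1)

lemma integral_fps_sigma: "integral_fps (sigma_fps k)"
  by (simp only: integral_fps_def sigma_fps_nth algebraic_int_of_nat simp_thms)

lemma integral_fps_compose: "integral_fps F \<Longrightarrow> integral_fps G \<Longrightarrow> integral_fps (fps_compose F G)"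
  using integral_fps_power[of G]
  unfolding integral_fps_def fps_compose_nth by (auto intro!: algebraic_int_sum algebraic_int_mult)

lemma integral_fps_inverse:
  assumes "integral_fps F" "fps_nth F 0 = 1" shows "integral_fps (inverse F)"
proof -
  have "algebraic_int (fps_nth (inverse F) n)" for n
  proof (induction n rule: less_induct)
    case (less n)
    have "inverse F * F = 1" using assms(2) by (intro inverse_mult_eq_1) simp
    then have "(\<Sum>i=0..n. fps_nth (inverse F) i * fps_nth F (n - i)) = fps_nth 1 n"
      by (metis fps_mult_nth)
    moreover have "{0..n} = insert n {0..<n}" by auto
    ultimately have "fps_nth (inverse F) n = fps_nth 1 n - (\<Sum>i=0..<n. fps_nth (inverse F) i * fps_nth F (n - i))"
      using assms(2) by (simp add: eq_diff_eq)
    also have "algebraic_int \<dots>"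
      using less assms(1) by (intro algebraic_int_diff algebraic_int_sum algebraic_int_mult)
        (auto simp: integral_fps_def)
    finally show ?case .
  qed
  then show ?thesis by (simp add: integral_fps_def)
qed

lemma integral_fps_E: "integral_fps E2_fps" "integral_fps E4_fps"
  unfolding E2_fps_def E4_fps_def
  by (intro integral_fps_diff integral_fps_add integral_fps_mult integral_fps_1 integral_fps_numeral integral_fps_sigma)+

lemma integral_fps_disc: "integral_fps disc_fps"
proof -
  have "integral_fps disc_sum_fps"
    unfolding integral_fps_def disc_sum_fps_def fps_nth_Abs_fps by (intro allI algebraic_int_of_nat)
  then show ?thesis unfolding disc_fps_def
    by (intro integral_fps_diff integral_fps_add integral_fps_mult integral_fps_power integral_fps_numeral integral_fps_sigma)
qed

text \<open>Holomorphy on the whole disc encodes the absence of poles in the upper half plane;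
  integrality of the expansion at 0 is information at the cusp alone.\<close>

definition integral_series :: "(complex \<Rightarrow> complex) \<Rightarrow> bool" where
  "integral_series G \<longleftrightarrow> G holomorphic_on ball 0 1 \<and> (\<exists>F. G has_fps_expansion F \<and> integral_fps F)"

lemma integral_series_eval_fps:
  "fps_conv_radius F \<ge> 1 \<Longrightarrow> integral_fps F \<Longrightarrow> integral_series (eval_fps F)"
  unfolding integral_series_def
  by (intro conjI holomorphic_on_eval_fps exI[of _ F] eval_fps_has_fps_expansion)
     (auto intro: less_radius less_le_trans[of 0 1])

lemma integral_series_add: "integral_series F \<Longrightarrow> integral_series G \<Longrightarrow> integral_series (\<lambda>x. F x + G x)"
  unfolding integral_series_def
  by (blast intro: holomorphic_on_add has_fps_expansion_add integral_fps_add)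

lemma integral_series_diff: "integral_series F \<Longrightarrow> integral_series G \<Longrightarrow> integral_series (\<lambda>x. F x - G x)"
  unfolding integral_series_def
  by (blast intro: holomorphic_on_diff has_fps_expansion_diff integral_fps_diff)

lemma integral_series_mult: "integral_series F \<Longrightarrow> integral_series G \<Longrightarrow> integral_series (\<lambda>x. F x * G x)"
  unfolding integral_series_def
  by (blast intro: holomorphic_on_mult has_fps_expansion_mult integral_fps_mult)

lemma integral_series_const: "algebraic_int c \<Longrightarrow> integral_series (\<lambda>_. c)"
  unfolding integral_series_def
  by (blast intro: holomorphic_on_const has_fps_expansion_const integral_fps_const)

lemma integral_series_power: "integral_series F \<Longrightarrow> integral_series (\<lambda>x. F x ^ n)"
  by (induction n) (auto intro: integral_series_mult integral_series_const)

lemma integral_series_ident: "integral_series (\<lambda>x. x)"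
  unfolding integral_series_def
  by (blast intro: holomorphic_on_ident has_fps_expansion_fps_X integral_fps_X)

lemmas integral_series_intros = integral_series_add integral_series_diff integral_series_mult
  integral_series_const integral_series_power integral_series_ident

text \<open>This is the substitution that replaces \<tau> by M \<tau> in a q-expansion: c is a root
  of unity and m = a^2, as in \<open>hecke_qnome\<close>.\<close>

lemma integral_series_compose:
  assumes F: "integral_series F" and c: "algebraic_int c" "norm c = 1" and m: "m > 0"
  shows "integral_series (\<lambda>x. F (c * x ^ m))"
proof -
  obtain f where f: "F holomorphic_on ball 0 1" "F has_fps_expansion f" "integral_fps f"
    using F unfolding integral_series_def by blast
  have "F \<circ> (\<lambda>x. c * x ^ m) holomorphic_on ball 0 1"
    by (rule holomorphic_on_compose_gen[OF _ f(1)])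
       (use c m in \<open>auto simp: norm_mult norm_power power_less_one_iff intro!: holomorphic_intros\<close>)
  moreover have "(F \<circ> (\<lambda>x. c * x ^ m)) has_fps_expansion fps_compose f (fps_const c * fps_X ^ m)"
    by (intro has_fps_expansion_compose f(2) has_fps_expansion_cmult_left has_fps_expansion_fps_X_power)
       (use m in simp)
  moreover have "integral_fps (fps_compose f (fps_const c * fps_X ^ m))"
    by (intro integral_fps_compose f integral_fps_mult integral_fps_power integral_fps_const c integral_fps_X)
  ultimately show ?thesis unfolding integral_series_def o_def by blast
qed

lemma integral_series_shift:
  assumes F: "integral_series F" and "F 0 = 0"
  obtains G where "integral_series G" "\<And>x. norm x < 1 \<Longrightarrow> F x = x * G x"
proof -
  obtain f where f: "F holomorphic_on ball 0 1" "F has_fps_expansion f" "integral_fps f"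
    using F unfolding integral_series_def by blast
  have r: "fps_conv_radius f \<ge> 1"
    using holomorphic_on_imp_fps_conv_radius_ge[OF f(2), of 1] f(1) by (simp add: one_ereal_def)
  have ev: "eval_fps f x = F x" if "norm x < 1" for x
    by (rule has_fps_expansion_imp_eval_fps_eq[OF f(2) that f(1)])
  have f0: "fps_nth f 0 = 0" using ev[of 0] assms(2) by (simp add: eval_fps_at_0)
  show ?thesis
  proof (rule that)
    show "integral_series (eval_fps (fps_shift 1 f))"
      using r f by (intro integral_series_eval_fps integral_fps_shift) auto
    show "F x = x * eval_fps (fps_shift 1 f) x" if "norm x < 1" for x
    proof (cases "x = 0")
      case False
      then show ?thesis using eval_fps_shift_1[OF f0 less_radius[OF that r]] ev[OF that] by simp
    qed (use assms in simp)
  qed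
qed

lemma integral_series_at_0: "integral_series G \<Longrightarrow> algebraic_int (G 0)"
proof -
  assume "integral_series G"
  then obtain f where f: "G holomorphic_on ball 0 1" "G has_fps_expansion f" "integral_fps f"
    unfolding integral_series_def by blast
  have "eval_fps f 0 = G 0" by (rule has_fps_expansion_imp_eval_fps_eq[OF f(2) _ f(1)]) simp
  then show ?thesis using f(3) by (metis eval_fps_at_0 integral_fps_def)
qed

section \<open>Modular functions are polynomials in the modular invariant\<close>

definition jinv :: "complex \<Rightarrow> complex" where
  "jinv \<tau> = E4 \<tau> ^ 3 / disc \<tau>"

definition inv_disc_unit :: "complex \<Rightarrow> complex" where
  "inv_disc_unit x = inverse (disc_unit x)"

definition jser :: "complex \<Rightarrow> complex" where
  "jser x = eval_fps E4_fps x ^ 3 * inv_disc_unit x"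

lemma integral_series_inv_disc_unit: "integral_series inv_disc_unit"
proof -
  have "disc_unit has_fps_expansion fps_shift 1 disc_fps"
    unfolding disc_unit_def[abs_def] using radius_disc_fps
    by (intro eval_fps_has_fps_expansion) (auto intro: less_le_trans[of 0 1])
  then have "(\<lambda>x. inverse (disc_unit x)) has_fps_expansion inverse (fps_shift 1 disc_fps)"
    using disc_fps_nth_1 by (intro has_fps_expansion_inverse) auto
  moreover have "integral_fps (inverse (fps_shift 1 disc_fps))"
    using disc_fps_nth_1 by (intro integral_fps_inverse integral_fps_shift integral_fps_disc) auto
  moreover have "(\<lambda>x. inverse (disc_unit x)) holomorphic_on ball 0 1"
    using disc_unit_nonzero by (intro holomorphic_intros holomorphic_disc_unit) auto
  ultimately show ?thesis unfolding integral_series_def inv_disc_unit_def[abs_def] by blast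
qed

lemma integral_series_jser: "integral_series jser"
  unfolding jser_def[abs_def]
  by (intro integral_series_intros integral_series_inv_disc_unit integral_series_eval_fps radius_E_fps integral_fps_E)

lemma jser_0: "jser 0 = 1"
  using disc_fps_nth_1 by (simp add: jser_def inv_disc_unit_def disc_unit_def eval_fps_at_0 E4_fps_def)

lemma jinv_eq: "Im \<tau> > 0 \<Longrightarrow> jinv \<tau> * qnome \<tau> = jser (qnome \<tau>)"
  by (simp add: jinv_def jser_def inv_disc_unit_def E_eval_fps disc_eq_unit field_simps)

lemma disc_translate: "disc (\<tau> + 1) = disc \<tau>"
  by (simp add: disc_def)

lemma modular_invariant_jinv: "modular_invariant jinv"
  unfolding modular_invariant_def
proof (intro allI impI conjI)
  fix \<tau> :: complex assume t: "Im \<tau> > 0"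
  show "jinv (\<tau> + 1) = jinv \<tau>" by (simp add: jinv_def disc_translate)
  have "\<tau> \<noteq> 0" using t by auto
  then show "jinv (-1 / \<tau>) = jinv \<tau>"
    unfolding jinv_def disc_inversion[OF t] Eisenstein_inversion[OF t]
    by (simp add: power_mult_distrib flip: power_mult)
qed

lemma qnome_div_power:
  assumes "N > (0 :: nat)" shows "qnome (\<tau> / of_nat N) ^ N = qnome \<tau>"
  using assms by (simp flip: qnome_of_nat_mult)

text \<open>
  \<open>q_laurent N K F G\<close>: in the local parameter \<open>x = exp (2 \<pi> \<i> \<tau> / N)\<close> at the cusp,
  \<open>F = x\<^sup>-\<^sup>K G(x)\<close> with \<open>G\<close> having algebraic integer coefficients.
\<close>

definition q_laurent :: "nat \<Rightarrow> nat \<Rightarrow> (complex \<Rightarrow> complex) \<Rightarrow> (complex \<Rightarrow> complex) \<Rightarrow> bool" where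
  "q_laurent N K F G \<longleftrightarrow> integral_series G \<and>
     (\<forall>\<tau>. Im \<tau> > 0 \<longrightarrow> F \<tau> * qnome (\<tau> / of_nat N) ^ K = G (qnome (\<tau> / of_nat N)))"

lemma q_laurent_mult:
  assumes "q_laurent N K F G" "q_laurent N K' F' G'"
  shows "q_laurent N (K + K') (\<lambda>\<tau>. F \<tau> * F' \<tau>) (\<lambda>x. G x * G' x)"
  unfolding q_laurent_def
proof (intro conjI allI impI)
  show "integral_series (\<lambda>x. G x * G' x)"
    using assms unfolding q_laurent_def by (intro integral_series_mult) auto
  fix \<tau> :: complex assume t: "Im \<tau> > 0"
  define x where "x = qnome (\<tau> / of_nat N)"
  have "G x = F \<tau> * x ^ K" "G' x = F' \<tau> * x ^ K'"
    using assms t unfolding q_laurent_def x_def by simp_all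
  then show "F \<tau> * F' \<tau> * x ^ (K + K') = G x * G' x" by (simp add: power_add mult_ac)
qed

lemma q_laurent_const: "algebraic_int c \<Longrightarrow> q_laurent N 0 (\<lambda>_. c) (\<lambda>_. c)"
  unfolding q_laurent_def by (auto intro: integral_series_const)

lemma q_laurent_raise:
  assumes "q_laurent N K F G" "K \<le> K'" shows "q_laurent N K' F (\<lambda>x. G x * x ^ (K' - K))"
proof -
  have "z ^ K' = z ^ K * z ^ (K' - K)" for z :: complex using assms(2) by (simp flip: power_add)
  then show ?thesis using assms(1) unfolding q_laurent_def
    by (simp add: integral_series_intros mult.assoc[symmetric])
qed

lemma q_laurent_add:
  assumes "q_laurent N K F G" "q_laurent N K' F' G'"
  shows "\<exists>L H. q_laurent N L (\<lambda>\<tau>. F \<tau> + F' \<tau>) H"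
proof -
  have "q_laurent N (K + K') F (\<lambda>x. G x * x ^ K')" "q_laurent N (K + K') F' (\<lambda>x. G' x * x ^ K)"
    using q_laurent_raise[OF assms(1), of "K + K'"] q_laurent_raise[OF assms(2), of "K + K'"] by simp_all
  then have "q_laurent N (K + K') (\<lambda>\<tau>. F \<tau> + F' \<tau>) (\<lambda>x. G x * x ^ K' + G' x * x ^ K)"
    unfolding q_laurent_def by (auto intro!: integral_series_intros simp: distrib_right)
  then show ?thesis by blast
qed

lemma q_laurent_jinv:
  assumes "N > 0" shows "q_laurent N (N * k) (\<lambda>\<tau>. jinv \<tau> ^ k) (\<lambda>x. jser (x ^ N) ^ k)"
  unfolding q_laurent_def
proof (intro conjI allI impI)
  show "integral_series (\<lambda>x. jser (x ^ N) ^ k)"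
    using integral_series_compose[OF integral_series_jser, of 1 N] assms
    by (intro integral_series_power) simp
  fix \<tau> :: complex assume "Im \<tau> > 0"
  then show "jinv \<tau> ^ k * qnome (\<tau> / of_nat N) ^ (N * k) = jser (qnome (\<tau> / of_nat N) ^ N) ^ k"
    unfolding power_mult qnome_div_power[OF assms] by (simp flip: jinv_eq power_mult_distrib)
qed

lemma qnome_eq_1_iff: "qnome z = 1 \<longleftrightarrow> z \<in> \<int>"
proof
  assume "qnome z = 1"
  then obtain n :: int where "Re (2 * of_real pi * \<i> * z) = 0" "Im (2 * of_real pi * \<i> * z) = of_int (2 * n) * pi"
    unfolding qnome_def exp_eq_1 by blast
  then have "Im z = 0" "Re z = of_int n" by simp_all
  then have "z = of_int n" by (simp add: complex_eq_iff)
  then show "z \<in> \<int>" by simp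
next
  assume "z \<in> \<int>"
  then obtain n where "z = of_int n" by (elim Ints_cases)
  then show "qnome z = 1" unfolding qnome_def exp_eq_1 by (auto intro!: exI[of _ n])
qed

text \<open>The translation \<tau> + 1 multiplies the local parameter by a primitive N-th root of
  unity z, so invariance gives G(z x) = z^K G(x). At x = 0 this forces z^K = 1.\<close>

lemma q_laurent_period:
  assumes N: "N > 0" and F: "modular_invariant F" and L: "q_laurent N K F G" and G0: "G 0 \<noteq> 0"
  shows "N dvd K"
proof -
  define z where "z = qnome (1 / of_nat N)"
  have nz: "norm z = 1" by (simp add: z_def norm_qnome)
  have hol: "G holomorphic_on ball 0 1" using L unfolding q_laurent_def integral_series_def by blast
  define H where "H = (\<lambda>x. G (z * x) - z ^ K * G x)"
  have "G \<circ> (\<lambda>x. z * x) holomorphic_on ball 0 1"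
    by (rule holomorphic_on_compose_gen[OF _ hol]) (use nz in \<open>auto simp: norm_mult intro!: holomorphic_intros\<close>)
  then have "H holomorphic_on ball 0 1"
    unfolding H_def o_def by (intro holomorphic_intros hol)
  then have "isCont H 0"
    by (intro continuous_on_interior[OF holomorphic_on_imp_continuous_on]) auto
  then have "(H \<longlongrightarrow> H 0) (at 0)" by (simp add: isCont_def)
  \<comment> \<open>Only x \<noteq> 0 comes from a point of the upper half plane; the value at the
    cusp follows by continuity.\<close>
  moreover have "\<forall>\<^sub>F x in at 0. H x = 0"
  proof -
    have "H x = 0" if "x \<in> ball 0 1 - {0}" for x
    proof -
      from that have x: "x \<noteq> 0" "norm x < 1" by auto
      obtain \<tau> where t: "Im \<tau> > 0" "qnome (\<tau> / of_nat N) = x" using qnome_surj[OF N x] by blast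
      have "qnome ((\<tau> + 1) / of_nat N) = z * x"
        using t(2) by (simp add: add_divide_distrib qnome_add z_def mult.commute)
      moreover have "Im (\<tau> + 1) > 0" using t by simp
      ultimately have e1: "F (\<tau> + 1) * (z * x) ^ K = G (z * x)"
        using L unfolding q_laurent_def by metis
      have e2: "F \<tau> * x ^ K = G x" using L t unfolding q_laurent_def by metis
      have e3: "F (\<tau> + 1) = F \<tau>" using F t by (simp add: modular_invariant_def)
      show ?thesis unfolding H_def e1[symmetric] e2[symmetric] e3 by (simp add: power_mult_distrib)
    qed
    then show ?thesis
      using eventually_at_ball'[of 1 "0::complex" UNIV] by (auto elim!: eventually_mono)
  qed
  ultimately have "H 0 = 0"
    using tendsto_unique[of "at (0::complex)" H] tendsto_eventually by (metis trivial_limit_at)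
  then have "z ^ K = 1" using G0 by (simp add: H_def)
  then have "qnome (of_nat K / of_nat N) = 1"
    using qnome_of_nat_mult[of K "1 / of_nat N"] by (simp add: z_def)
  then obtain n where "of_nat K / (of_nat N :: complex) = of_int n" unfolding qnome_eq_1_iff by (elim Ints_cases)
  then have "(of_int (int K) :: complex) = of_int (n * int N)" using N by (simp add: field_simps)
  then have "int K = n * int N" by (simp only: of_int_eq_iff)
  then have "int N dvd int K" by simp
  then show ?thesis by (simp only: of_nat_dvd_iff)
qed

text \<open>Induction on the pole order K. A nonzero leading coefficient forces K = N k, and since
  \<open>jser 0 = 1\<close>, subtracting \<open>G 0 * jinv \<tau> ^ k\<close> removes it without any
  division, so integrality survives. The leading coefficient is recorded because the integrality of
  j needs it to be a unit.\<close>

theorem modular_function_poly: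
  assumes N: "N > 0" and "modular_invariant F" "q_laurent N K F G"
  shows "\<exists>p. (\<forall>i. algebraic_int (coeff p i)) \<and> (\<forall>\<tau>. Im \<tau> > 0 \<longrightarrow> F \<tau> = poly p (jinv \<tau>)) \<and>
     degree p * N \<le> K \<and> (G 0 \<noteq> 0 \<longrightarrow> lead_coeff p = G 0)"
  using assms(2,3)
proof (induction K arbitrary: F G)
  case 0
  have hol: "G holomorphic_on ball 0 1" and G0: "algebraic_int (G 0)"
    using 0 integral_series_at_0 unfolding q_laurent_def integral_series_def by auto
  have FG: "F \<tau> = G (qnome (\<tau> / of_nat N))" if "Im \<tau> > 0" for \<tau>
    using 0(2) that unfolding q_laurent_def by simp
  have "F \<tau> = G 0" if "Im \<tau> > 0" for \<tau>
    using FG[OF that] modular_invariant_constant[OF 0(1) N hol FG norm_qnome_div_less_1[OF that N]] by simp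
  then show ?case using G0 by (intro exI[of _ "[:G 0:]"]) (auto simp: coeff_pCons split: nat.splits)
next
  case (Suc K)
  have lower: "\<exists>p. (\<forall>i. algebraic_int (coeff p i)) \<and> (\<forall>\<tau>. Im \<tau> > 0 \<longrightarrow> F' \<tau> = poly p (jinv \<tau>)) \<and> degree p * N \<le> K"
    if F': "modular_invariant F'" "q_laurent N (Suc K) F' G'" "G' 0 = 0" for F' G'
  proof -
    have "integral_series G'" using F'(2) unfolding q_laurent_def by blast
    then obtain H where H: "integral_series H" "\<And>x. norm x < 1 \<Longrightarrow> G' x = x * H x"
      using integral_series_shift[of G'] F'(3) by metis
    have "F' \<tau> * qnome (\<tau> / of_nat N) ^ K = H (qnome (\<tau> / of_nat N))" if t: "Im \<tau> > 0" for \<tau>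
    proof -
      define x where "x = qnome (\<tau> / of_nat N)"
      have "norm x < 1" "x \<noteq> 0" using norm_qnome_div_less_1[OF t N] by (auto simp: x_def)
      moreover have "F' \<tau> * x ^ Suc K = G' x" using F'(2) t unfolding q_laurent_def x_def by blast
      ultimately have "x * (F' \<tau> * x ^ K) = x * H x" using H(2) by (simp add: mult_ac)
      then show ?thesis using \<open>x \<noteq> 0\<close> unfolding x_def by simp
    qed
    then have "q_laurent N K F' H" using H(1) unfolding q_laurent_def by blast
    from Suc.IH[OF F'(1) this] show ?thesis by blast
  qed
  show ?case
  proof (cases "G 0 = 0")
    case True
    from lower[OF Suc.prems True] True show ?thesis by auto
  next
    case False
    obtain k where k: "Suc K = N * k" using q_laurent_period[OF N Suc.prems False] by (elim dvdE)
    have aG: "algebraic_int (G 0)" using Suc.prems(2) integral_series_at_0 unfolding q_laurent_def by blast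
    define F' where "F' = (\<lambda>\<tau>. F \<tau> - G 0 * jinv \<tau> ^ k)"
    define G' where "G' = (\<lambda>x. G x - G 0 * jser (x ^ N) ^ k)"
    have inv: "modular_invariant F'"
      using Suc.prems(1) modular_invariant_jinv unfolding F'_def modular_invariant_def by simp
    have "q_laurent N (Suc K) (\<lambda>\<tau>. jinv \<tau> ^ k) (\<lambda>x. jser (x ^ N) ^ k)"
      unfolding k by (rule q_laurent_jinv[OF N])
    then have "q_laurent N (Suc K) F' G'"
      using Suc.prems(2) aG unfolding q_laurent_def F'_def G'_def
      by (auto intro!: integral_series_intros simp: left_diff_distrib mult.assoc simp del: power_Suc)
    moreover have "G' 0 = 0" using N by (simp add: G'_def jser_0 power_0_left)
    ultimately obtain p where p: "\<And>i. algebraic_int (coeff p i)"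
      "\<And>\<tau>. Im \<tau> > 0 \<Longrightarrow> F' \<tau> = poly p (jinv \<tau>)" "degree p * N \<le> K"
      using lower[OF inv] by blast
    have "degree p * N < k * N" using p(3) k by (metis le_imp_less_Suc mult.commute)
    then have deg: "degree p < k" by simp
    define r where "r = p + monom (G 0) k"
    have dr: "degree r = k" "lead_coeff r = G 0"
      using deg False unfolding r_def by (simp_all add: degree_add_eq_right degree_monom_eq coeff_eq_0)
    show ?thesis
    proof (intro exI[of _ r] conjI allI impI)
      show "algebraic_int (coeff r i)" for i using p(1) aG by (auto simp: r_def)
      show "F \<tau> = poly r (jinv \<tau>)" if "Im \<tau> > 0" for \<tau>
        using p(2)[OF that] by (simp add: r_def F'_def poly_monom algebra_simps)
      show "degree r * N \<le> Suc K" using dr k by (simp add: mult.commute)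
    qed (rule dr)
  qed
qed

section \<open>Integrality of values of modular functions\<close>

text \<open>Because a d = N, one has (a \<tau> + b)/d = b/d + a^2 (\<tau>/N). The number \<zeta> =
  exp(2 pi i b/d) is a root of unity, hence a unit among the algebraic integers.\<close>

lemma hecke_qnome:
  assumes M: "M \<in> hecke N" and N: "N > 0"
  obtains a d \<zeta> where "a > 0" "d > 0" "a * d = N" "norm \<zeta> = 1" "algebraic_int \<zeta>" "algebraic_int (inverse \<zeta>)"
    "\<And>\<tau>. Im \<tau> > 0 \<Longrightarrow> qnome (mob M \<tau>) = \<zeta> * qnome (\<tau> / of_nat (nat N)) ^ nat (a * a)"
    "\<And>\<tau>. Im \<tau> > 0 \<Longrightarrow> Im (mob M \<tau>) = of_int a * Im \<tau> / of_int d" "fst M = a" "snd (snd (snd M)) = d"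
    "fst (snd (snd M)) = 0"
proof -
  obtain a b d where m: "M = (a, b, 0, d)" "0 < a" "0 < d" "a * d = N" using M by (auto simp: hecke_def)
  define \<zeta> where "\<zeta> = qnome (of_int b / of_int d)"
  have root: "qnome (of_int b' / of_int d) ^ nat d = 1" for b'
  proof -
    have "of_nat (nat d) * (of_int b' / of_int d :: complex) = of_int b'" using m by simp
    then show ?thesis using qnome_of_nat_mult[of "nat d" "of_int b' / of_int d"] qnome_eq_1_iff[of "of_int b'"] by simp
  qed
  have alg: "algebraic_int (qnome (of_int b' / of_int d))" for b'
    by (rule algebraic_int_power_imp[of _ "nat d"]) (use root m in auto)
  show ?thesis
  proof (rule that[of a d \<zeta>])
    show "norm \<zeta> = 1" by (simp add: \<zeta>_def norm_qnome)
    show "algebraic_int \<zeta>" using alg by (simp add: \<zeta>_def)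
    show "algebraic_int (inverse \<zeta>)" using alg[of "- b"] by (simp add: \<zeta>_def qnome_minus)
    fix \<tau> :: complex assume "Im \<tau> > 0"
    have "(of_int N :: complex) = of_int a * of_int d" unfolding m(4)[symmetric] by simp
    then have "mob M \<tau> = of_int b / of_int d + of_nat (nat (a * a)) * (\<tau> / of_nat (nat N))"
      using m N by (simp add: field_simps)
    then show "qnome (mob M \<tau>) = \<zeta> * qnome (\<tau> / of_nat (nat N)) ^ nat (a * a)"
      by (simp only: qnome_add qnome_of_nat_mult \<zeta>_def)
    show "Im (mob M \<tau>) = of_int a * Im \<tau> / of_int d" by (simp add: m)
  qed (use m in auto)
qed

lemma q_laurent_prod:
  assumes "finite S" "\<And>i. i \<in> S \<Longrightarrow> q_laurent N (K i) (F i) (G i)"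
  shows "q_laurent N (\<Sum>i\<in>S. K i) (\<lambda>\<tau>. \<Prod>i\<in>S. F i \<tau>) (\<lambda>x. \<Prod>i\<in>S. G i x)"
  using assms
proof (induction S rule: finite_induct)
  case empty
  then show ?case using q_laurent_const[of 1 N] by simp
next
  case (insert i S)
  then show ?case using q_laurent_mult[of N "K i" "F i" "G i"] by simp
qed

section \<open>The modular invariant at points fixed by a matrix of nonsquare determinant\<close>

definition j_diff :: "imat \<Rightarrow> complex \<Rightarrow> complex" where
  "j_diff M \<tau> = jinv \<tau> - jinv (mob M \<tau>)"

lemma hecke_compatible_j_diff: "hecke_compatible j_diff"
  unfolding hecke_compatible_def left_invariant_def j_diff_def
proof (intro allI impI conjI)
  fix \<tau> :: complex assume t: "Im \<tau> > 0"
  note J = modular_invariant_jinv[unfolded modular_invariant_def, rule_format]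
  {
    fix a b c d assume p: "idet (a, b, c, d) > 0"
    show "jinv \<tau> - jinv (mob (a + c, b + d, c, d) \<tau>) = jinv \<tau> - jinv (mob (a, b, c, d) \<tau>)"
      "jinv \<tau> - jinv (mob (- c, - d, a, b) \<tau>) = jinv \<tau> - jinv (mob (a, b, c, d) \<tau>)"
      unfolding mob_left[OF t p] using J[OF Im_mob[OF t p]] by simp_all
  next
    fix M assume p: "idet M > 0"
    show "jinv (\<tau> + 1) - jinv (mob M (\<tau> + 1)) = jinv \<tau> - jinv (mob (mulT M) \<tau>)"
      "jinv (-1 / \<tau>) - jinv (mob M (-1 / \<tau>)) = jinv \<tau> - jinv (mob (mulS M) \<tau>)"
      unfolding mob_right[OF t p] using J[OF t] by simp_all
  }
qed

text \<open>In the local parameter, j(\<tau>) has a pole of order N with leading coefficient 1, and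
  j(M \<tau>) a pole of order a^2 with leading coefficient 1/\<zeta>. As N is not a square the
  orders differ, so the difference has leading coefficient 1 or -1/\<zeta>, a unit.\<close>

lemma q_laurent_j_diff:
  assumes M: "M \<in> hecke N" and N: "N > 0" and sq: "\<And>s. s * s \<noteq> N"
  shows "\<exists>K G. q_laurent (nat N) K (j_diff M) G \<and> G 0 \<noteq> 0 \<and> algebraic_int (inverse (G 0))"
proof -
  obtain a d \<zeta> where h: "a > 0" "norm \<zeta> = 1" "algebraic_int \<zeta>" "algebraic_int (inverse \<zeta>)"
    "\<And>\<tau>. Im \<tau> > 0 \<Longrightarrow> qnome (mob M \<tau>) = \<zeta> * qnome (\<tau> / of_nat (nat N)) ^ nat (a * a)"
    using hecke_qnome[OF M N] by metis
  define n where "n = nat N"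
  define m where "m = nat (a * a)"
  have n: "n > 0" and m: "m > 0" using N h(1) by (auto simp: n_def m_def)
  have z0: "\<zeta> \<noteq> 0" using h(2) by auto
  have 1: "q_laurent n n jinv (\<lambda>x. jser (x ^ n))" using q_laurent_jinv[OF n, of 1] by simp
  have 2: "q_laurent n m (\<lambda>\<tau>. jinv (mob M \<tau>)) (\<lambda>x. inverse \<zeta> * jser (\<zeta> * x ^ m))"
    unfolding q_laurent_def
  proof (intro conjI allI impI)
    show "integral_series (\<lambda>x. inverse \<zeta> * jser (\<zeta> * x ^ m))"
      by (intro integral_series_mult integral_series_const h integral_series_compose integral_series_jser m)
    fix \<tau> :: complex assume t: "Im \<tau> > 0"
    have "jinv (mob M \<tau>) * qnome (mob M \<tau>) = jser (qnome (mob M \<tau>))"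
      using t M N by (intro jinv_eq Im_mob) (auto simp: idet_hecke)
    then show "jinv (mob M \<tau>) * qnome (\<tau> / of_nat n) ^ m = inverse \<zeta> * jser (\<zeta> * qnome (\<tau> / of_nat n) ^ m)"
      unfolding h(5)[OF t] m_def[symmetric] n_def[symmetric] using z0 by (auto simp: field_simps)
  qed
  define L where "L = max n m"
  define G where "G = (\<lambda>x. jser (x ^ n) * x ^ (L - n) - inverse \<zeta> * jser (\<zeta> * x ^ m) * x ^ (L - m))"
  have "q_laurent n L jinv (\<lambda>x. jser (x ^ n) * x ^ (L - n))"
    "q_laurent n L (\<lambda>\<tau>. jinv (mob M \<tau>)) (\<lambda>x. inverse \<zeta> * jser (\<zeta> * x ^ m) * x ^ (L - m))"
    using q_laurent_raise[OF 1, of L] q_laurent_raise[OF 2, of L] by (simp_all add: L_def)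
  then have "q_laurent n L (j_diff M) G"
    unfolding q_laurent_def G_def j_diff_def by (simp add: integral_series_diff left_diff_distrib)
  moreover have "n \<noteq> m" using sq[of a] N h(1) by (auto simp: n_def m_def nat_eq_iff)
  then have "G 0 = 1 \<or> G 0 = - inverse \<zeta>"
    using n m by (auto simp: G_def L_def max_def jser_0 power_0_left)
  then have "G 0 \<noteq> 0 \<and> algebraic_int (inverse (G 0))" using z0 h(3) by auto
  ultimately show ?thesis unfolding n_def by blast
qed

text \<open>The representative of \<open>M0\<close> contributes a factor that vanishes at the fixed
  point, so \<open>jinv \<tau>\<close> is a root of the polynomial expressing the product through j.
  Its leading coefficient is a product of units and can be divided out.\<close>

theorem algebraic_int_jinv:
  assumes t: "Im \<tau> > 0" and M0: "idet M0 > 0" "mob M0 \<tau> = \<tau>" and sq: "\<And>s. s * s \<noteq> idet M0"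
  shows "algebraic_int (jinv \<tau>)"
proof -
  define N where "N = idet M0"
  have N: "N > 0" "nat N > 0" using M0 by (auto simp: N_def)
  define F where "F = (\<lambda>\<tau>. \<Prod>M\<in>hecke N. j_diff M \<tau>)"
  have "\<exists>K G. q_laurent (nat N) K (j_diff M) G \<and> G 0 \<noteq> 0 \<and> algebraic_int (inverse (G 0))" if "M \<in> hecke N" for M
    using q_laurent_j_diff[OF that N(1)] sq by (simp add: N_def)
  then obtain K G where KG: "\<And>M. M \<in> hecke N \<Longrightarrow> q_laurent (nat N) (K M) (j_diff M) (G M)"
    "\<And>M. M \<in> hecke N \<Longrightarrow> G M 0 \<noteq> 0" "\<And>M. M \<in> hecke N \<Longrightarrow> algebraic_int (inverse (G M 0))" by metis
  have inv: "modular_invariant F"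
    using hecke_product_invariant[OF hecke_compatible_j_diff N(1), of "\<lambda>z. z"]
    unfolding modular_invariant_def F_def by blast
  have L: "q_laurent (nat N) (\<Sum>M\<in>hecke N. K M) F (\<lambda>x. \<Prod>M\<in>hecke N. G M x)"
    unfolding F_def by (rule q_laurent_prod[OF finite_hecke KG(1)])
  from modular_function_poly[OF N(2) inv L] obtain p where p: "\<And>i. algebraic_int (coeff p i)"
     "\<And>\<tau>. Im \<tau> > 0 \<Longrightarrow> F \<tau> = poly p (jinv \<tau>)"
     "(\<Prod>M\<in>hecke N. G M 0) \<noteq> 0 \<Longrightarrow> lead_coeff p = (\<Prod>M\<in>hecke N. G M 0)" by blast
  have nz: "(\<Prod>M\<in>hecke N. G M 0) \<noteq> 0" using KG(2) finite_hecke by simp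
  have lead: "algebraic_int (inverse (lead_coeff p))" "lead_coeff p \<noteq> 0"
  proof -
    have "algebraic_int (\<Prod>M\<in>S. inverse (G M 0))" if "finite S" "S \<subseteq> hecke N" for S
      using that KG(3) by (induction S rule: finite_induct) auto
    from this[OF finite_hecke order_refl] show "algebraic_int (inverse (lead_coeff p))"
      unfolding p(3)[OF nz] by (simp add: prod_inversef[unfolded comp_def])
    show "lead_coeff p \<noteq> 0" unfolding p(3)[OF nz] by (rule nz)
  qed
  obtain M where M: "M \<in> hecke N" "meq M0 M" using meq_hecke_ex[OF M0(1)] by (auto simp: N_def)
  have "left_invariant (\<lambda>M. j_diff M \<tau>)"
    using hecke_compatible_j_diff t unfolding hecke_compatible_def by blast
  from meq_invariant[OF M(2) this M0(1)] have "j_diff M \<tau> = 0" by (simp add: j_diff_def M0(2))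
  then have "F \<tau> = 0" unfolding F_def using M(1) finite_hecke by auto
  then have "poly p (jinv \<tau>) = 0" using p(2)[OF t] by simp
  then have root: "poly (Polynomial.smult (inverse (lead_coeff p)) p) (jinv \<tau>) = 0" by simp
  have monic: "lead_coeff (Polynomial.smult (inverse (lead_coeff p)) p) = 1"
    unfolding lead_coeff_smult using lead(2) by (rule left_inverse)
  have "algebraic_int (coeff (Polynomial.smult (inverse (lead_coeff p)) p) i)" for i
    unfolding coeff_smult by (intro algebraic_int_mult lead(1) p(1))
  with monic root show ?thesis by (rule algebraic_int_integrally_closed)
qed

lemma qnome_of_int [simp]: "qnome (of_int n) = 1"
  by (simp add: qnome_eq_1_iff)

section \<open>The completed Eisenstein series of weight 2 under integer matrices\<close>

lemma E2star_translate: "E2star (\<tau> + of_int n) = E2star \<tau>"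
  by (simp add: E2star_def E2_def lambert_def qnome_add)

text \<open>Writing the square of |\<tau>| as \<tau> (\<tau> - 2 \<i> Im \<tau>), the completing
  term produces exactly the multiple of \<tau> that cancels the anomaly of
  \<open>E2\<close>.\<close>

lemma E2star_inversion:
  assumes "Im \<tau> > 0" shows "E2star (-1 / \<tau>) = \<tau>\<^sup>2 * E2star \<tau>"
proof -
  have t0: "\<tau> \<noteq> 0" and i0: "complex_of_real (Im \<tau>) \<noteq> 0" using assms by auto
  have p0: "complex_of_real pi \<noteq> 0" by simp
  have nn: "of_real ((norm \<tau>)\<^sup>2) = \<tau> * cnj \<tau>" by (rule complex_norm_square)
  have cj: "cnj \<tau> = \<tau> - 2 * \<i> * of_real (Im \<tau>)" by (simp add: complex_eq_iff)
  have "complex_of_real (3 / (pi * Im (-1 / \<tau>))) = 3 * of_real ((norm \<tau>)\<^sup>2) / (of_real pi * of_real (Im \<tau>))"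
    unfolding Im_neg_inverse using assms t0 by simp
  also have "\<dots> = 3 * \<tau> ^ 2 / (of_real pi * of_real (Im \<tau>)) - 6 * \<i> * \<tau> / of_real pi"
    unfolding nn cj using i0 p0 by (simp add: field_simps power2_eq_square)
  finally have r1: "complex_of_real (3 / (pi * Im (-1 / \<tau>))) = 3 * \<tau> ^ 2 / (of_real pi * of_real (Im \<tau>)) - 6 * \<i> * \<tau> / of_real pi" .
  have r2: "6 * \<tau> / (of_real pi * \<i>) = - (6 * \<i> * \<tau> / of_real pi)" by (simp add: field_simps)
  have r3: "complex_of_real (3 / (pi * Im \<tau>)) = 3 / (of_real pi * of_real (Im \<tau>))" by simp
  show ?thesis
    unfolding E2star_def Eisenstein_inversion(1)[OF assms] r1 r2 r3 by (simp add: right_diff_distrib)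
qed

text \<open>
  For upper triangular \<open>M\<close> the nonholomorphic parts of \<open>E2\<^sup>* | M\<close> and \<open>E2\<^sup>*\<close> cancel.
\<close>

definition slash_diff :: "imat \<Rightarrow> complex \<Rightarrow> complex" where
  "slash_diff M \<tau> = (case M of (a, b, c, d) \<Rightarrow>
     of_int (idet M) / (of_int c * \<tau> + of_int d)\<^sup>2 * E2star (mob M \<tau>) - E2star \<tau>)"

text \<open>The sixth power has weight 12, like \<open>disc\<close>, so the quotient has weight 0.
  The determinant clears denominators: for upper triangular M, N times \<open>slash_diff M\<close>
  is a^2 E2(M \<tau>) - N E2(\<tau>).\<close>

definition slash_ratio :: "imat \<Rightarrow> complex \<Rightarrow> complex" where
  "slash_ratio M \<tau> = (of_int (idet M) * slash_diff M \<tau>) ^ 6 / disc \<tau>"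

lemma slash_diff_left:
  assumes t: "Im \<tau> > 0" and p: "idet (a, b, c, d) > 0"
  shows "slash_diff (a + c, b + d, c, d) \<tau> = slash_diff (a, b, c, d) \<tau>"
    and "slash_diff (- c, - d, a, b) \<tau> = slash_diff (a, b, c, d) \<tau>"
proof -
  have i: "idet (a + c, b + d, c, d) = idet (a, b, c, d)" "idet (- c, - d, a, b) = idet (a, b, c, d)"
    by (simp_all add: algebra_simps)
  note nz = mob_denominator_nonzero[OF t p]
  show "slash_diff (a + c, b + d, c, d) \<tau> = slash_diff (a, b, c, d) \<tau>"
    using E2star_translate[of _ 1] unfolding slash_diff_def prod.case mob_left[OF t p] i by simp
  \<comment> \<open>The factor (M \<tau>)^2 from the inversion law of \<open>E2star\<close> converts
    the denominator of the row (a, b) into that of the row (c, d).\<close>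
  have "mob (a, b, c, d) \<tau> ^ 2 / (of_int a * \<tau> + of_int b) ^ 2 = 1 / (of_int c * \<tau> + of_int d) ^ 2"
    using nz by (simp add: power_divide)
  moreover have "n / X * (P * e) = n / Y * e" if "P / X = 1 / Y" for n X P Y e :: complex
  proof -
    have "n / X * (P * e) = n * (P / X) * e" by simp
    then show ?thesis unfolding that by simp
  qed
  ultimately have r: "n / (of_int a * \<tau> + of_int b)\<^sup>2 * ((mob (a, b, c, d) \<tau>)\<^sup>2 * e) = n / (of_int c * \<tau> + of_int d)\<^sup>2 * e" for n e
    by blast
  show "slash_diff (- c, - d, a, b) \<tau> = slash_diff (a, b, c, d) \<tau>"
    unfolding slash_diff_def prod.case mob_left[OF t p] i E2star_inversion[OF Im_mob[OF t p]] r ..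
qed

lemma slash_diff_right:
  assumes t: "Im \<tau> > 0" and p: "idet M > 0"
  shows "slash_diff M (\<tau> + 1) = slash_diff (mulT M) \<tau>"
    and "slash_diff M (-1 / \<tau>) = \<tau>\<^sup>2 * slash_diff (mulS M) \<tau>"
proof -
  obtain a b c d where M: "M = (a, b, c, d)" by (metis prod_cases4)
  have t0: "\<tau> \<noteq> 0" using t by auto
  have T: "of_int c * (\<tau> + 1) + of_int d = of_int c * \<tau> + of_int (c + d)" by (simp add: algebra_simps)
  show "slash_diff M (\<tau> + 1) = slash_diff (mulT M) \<tau>"
  proof -
    have "slash_diff M (\<tau> + 1) = of_int (idet M) / (of_int c * \<tau> + of_int (c + d))\<^sup>2 * E2star (mob (mulT M) \<tau>) - E2star \<tau>"
      unfolding slash_diff_def mob_right(1)[OF t p] E2star_translate[of \<tau> 1, simplified] unfolding M prod.case T ..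
    then show ?thesis using idet_mulT[of M] unfolding slash_diff_def M by simp
  qed
  have S: "of_int c * (-1 / \<tau>) + of_int d = (of_int d * \<tau> + of_int (- c)) / \<tau>" using t0 by (simp add: field_simps)
  have "slash_diff M (-1 / \<tau>) = of_int (idet M) / ((of_int d * \<tau> + of_int (- c)) / \<tau>)\<^sup>2 * E2star (mob (mulS M) \<tau>) - \<tau>\<^sup>2 * E2star \<tau>"
    unfolding slash_diff_def mob_right(2)[OF t p] E2star_inversion[OF t] unfolding M prod.case S ..
  also have "\<dots> = \<tau>\<^sup>2 * slash_diff (mulS M) \<tau>"
    using idet_mulS[of M] unfolding slash_diff_def M by (simp add: power_divide right_diff_distrib)
  finally show "slash_diff M (-1 / \<tau>) = \<tau>\<^sup>2 * slash_diff (mulS M) \<tau>" .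
qed

lemma hecke_compatible_slash_ratio: "hecke_compatible slash_ratio"
  unfolding hecke_compatible_def left_invariant_def
proof (intro allI impI conjI)
  fix \<tau> :: complex assume t: "Im \<tau> > 0"
  then have t0: "\<tau> \<noteq> 0" by auto
  {
    fix a b c d assume p: "idet (a, b, c, d) > 0"
    have i: "idet (a + c, b + d, c, d) = idet (a, b, c, d)" "idet (- c, - d, a, b) = idet (a, b, c, d)"
      by (simp_all add: algebra_simps)
    show "slash_ratio (a + c, b + d, c, d) \<tau> = slash_ratio (a, b, c, d) \<tau>"
      "slash_ratio (- c, - d, a, b) \<tau> = slash_ratio (a, b, c, d) \<tau>"
      unfolding slash_ratio_def slash_diff_left[OF t p] i by simp_all
  next
    fix M assume p: "idet M > 0"
    show "slash_ratio M (\<tau> + 1) = slash_ratio (mulT M) \<tau>"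
      unfolding slash_ratio_def slash_diff_right[OF t p] disc_translate idet_mulT ..
    have "(\<tau>\<^sup>2) ^ 6 = \<tau> ^ 12" by (simp flip: power_mult)
    then show "slash_ratio M (-1 / \<tau>) = slash_ratio (mulS M) \<tau>"
      unfolding slash_ratio_def slash_diff_right[OF t p] disc_inversion[OF t] idet_mulS
      using t0 by (simp add: power_mult_distrib)
  }
qed

text \<open>The numerator is a power series in the local parameter x, so a pole can only come from
  1/\<open>disc\<close>; its order in x is N because q = x^N.\<close>

lemma q_laurent_slash_ratio:
  assumes M: "M \<in> hecke N" and N: "N > 0"
  shows "\<exists>K G. q_laurent (nat N) K (slash_ratio M) G"
proof -
  obtain a d \<zeta> where h: "a > 0" "d > 0" "a * d = N" "norm \<zeta> = 1" "algebraic_int \<zeta>"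
    "\<And>\<tau>. Im \<tau> > 0 \<Longrightarrow> qnome (mob M \<tau>) = \<zeta> * qnome (\<tau> / of_nat (nat N)) ^ nat (a * a)"
    "\<And>\<tau>. Im \<tau> > 0 \<Longrightarrow> Im (mob M \<tau>) = of_int a * Im \<tau> / of_int d"
    "fst M = a" "snd (snd (snd M)) = d" "fst (snd (snd M)) = 0"
    using hecke_qnome[OF M N] by metis
  define n where "n = nat N"
  define m where "m = nat (a * a)"
  have n: "n > 0" and m: "m > 0" using N h(1) by (auto simp: n_def m_def)
  have det: "idet M = N" using M by (rule idet_hecke)
  have Nc: "(of_int N :: complex) = of_int a * of_int d" unfolding h(3)[symmetric] by simp
  have diff: "of_int N * slash_diff M \<tau> = of_int (a * a) * E2 (mob M \<tau>) - of_int N * E2 \<tau>"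
    if t: "Im \<tau> > 0" for \<tau>
  proof -
    have "slash_diff M \<tau> = of_int N / (of_int d)\<^sup>2 * E2star (mob M \<tau>) - E2star \<tau>"
      using h(9,10) det unfolding slash_diff_def by (auto split: prod.splits)
    also have "of_int N / (of_int d)\<^sup>2 = (of_int a / of_int d :: complex)"
      unfolding Nc using h(2) by (simp add: power2_eq_square)
    also have "E2star (mob M \<tau>) = E2 (mob M \<tau>) - of_int d / of_int a * of_real (3 / (pi * Im \<tau>))"
      unfolding E2star_def h(7)[OF t] by (simp add: mult_ac)
    finally have s: "slash_diff M \<tau> = of_int a / of_int d * (E2 (mob M \<tau>) - of_int d / of_int a * of_real (3 / (pi * Im \<tau>)))
        - (E2 \<tau> - of_real (3 / (pi * Im \<tau>)))" unfolding E2star_def .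
    have alg: "u * v * (u / v * (x - v / u * w) - (y - w)) = u * u * x - u * v * y" if "u \<noteq> 0" "v \<noteq> 0" for u v w x y :: complex
      using that by (simp add: field_simps)
    show ?thesis unfolding Nc s of_int_mult by (rule alg) (use h(1,2) in auto)
  qed
  define e where "e = eval_fps E2_fps"
  have e: "integral_series e" unfolding e_def by (intro integral_series_eval_fps radius_E_fps integral_fps_E)
  define G where "G = (\<lambda>x. (of_int (a * a) * e (\<zeta> * x ^ m) - of_int N * e (1 * x ^ n)) ^ 6 * inv_disc_unit (1 * x ^ n))"
  have "q_laurent n n (slash_ratio M) G"
    unfolding q_laurent_def
  proof (intro conjI allI impI)
    show "integral_series G" unfolding G_def
      by (intro integral_series_mult integral_series_power integral_series_diff integral_series_const
            integral_series_compose e integral_series_inv_disc_unit h m n) auto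
    fix \<tau> :: complex assume t: "Im \<tau> > 0"
    define x where "x = qnome (\<tau> / of_nat n)"
    have x: "qnome \<tau> = x ^ n" "qnome (mob M \<tau>) = \<zeta> * x ^ m"
      using qnome_div_power[OF n] h(6)[OF t] by (simp_all add: x_def n_def m_def)
    have "E2 (mob M \<tau>) = e (\<zeta> * x ^ m)"
      using E_eval_fps(1)[OF Im_mob[OF t]] det N by (simp add: e_def x)
    moreover have "E2 \<tau> = e (x ^ n)" using E_eval_fps(1)[OF t] by (simp add: e_def x)
    moreover have "1 / disc \<tau> * x ^ n = inv_disc_unit (x ^ n)"
      unfolding disc_eq_unit[OF t] x inv_disc_unit_def using qnome_nonzero[of \<tau>] unfolding x
      by (simp add: field_simps)
    ultimately show "slash_ratio M \<tau> * x ^ n = G x"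
      unfolding slash_ratio_def det diff[OF t] G_def by (simp flip: times_divide_eq_left) (simp add: divide_inverse mult.assoc)
  qed
  then show ?thesis unfolding n_def by blast
qed

lemma q_laurent_coeff_prod:
  assumes "finite S" "\<And>M. M \<in> S \<Longrightarrow> \<exists>K G. q_laurent n K (h M) G"
  shows "\<exists>K G. q_laurent n K (\<lambda>\<tau>. coeff (\<Prod>M\<in>S. [:- h M \<tau>, 1:]) i) G"
  using assms
proof (induction S arbitrary: i rule: finite_induct)
  case empty
  have "algebraic_int (coeff 1 i :: complex)" by (cases "i = 0") auto
  from q_laurent_const[OF this] show ?case unfolding prod.empty by blast
next
  case (insert M S)
  have IH: "\<exists>K G. q_laurent n K (\<lambda>\<tau>. coeff (\<Prod>M\<in>S. [:- h M \<tau>, 1:]) i) G" for i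
    using insert by auto
  obtain K G where 1: "q_laurent n K (h M) G" using insert.prems[of M] by blast
  obtain K1 G1 where 2: "q_laurent n K1 (\<lambda>\<tau>. coeff (\<Prod>M\<in>S. [:- h M \<tau>, 1:]) i) G1" using IH by blast
  have "algebraic_int (- 1 :: complex)" by simp
  note 3 = q_laurent_mult[OF q_laurent_const[OF this] q_laurent_mult[OF 1 2]]
  have 4: "\<exists>K G. q_laurent n K (\<lambda>\<tau>. if i = 0 then 0 else coeff (\<Prod>M\<in>S. [:- h M \<tau>, 1:]) (i - 1)) G"
    using IH[of "i - 1"] q_laurent_const[of 0 n] by (cases "i = 0") auto
  obtain L H where "q_laurent n L (\<lambda>\<tau>. - 1 * (h M \<tau> * coeff (\<Prod>M\<in>S. [:- h M \<tau>, 1:]) i) +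
     (if i = 0 then 0 else coeff (\<Prod>M\<in>S. [:- h M \<tau>, 1:]) (i - 1))) H"
    using 4 q_laurent_add[OF 3] by blast
  moreover have "coeff (\<Prod>M\<in>insert M S. [:- h M \<tau>, 1:]) i = - 1 * (h M \<tau> * coeff (\<Prod>M\<in>S. [:- h M \<tau>, 1:]) i) +
     (if i = 0 then 0 else coeff (\<Prod>M\<in>S. [:- h M \<tau>, 1:]) (i - 1))" for \<tau>
    using insert.hyps by (cases i) (auto simp: coeff_pCons)
  ultimately show ?case by auto
qed

text \<open>The monic polynomial Q has all the ratios as roots. Its coefficients are modular
  functions, hence polynomials in j with algebraic integer coefficients, and therefore algebraic
  integers at \<tau>.\<close>

theorem algebraic_int_slash_ratio:
  assumes t: "Im \<tau> > 0" and N: "N > 0" and M: "M \<in> hecke N" and j: "algebraic_int (jinv \<tau>)"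
  shows "algebraic_int (slash_ratio M \<tau>)"
proof (rule algebraic_int_integrally_closed)
  define Q where "Q = (\<lambda>\<tau>. \<Prod>M\<in>hecke N. [:- slash_ratio M \<tau>, 1:])"
  show "lead_coeff (Q \<tau>) = 1" unfolding Q_def by (simp add: lead_coeff_prod)
  show "poly (Q \<tau>) (slash_ratio M \<tau>) = 0"
    unfolding Q_def poly_prod using M finite_hecke by auto
  fix i
  have nN: "nat N > 0" using N by simp
  have inv: "modular_invariant (\<lambda>\<tau>. coeff (Q \<tau>) i)"
    using hecke_product_invariant[OF hecke_compatible_slash_ratio N, of "\<lambda>z. [:- z, 1:]"]
    unfolding modular_invariant_def Q_def by simp
  obtain K G where "q_laurent (nat N) K (\<lambda>\<tau>. coeff (Q \<tau>) i) G"
    unfolding Q_def using q_laurent_coeff_prod[OF finite_hecke[of N], of "nat N" slash_ratio i] q_laurent_slash_ratio[OF _ N] by blast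
  from modular_function_poly[OF nN inv this] obtain p where p: "\<And>i. algebraic_int (coeff p i)"
     "\<And>\<tau>. Im \<tau> > 0 \<Longrightarrow> coeff (Q \<tau>) i = poly p (jinv \<tau>)" by blast
  show "algebraic_int (coeff (Q \<tau>) i)"
    unfolding p(2)[OF t] poly_altdef using p(1) j
    by (intro algebraic_int_sum algebraic_int_mult algebraic_int_power)
qed

section \<open>Complex multiplication\<close>

text \<open>The number w = 2 C \<tau> + B has positive imaginary part and real square B^2 - 4 A C,
  so it is purely imaginary.\<close>

lemma CM_discriminant_neg:
  fixes \<tau> :: complex and A B C :: int
  assumes t: "Im \<tau> > 0" and eq: "of_int A + of_int B * \<tau> + of_int C * \<tau>\<^sup>2 = 0" and C: "C > 0"
  shows "B\<^sup>2 < 4 * A * C"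
proof -
  define w where "w = 2 * of_int C * \<tau> + of_int B"
  have "w\<^sup>2 = of_int (B\<^sup>2 - 4 * A * C) + 4 * of_int C * (of_int A + of_int B * \<tau> + of_int C * \<tau>\<^sup>2)"
    by (simp add: w_def power2_eq_square algebra_simps)
  then have w2: "w\<^sup>2 = of_int (B\<^sup>2 - 4 * A * C)" unfolding eq by simp
  have "Im w > 0" using t C by (simp add: w_def)
  moreover from w2 have "Im (w\<^sup>2) = 0" by (simp only: complex_Im_of_int)
  ultimately have "Re w = 0" by (simp add: power2_eq_square)
  moreover from w2 have "Re (w\<^sup>2) = of_int (B\<^sup>2 - 4 * A * C)" by (simp only: complex_Re_of_int)
  ultimately have "of_int (B\<^sup>2 - 4 * A * C) = - (Im w * Im w)" by (simp add: power2_eq_square)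
  also have "\<dots> < 0" using \<open>Im w > 0\<close> by simp
  finally show ?thesis by linarith
qed

text \<open>Adding any multiple a of the identity to the matrix with rows (0, -A), (C, B) keeps
  \<tau> fixed. With trace u = 2 a + B and m = 4 A C - B^2, four times the determinant is u^2 +
  m.\<close>

lemma CM_matrix:
  fixes \<tau> :: complex and A B C :: int
  assumes t: "Im \<tau> > 0" and eq: "of_int A + of_int B * \<tau> + of_int C * \<tau>\<^sup>2 = 0" and C: "C > 0"
  obtains M where "idet M > 0" "mob M \<tau> = \<tau>" "\<And>s. s * s \<noteq> idet M"
proof -
  define m where "m = 4 * A * C - B\<^sup>2"
  have m: "m > 0" using CM_discriminant_neg[OF assms] by (simp add: m_def)
  \<comment> \<open>This size of a makes u \<ge> m, so u^2 + m lies strictly between u^2 and (u +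
    1)^2. Four times the determinant is then no square, and neither is the determinant.\<close>
  define a where "a = m + \<bar>B\<bar>"
  define u where "u = 2 * a + B"
  define M where "M = (a, - A, C, a + B)"
  have det: "4 * idet M = u\<^sup>2 + m"
    by (simp add: M_def u_def m_def power2_eq_square algebra_simps)
  have u: "m \<le> u" using m by (simp add: u_def a_def)
  have pos: "idet M > 0" using det m zero_le_power2[of u] by linarith
  show ?thesis
  proof (rule that[OF pos])
    show "s * s \<noteq> idet M" for s
    proof
      assume "s * s = idet M"
      then have sq: "(2 * \<bar>s\<bar>)\<^sup>2 = u\<^sup>2 + m" using det by (simp add: power2_eq_square)
      have "u\<^sup>2 < (2 * \<bar>s\<bar>)\<^sup>2" unfolding sq using m by simp
      then have "u < 2 * \<bar>s\<bar>" by (rule power2_less_imp_less) simp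
      moreover have "(2 * \<bar>s\<bar>)\<^sup>2 < (u + 1)\<^sup>2" unfolding sq using u m by (simp add: power2_eq_square algebra_simps)
      then have "2 * \<bar>s\<bar> < u + 1" by (rule power2_less_imp_less) (use u m in simp)
      ultimately show False by simp
    qed
    have "of_int C * \<tau> + of_int (a + B) \<noteq> 0"
      using mob_denominator_nonzero(1)[OF t pos[unfolded M_def]] .
    moreover have "of_int a * \<tau> + of_int (- A) = \<tau> * (of_int C * \<tau> + of_int (a + B))"
    proof -
      have "of_int a * \<tau> + of_int (- A)
          = \<tau> * (of_int C * \<tau> + of_int (a + B)) - (of_int A + of_int B * \<tau> + of_int C * \<tau>\<^sup>2)"
        by (simp add: power2_eq_square algebra_simps)
      then show ?thesis unfolding eq by simp
    qed
    ultimately show "mob M \<tau> = \<tau>" unfolding M_def mob.simps by simp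
  qed
qed

text \<open>By translation and inversion, E2star(C \<tau>) and E2star(\<tau>/A) are multiples of one
  unknown u. The two multipliers are chosen so that u drops out; the remaining copies of
  \<open>E2star \<tau>\<close> add up to the factor (B + C \<tau>) + C \<tau>.\<close>

lemma CM_E2star:
  fixes \<tau> :: complex and A B C :: int
  assumes t: "Im \<tau> > 0" and eq: "of_int A + of_int B * \<tau> + of_int C * \<tau>\<^sup>2 = 0" and A: "A > 0"
  shows "(2 * of_int C * \<tau> + of_int B) * E2star \<tau>
    = - (of_int B + of_int C * \<tau>) * slash_diff (C, 0, 0, 1) \<tau> - of_int C * \<tau> * slash_diff (1, 0, 0, A) \<tau>"
proof -
  have t0: "\<tau> \<noteq> 0" using t by auto
  have A0: "(of_int A :: complex) \<noteq> 0" using A by simp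
  define u where "u = E2star (\<tau> / of_int A)"
  have neg: "\<tau> * (of_int C * \<tau> + of_int B) = - of_int A"
  proof -
    have "\<tau> * (of_int C * \<tau> + of_int B) = (of_int A + of_int B * \<tau> + of_int C * \<tau>\<^sup>2) - of_int A"
      by (simp add: power2_eq_square algebra_simps)
    then show ?thesis unfolding eq by simp
  qed
  have BC: "of_int B + of_int C * \<tau> = - of_int A / \<tau>"
    unfolding neg[symmetric] using t0 by (simp add: add.commute)
  then have "of_int C * \<tau> + of_int B = -1 / (\<tau> / of_int A)" by (simp add: add.commute)
  then have "E2star (of_int C * \<tau>) = E2star (-1 / (\<tau> / of_int A))"
    using E2star_translate[of "of_int C * \<tau>" B] by simp
  also have "\<dots> = (\<tau> / of_int A)\<^sup>2 * u"
    unfolding u_def using t A by (intro E2star_inversion) simp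
  finally have v: "E2star (of_int C * \<tau>) = (\<tau> / of_int A)\<^sup>2 * u" .
  have 1: "slash_diff (C, 0, 0, 1) \<tau> = of_int C * ((\<tau> / of_int A)\<^sup>2 * u) - E2star \<tau>"
    unfolding slash_diff_def by (simp add: v)
  have 2: "slash_diff (1, 0, 0, A) \<tau> = u / of_int A - E2star \<tau>"
    unfolding slash_diff_def using A0 by (simp add: u_def power2_eq_square)
  have "- (of_int B + of_int C * \<tau>) * (of_int C * ((\<tau> / of_int A)\<^sup>2 * u)) = of_int C * \<tau> * (u / of_int A)"
    unfolding BC using t0 A0 by (simp add: power2_eq_square)
  then show ?thesis unfolding 1 2 by (simp add: algebra_simps)
qed

theorem mainTheorem19:
  fixes \<tau> \<eta> :: complex and A B C :: int
  assumes "Im \<tau> > 0"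
    and "of_int A + of_int B * \<tau> + of_int C * \<tau>^2 = 0"
    and "gcd A (gcd B C) = 1"
    and "C > 0"
    and "1728 * \<eta>^24 = E4 \<tau> ^ 3 - E6 \<tau> ^ 2"
  shows "algebraic_integer ((2 * of_int C * \<tau> + of_int B) * (E2star \<tau> / \<eta>^4) * of_int ((A * C)^2))
       \<and> algebraic_integer (E4 \<tau> / \<eta>^8)
       \<and> algebraic_integer (E6 \<tau> / \<eta>^12)"
proof -
  note t = assms(1) and eq = assms(2) and C = assms(4)
  have disc: "disc \<tau> = \<eta> ^ 24" using assms(5) by (simp add: disc_def flip: assms(5))
  then have eta0: "\<eta> \<noteq> 0" using disc_nonzero[OF t] by auto
  obtain M where "idet M > 0" "mob M \<tau> = \<tau>" "\<And>s. s * s \<noteq> idet M" using CM_matrix[OF t eq C] by blast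
  then have j: "algebraic_int (jinv \<tau>)" by (rule algebraic_int_jinv[OF t])
  have pw: "(\<eta> ^ 8) ^ 3 = \<eta> ^ 24" "(\<eta> ^ 12) ^ 2 = \<eta> ^ 24" "(\<eta> ^ 4) ^ 6 = \<eta> ^ 24"
    by (simp_all flip: power_mult)
  have e4: "algebraic_int (E4 \<tau> / \<eta> ^ 8)"
    by (rule algebraic_int_power_imp[of _ 3]) (use j in \<open>simp_all add: power_divide pw jinv_def disc\<close>)
  \<comment> \<open>The difference E4^3 - E6^2 is 1728 \<open>disc\<close>, so E6^2 /
    \<open>disc\<close> is j - 1728.\<close>
  have e6sq: "(E6 \<tau> / \<eta> ^ 12) ^ 2 = jinv \<tau> - 1728"
    using assms(5) eta0 unfolding power_divide pw jinv_def disc by (simp add: field_simps)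
  have "algebraic_int ((E6 \<tau> / \<eta> ^ 12) ^ 2)"
    unfolding e6sq by (intro algebraic_int_diff j algebraic_int_numeral)
  then have e6: "algebraic_int (E6 \<tau> / \<eta> ^ 12)" by (rule algebraic_int_power_imp) simp
  \<comment> \<open>Positivity of A is what places diag(1, A) in \<open>hecke A\<close>.\<close>
  have "0 < 4 * A * C" using CM_discriminant_neg[OF t eq C] zero_le_power2[of B] by linarith
  then have A: "A > 0" using C by (simp add: zero_less_mult_iff)
  have s: "algebraic_int (of_int (idet M) * slash_diff M \<tau> / \<eta> ^ 4)" if "M \<in> hecke N" "N > 0" for M N
    by (rule algebraic_int_power_imp[of _ 6])
       (use algebraic_int_slash_ratio[OF t that(2,1) j] in \<open>simp_all add: slash_ratio_def power_divide pw disc\<close>)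
  have 1: "algebraic_int (of_int C * slash_diff (C, 0, 0, 1) \<tau> / \<eta> ^ 4)"
    using s[of "(C, 0, 0, 1)" C] C by (simp add: hecke_def)
  have 2: "algebraic_int (of_int A * slash_diff (1, 0, 0, A) \<tau> / \<eta> ^ 4)"
    using s[of "(1, 0, 0, A)" A] A by (simp add: hecke_def)
  \<comment> \<open>C \<tau> is a root of X^2 + B X + A C.\<close>
  have 3: "algebraic_int (of_int C * \<tau>)"
  proof (rule algebraic_int_integrally_closed[of "[:of_int (A * C), of_int B, 1:]"])
    have "poly [:of_int (A * C), of_int B, 1:] (of_int C * \<tau>) = of_int C * (of_int A + of_int B * \<tau> + of_int C * \<tau>\<^sup>2)"
      by (simp add: power2_eq_square algebra_simps)
    then show "poly [:of_int (A * C), of_int B, 1:] (of_int C * \<tau>) = 0" unfolding eq by simp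
    show "algebraic_int (coeff [:of_int (A * C), of_int B, 1:] i :: complex)" for i
      unfolding coeff_pCons by (simp split: nat.splits del: of_int_mult)
  qed simp
  have "(2 * of_int C * \<tau> + of_int B) * (E2star \<tau> / \<eta>^4) * of_int ((A * C)^2)
     = ((2 * of_int C * \<tau> + of_int B) * E2star \<tau>) * of_int ((A * C)^2) / \<eta>^4" by simp
  \<comment> \<open>The factor (A C)^2 is split as (A^2 C) C and (A C^2) A; the last factors C and A
    are the determinants that make the two \<open>slash_diff\<close> terms integral.\<close>
  also have "\<dots> = - (of_int B + of_int C * \<tau>) * of_int (A\<^sup>2 * C) * (of_int C * slash_diff (C, 0, 0, 1) \<tau> / \<eta> ^ 4)
        - of_int C * \<tau> * of_int (A * C\<^sup>2) * (of_int A * slash_diff (1, 0, 0, A) \<tau> / \<eta> ^ 4)"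
    unfolding CM_E2star[OF t eq A] by (simp add: power2_eq_square algebra_simps diff_divide_distrib add_divide_distrib)
  also have "algebraic_int \<dots>"
    by (intro algebraic_int_diff algebraic_int_mult algebraic_int_minus algebraic_int_add algebraic_int_of_int 1 2 3)
  finally show ?thesis using e4 e6 by (simp add: algebraic_integer_iff)
qed

end
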